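(* Let $A=A'>0$ and $B=B'>0$ be real $p\times p$ matrices, and let $\mathrm{Re}(\gamma\pm\beta)>\frac{p-3}{4}$ and $\mathrm{Re}(\beta-\alpha)>\frac{p-3}{4}$. Then, the integral being over real symmetric positive definite $p\times p$ matrices $Z=Z'>0$, $$\int_{Z>0}|Z|^{\gamma-\frac{p+1}{2}}e^{-\mathrm{tr}(AZ)}W_{\alpha,\beta}(BZ)\,dZ=\left|A+\tfrac12B\right|^{-(\gamma+\beta+\frac{p+1}{4})}\frac{\Gamma_p(\gamma+\beta+\frac{p+1}{4})\,\Gamma_p(\gamma-\beta+\frac{p+1}{4})}{\Gamma_p(\gamma-\alpha+\frac{p+1}{2})}$$ $$\times\;{}_2F_1\!\left(\tfrac{p+1}{4}+\beta-\alpha,\ \tfrac{p+1}{4}+\gamma+\beta;\ \tfrac{p+1}{2}+\gamma-\alpha;\ I-B^{1/2}(A+\tfrac12B)^{-1}B^{1/2}\right)$$ for $0<B^{1/2}(A+\frac12B)^{-1}B^{1/2}<I$ or $2B^{-1/2}AB^{-1/2}>I$; and the same integral equals $$|B|^{-(\gamma+\beta+\frac{p+1}{4})}\,\frac{\Gamma_p(\frac{p+1}{4}+\gamma+\beta)\,\Gamma_p(\frac{p+1}{4}+\gamma-\beta)}{\Gamma_p(\frac{p+1}{2}+\gamma-\alpha)}\;{}_2F_1\!\left(\tfrac{p+1}{4}+\gamma-\beta,\ \tfrac{p+1}{4}+\gamma+\beta;\ \tfrac{p+1}{2}+\gamma-\alpha;\ -C\right)$$ for $\|C\|<1$, where $C=B^{-1/2}AB^{-1/2}-\frac12I$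 and $\|(\cdot)\|$ denotes a norm of $(\cdot)$. A sufficient condition is that $$0<B^{-1/2}AB^{-1/2}-\tfrac12I<I\quad\text{or}\quad 0<\tfrac12I-B^{-1/2}AB^{-1/2}<I.$$
   Context: For real symmetric matrices, $A>0$ means positive definite and $A<B$ means $B-A>0$; $A^{1/2}$ is the positive definite square root of $A>0$; $|A|$ is the determinant. Integrals over (subsets of) real symmetric $p\times p$ matrices are with respect to $dZ=\prod_{i\le j}dz_{ij}$. The real matrix-variate gamma function is $$\Gamma_p(\alpha)=\pi^{p(p-1)/4}\,\Gamma(\alpha)\,\Gamma\!\left(\alpha-\tfrac12\right)\cdots\Gamma\!\left(\alpha-\tfrac{p-1}{2}\right)=\int_{X=X'>0}|X|^{\alpha-\frac{p+1}{2}}e^{-\mathrm{tr}(X)}dX,\quad \mathrm{Re}(\alpha)>\tfrac{p-1}{2}.$$ The Whittaker function of matrix argument $W_{\alpha,\beta}(A)$, for $A=A'>0$ and $\mathrm{Re}(\beta-\alpha)>\frac{p-3}{4}$, is defined by $$\int_{Z=Z'>0}|Z|^{\beta-\alpha-\frac{p+1}{4}}|I+Z|^{\alpha+\beta-\frac{p+1}{4}}e^{-\mathrm{tr}(AZ)}dZ=|A|^{-\beta-\frac{p+1}{4}}\,\Gamma_p\!\left(\beta-\alpha+\tfrac{p+1}{4}\right)e^{\frac12\mathrm{tr}(A)}\,W_{\alpha,\beta}(A);$$ for $B>0$, $Z>0$, $W_{\alpha,\beta}(BZ)$ is understood as the value at the symmetric matrix $B^{1/2}ZB^{1/2}$. The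 Gauss hypergeometric function of matrix argument has, for real symmetric $X<I$, $\mathrm{Re}(a)>\frac{p-1}{2}$, $\mathrm{Re}(c-a)>\frac{p-1}{2}$, the integral representation $${}_2F_1(a,b;c;X)=\frac{\Gamma_p(c)}{\Gamma_p(a)\Gamma_p(c-a)}\int_{0<U=U'<I}|U|^{a-\frac{p+1}{2}}|I-U|^{c-a-\frac{p+1}{2}}|I-XU|^{-b}\,dU.$$
   Formalization: Both closed forms carry an extra factor |B|^{β+(p+1)/4} missing from the printed formulas, which are false without it: for p=1, α=0, β=1/2, γ=1, A=B=2 the integral is 1/3, but both printed right-hand sides equal 1/6. *)

theory Defs
  imports "HOL-Analysis.Analysis"
begin

text \<open>
  Real \<open>p \<times> p\<close> matrices are elements of \<open>real^'n^'n\<close> with \<open>p = CARD('n)\<close>.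
\<close>

definition pos_def :: "real^'n^'n \<Rightarrow> bool" where
  "pos_def A \<longleftrightarrow> transpose A = A \<and> (\<forall>x. x \<noteq> 0 \<longrightarrow> x \<bullet> (A *v x) > 0)"

definition loewner_less :: "real^'n^'n \<Rightarrow> real^'n^'n \<Rightarrow> bool" (infix "\<prec>\<^sub>L" 50) where
  "A \<prec>\<^sub>L B \<longleftrightarrow> pos_def (B - A)"

text \<open>Only meaningful for positive definite \<open>A\<close>.\<close>

definition msqrt :: "real^'n^'n \<Rightarrow> real^'n^'n" where
  "msqrt A = (THE R. pos_def R \<and> R ** R = A)"

text \<open>\<open>|A|\<^sup>s\<close> for a complex exponent; every use has \<open>det A > 0\<close>, where this is \<open>exp (s * ln (det A))\<close>.\<close>

definition det_powr :: "real^'n^'n \<Rightarrow> complex \<Rightarrow> complex" where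
  "det_powr A s = complex_of_real (det A) powr s"

text \<open>
  The measure \<open>dZ\<close>, the product of the \<open>dz\<^sub>i\<^sub>j\<close> over \<open>i \<le> j\<close>. To avoid choosing a linear order on the index type,
  the independent entries of a symmetric matrix are indexed by the sets \<open>{i, j}\<close> (\<open>i = j\<close> allowed)
  instead of the pairs \<open>i \<le> j\<close>; each such set corresponds to exactly one such pair.
\<close>

definition sym_indices :: "'n set set" where
  "sym_indices = {{i, j} | i j. True}"

definition sym_matrix :: "('n set \<Rightarrow> real) \<Rightarrow> real^'n^'n" where
  "sym_matrix z = (\<chi> i j. z {i, j})"

definition sym_lborel :: "(real^'n^'n) measure" where
  "sym_lborel = distr (Pi\<^sub>M sym_indices (\<lambda>_. lborel)) borel sym_matrix"

lemma measurable_sym_matrix [measurable]: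
  "sym_matrix \<in> borel_measurable (Pi\<^sub>M (sym_indices :: 'n::finite set set) (\<lambda>_. lborel))"
proof -
  have *: "(\<lambda>z. z {i, j}) \<in> borel_measurable (Pi\<^sub>M sym_indices (\<lambda>_. lborel :: real measure))"
    for i j :: 'n
  proof -
    have "{i, j} \<in> sym_indices"
      by (auto simp: sym_indices_def)
    from measurable_component_singleton[OF this, of "\<lambda>_. lborel :: real measure"] show ?thesis
      by simp
  qed
  have "(\<lambda>z. sym_matrix z \<bullet> b) \<in> borel_measurable (Pi\<^sub>M sym_indices (\<lambda>_. lborel))"
    if "b \<in> Basis" for b :: "real^'n^'n"
    using that * by (auto simp: sym_matrix_def Basis_vec_def inner_axis)
  then show ?thesis
    by (subst borel_measurable_euclidean_space) auto
qed

text \<open>The real matrix-variate gamma function \<open>\<Gamma>\<^sub>p\<close>.\<close>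

definition mv_Gamma :: "nat \<Rightarrow> complex \<Rightarrow> complex" where
  "mv_Gamma p \<alpha> =
     complex_of_real (pi powr (real p * (real p - 1) / 4)) * (\<Prod>j<p. Gamma (\<alpha> - of_nat j / 2))"

text \<open>
  The Whittaker function of matrix argument \<open>W\<^bsub>\<alpha>,\<beta>\<^esub>(A)\<close>, its defining equation solved for the
  function value. Meaningful for \<open>A\<close> positive definite and \<open>Re (\<beta> - \<alpha>) > (p - 3) / 4\<close>.
\<close>

definition mv_Whittaker :: "complex \<Rightarrow> complex \<Rightarrow> real^'n^'n \<Rightarrow> complex" where
  "mv_Whittaker \<alpha> \<beta> A =
     (let q = (of_nat CARD('n) + 1) / 4 in
        det_powr A (\<beta> + q) * exp (- of_real (trace A / 2)) / mv_Gamma CARD('n) (\<beta> - \<alpha> + q) *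
        (LINT Z:{Z. pos_def Z}|sym_lborel.
           det_powr Z (\<beta> - \<alpha> - q) * det_powr (mat 1 + Z) (\<alpha> + \<beta> - q) *
           exp (- of_real (trace (A ** Z)))))"

text \<open>
  The Gauss hypergeometric function of matrix argument through its Euler integral. Meaningful for
  symmetric \<open>X\<close> with \<open>X \<prec>\<^sub>L mat 1\<close>, \<open>Re a > (p - 1) / 2\<close> and \<open>Re (c - a) > (p - 1) / 2\<close>; then
  \<open>det (mat 1 - X ** U) = det (mat 1 - msqrt U ** X ** msqrt U)\<close> is positive on the domain of
  integration.
\<close>

definition mv_hyp2F1 :: "complex \<Rightarrow> complex \<Rightarrow> complex \<Rightarrow> real^'n^'n \<Rightarrow> complex" where
  "mv_hyp2F1 a b c X =
     (let p = CARD('n); h = (of_nat p + 1) / 2 in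
        mv_Gamma p c / (mv_Gamma p a * mv_Gamma p (c - a)) *
        (LINT U:{U. 0 \<prec>\<^sub>L U \<and> U \<prec>\<^sub>L mat 1}|sym_lborel.
           det_powr U (a - h) * det_powr (mat 1 - U) (c - a - h) * det_powr (mat 1 - X ** U) (- b)))"

text \<open>An arbitrary vector space norm on matrices (in particular every submultiplicative one).\<close>

definition is_norm :: "(real^'n^'n \<Rightarrow> real) \<Rightarrow> bool" where
  "is_norm \<nu> \<longleftrightarrow>
     (\<forall>X. \<nu> X = 0 \<longleftrightarrow> X = 0) \<and>
     (\<forall>c X. \<nu> (c *\<^sub>R X) = \<bar>c\<bar> * \<nu> X) \<and>
     (\<forall>X Y. \<nu> (X + Y) \<le> \<nu> X + \<nu> Y)"

text \<open>
  In the main statement both closed forms carry the factor \<open>|B|\<close> to the power \<open>\<beta> + (p + 1) / 4\<close>,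
  absent from the formulas as printed. It comes from the same power of the determinant in the
  Whittaker function, evaluated at \<open>B\<^sup>1\<^sup>/\<^sup>2 Z B\<^sup>1\<^sup>/\<^sup>2\<close>, and cannot be omitted: replacing \<open>(A, B)\<close> by
  \<open>(t A, t B)\<close> multiplies the integral by \<open>t\<close> to the power \<open>- p \<gamma>\<close>. For instance, with \<open>p = 1\<close>,
  \<open>\<alpha> = 0\<close>, \<open>\<beta> = 1/2\<close>, \<open>\<gamma> = 1\<close>, \<open>A = B = 2\<close> one has \<open>W(z) = exp (- z / 2)\<close>, the integral is \<open>1/3\<close>,
  and both closed forms without that factor are \<open>1/6\<close>.
\<close>

end

theory Submission
  imports Defs "HOL-Probability.Distributions"
begin

text \<open>
  Write \<open>p\<close> for the dimension, \<open>q = (p + 1) / 4\<close> and \<open>b = \<beta> - \<alpha> + q\<close>, \<open>\<delta> = \<gamma> + \<beta> + q\<close>, \<open>a = \<gamma> - \<beta> + q\<close>,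
  \<open>c = a + b\<close>. Insert the integral defining the Whittaker function and integrate over \<open>Z\<close> first: this is a
  matrix gamma integral, so
  \<open>\<integral> |Z|\<^bsup>\<delta> - 2q\<^esup> exp (- tr ((A + B/2 + B\<^sup>1\<^sup>/\<^sup>2 Y B\<^sup>1\<^sup>/\<^sup>2) Z)) dZ = \<Gamma>\<^sub>p(\<delta>) |B|\<^bsup>- \<delta>\<^esup> |D + Y|\<^bsup>- \<delta>\<^esup>\<close> with \<open>D = I + C\<close>, and what
  remains is \<open>\<integral> |Y|\<^bsup>b - 2q\<^esup> |I + Y|\<^bsup>\<delta> - c\<^esup> |D + Y|\<^bsup>- \<delta>\<^esup> dY\<close> over \<open>Y > 0\<close>
  (\<open>Whittaker_Laplace_transform\<close>). The substitution \<open>I + Y = U\<^sup>-\<^sup>1\<close>, with Jacobian \<open>|U|\<^bsup>- (p + 1)\<^esup>\<close>, turns this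
  into the Euler integral of the hypergeometric function with parameters \<open>a\<close>, \<open>\<delta>\<close>, \<open>c\<close> at \<open>- C\<close>
  (\<open>integral_pos_def_eq_Euler_integral\<close>), which is the second closed form. Replacing \<open>U\<close> by \<open>I - U\<close>
  takes out the factor \<open>|D|\<^bsup>- \<delta>\<^esup>\<close> and yields the hypergeometric function with parameters \<open>b\<close>, \<open>\<delta>\<close>, \<open>c\<close> at
  \<open>I - D\<^sup>-\<^sup>1\<close> (\<open>Euler_integral_reflect\<close>); this is the first closed form, because \<open>M = D\<^sup>-\<^sup>1\<close>. The matrices
  \<open>D\<close> and \<open>I + C U\<close> that occur have positive determinants because \<open>C > - I/2\<close>.

  The exchange of integrals rests on absolute convergence. The remaining integral is dominated by a matrix
  beta integral, which is finite since it is a quotient of gamma integrals; the comparison of determinants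
  that it needs is itself read off from the gamma integral (\<open>det_powr_antimono\<close>).

  Three facts about Lebesgue measure on symmetric matrices carry the argument, all obtained from maps that
  move one group of entries affinely while the others stay fixed, and from \<open>x \<mapsto> - 1/x\<close> on a single entry:
  \<^item> the congruence \<open>Z \<mapsto> L Z L\<^sup>T\<close> has Jacobian \<open>|det L|\<^bsup>p + 1\<^esup>\<close>, by decomposing \<open>L\<close> into elementary matrices
    (\<open>nn_integral_congruence\<close>);
  \<^item> inversion has Jacobian \<open>|Z|\<^bsup>- (p + 1)\<^esup>\<close>, by writing \<open>- Z\<^sup>-\<^sup>1\<close> as the result of sweeping \<open>Z\<close> at every index:
    each sweep contributes a power of its pivot, and the pivots multiply up to the determinant
    (\<open>nn_integral_pos_def_inverse\<close>);
  \<^item> the gamma integral is the product of one-dimensional Gamma functions, by removing one row and column at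
    a time in coordinates in which the integrand factorises (\<open>has_bochner_integral_mv_Gamma\<close>).
\<close>

section \<open>Substitutions in products of Lebesgue measure\<close>

abbreviation PiL :: "'i set \<Rightarrow> ('i \<Rightarrow> real) measure" where
  "PiL I \<equiv> Pi\<^sub>M I (\<lambda>_. lborel)"

interpretation lebesgue_product: product_sigma_finite "\<lambda>_. lborel :: real measure" ..

text \<open>
  Only the nonnegative form is proved here: it determines the measure, and so yields the substitution
  rule for complex integrands later.
\<close>

lemma nn_integral_PiL_affine:
  assumes "finite J" and "\<And>j. j \<in> J \<Longrightarrow> a j \<noteq> 0" and "f \<in> borel_measurable (PiL J)"
  shows "(\<integral>\<^sup>+z. f z \<partial>PiL J) =
    (\<integral>\<^sup>+z. ennreal (\<Prod>j\<in>J. \<bar>a j\<bar>) * f (\<lambda>j\<in>J. a j * z j + b j) \<partial>PiL J)"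
  using assms
proof (induction J arbitrary: f rule: finite_induct)
  case empty
  then show ?case by (auto simp: PiM_empty nn_integral_count_space_finite)
next
  case (insert k J)
  note [measurable] = insert.prems(2)
  have [measurable]: "(\<lambda>z. \<lambda>j\<in>insert k J. a j * z j + b j) \<in> PiL (insert k J) \<rightarrow>\<^sub>M PiL (insert k J)"
    by (rule measurable_restrict) measurable
  have [measurable]: "(\<lambda>z. \<lambda>j\<in>J. a j * z j + b j) \<in> PiL J \<rightarrow>\<^sub>M PiL J"
    by (rule measurable_restrict) measurable
  define g where "g x = (\<integral>\<^sup>+y. f (x(k := y)) \<partial>lborel)" for x
  have upd[measurable]: "(\<lambda>w. (fst w)(k := snd w)) \<in> PiL J \<Otimes>\<^sub>M lborel \<rightarrow>\<^sub>M PiL (insert k J)"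
    using measurable_add_dim[of k J "\<lambda>_. lborel :: real measure"] by (simp add: case_prod_unfold)
  have [measurable]: "g \<in> borel_measurable (PiL J)"
    unfolding g_def
    using measurable_compose[OF upd insert.prems(2)]
    by (intro lborel.borel_measurable_nn_integral) (simp add: case_prod_unfold)
  \<comment> \<open>The new coordinate is integrated innermost, where the one-dimensional affine substitution applies.\<close>
  have inner: "ennreal \<bar>a k\<bar> * (\<integral>\<^sup>+y. f (X(k := a k * y + b k)) \<partial>lborel) = g X"
    if X: "X \<in> space (PiL J)" for X
  proof -
    have [measurable]: "(\<lambda>y. f (X(k := y))) \<in> borel_measurable borel"
      using measurable_compose[OF measurable_Pair1'[OF X, of lborel] measurable_compose[OF upd insert.prems(2)]]
      by (simp add: fun_upd_def)
    show ?thesis unfolding g_def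
      by (subst (2) nn_integral_real_affine[of _ "a k" "b k"])
        (use insert.prems in \<open>auto simp: add.commute\<close>)
  qed
  have "(\<integral>\<^sup>+z. ennreal (\<Prod>j\<in>insert k J. \<bar>a j\<bar>) * f (\<lambda>j\<in>insert k J. a j * z j + b j) \<partial>PiL (insert k J))
     = (\<integral>\<^sup>+x. (\<integral>\<^sup>+y. ennreal (\<Prod>j\<in>insert k J. \<bar>a j\<bar>)
           * f ((\<lambda>j\<in>insert k J. a j * (x(k := y)) j + b j)) \<partial>lborel) \<partial>PiL J)"
    using insert.hyps by (subst lebesgue_product.product_nn_integral_insert) auto
  also have "\<dots> = (\<integral>\<^sup>+x. ennreal (\<Prod>j\<in>J. \<bar>a j\<bar>) * g (\<lambda>j\<in>J. a j * x j + b j) \<partial>PiL J)"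
  proof (rule nn_integral_cong)
    fix x assume x: "x \<in> space (PiL J)"
    let ?X = "\<lambda>j\<in>J. a j * x j + b j"
    have X: "?X \<in> space (PiL J)" by (auto simp: space_PiM)
    have eq: "(\<lambda>j\<in>insert k J. a j * (x(k := y)) j + b j) = ?X(k := a k * y + b k)" for y
      using insert.hyps by (auto simp: restrict_def fun_eq_iff)
    have [measurable]: "(\<lambda>y. f (?X(k := y))) \<in> borel_measurable borel"
      using measurable_compose[OF measurable_Pair1'[OF X, of lborel] measurable_compose[OF upd insert.prems(2)]]
      by (simp add: fun_upd_def)
    show "(\<integral>\<^sup>+y. ennreal (\<Prod>j\<in>insert k J. \<bar>a j\<bar>)
           * f ((\<lambda>j\<in>insert k J. a j * (x(k := y)) j + b j)) \<partial>lborel)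
       = ennreal (\<Prod>j\<in>J. \<bar>a j\<bar>) * g ?X"
      unfolding eq inner[OF X, symmetric]
      using insert.hyps
      by (subst nn_integral_cmult) (measurable, simp add: prod_nonneg ennreal_mult mult_ac)
  qed
  also have "\<dots> = (\<integral>\<^sup>+x. g x \<partial>PiL J)"
    by (rule insert.IH[symmetric]) (use insert.prems in auto)
  also have "\<dots> = (\<integral>\<^sup>+z. f z \<partial>PiL (insert k J))"
    unfolding g_def using insert.hyps
    by (subst lebesgue_product.product_nn_integral_insert) auto
  finally show ?case by (rule sym)
qed

lemma measurable_PiL_fibre_affine:
  assumes "\<And>j. j \<in> J \<Longrightarrow> (\<lambda>z. a z j) \<in> borel_measurable (PiL K)"
    and "\<And>j. j \<in> J \<Longrightarrow> (\<lambda>z. b z j) \<in> borel_measurable (PiL K)"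
  shows "(\<lambda>z. \<lambda>i\<in>K. if i \<in> J then a z i * z i + b z i else z i) \<in> PiL K \<rightarrow>\<^sub>M PiL K"
proof (rule measurable_restrict)
  fix i assume "i \<in> K"
  then show "(\<lambda>z. if i \<in> J then a z i * z i + b z i else z i) \<in> PiL K \<rightarrow>\<^sub>M lborel"
    using assms by (cases "i \<in> J") auto
qed

lemma measurable_PiL_component: "e \<in> K \<Longrightarrow> (\<lambda>z. z e) \<in> borel_measurable (PiL K)"
  using measurable_component_singleton[of e K "\<lambda>_. lborel :: real measure"] by simp

text \<open>
  The maps used below are composed of one-dimensional inversions and of steps that move a set \<open>J\<close> of
  coordinates affinely, with coefficients depending on the remaining ones. By Tonelli such a step can be
  treated fibre by fibre.
\<close>

lemma nn_integral_PiL_fibre_affine: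
  assumes K: "finite K" "J \<subseteq> K"
    and dep: "\<And>z z' j. (\<And>i. i \<in> K - J \<Longrightarrow> z i = z' i) \<Longrightarrow> j \<in> J \<Longrightarrow> a z j = a z' j \<and> b z j = b z' j"
    and nz: "\<And>z j. j \<in> J \<Longrightarrow> a z j \<noteq> 0"
    and meas: "\<And>j. j \<in> J \<Longrightarrow> (\<lambda>z. a z j) \<in> borel_measurable (PiL K)"
      "\<And>j. j \<in> J \<Longrightarrow> (\<lambda>z. b z j) \<in> borel_measurable (PiL K)"
    and f[measurable]: "f \<in> borel_measurable (PiL K)"
  shows "(\<integral>\<^sup>+z. f z \<partial>PiL K) = (\<integral>\<^sup>+z. ennreal (\<Prod>j\<in>J. \<bar>a z j\<bar>) *
      f (\<lambda>i\<in>K. if i \<in> J then a z i * z i + b z i else z i) \<partial>PiL K)"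
proof -
  define I where "I = K - J"
  have IJ: "I \<inter> J = {}" "finite I" "finite J" and KIJ: "K = I \<union> J"
    using K by (auto simp: I_def intro: finite_subset)
  have m1[measurable]: "(\<lambda>z. \<lambda>i\<in>K. if i \<in> J then a z i * z i + b z i else z i) \<in> PiL K \<rightarrow>\<^sub>M PiL K"
    by (rule measurable_PiL_fibre_affine) (use meas in auto)
  have m2[measurable]: "(\<lambda>z. \<Prod>j\<in>J. \<bar>a z j\<bar>) \<in> borel_measurable (PiL K)"
    using meas by (intro borel_measurable_prod) auto
  have m3: "(\<lambda>z. ennreal (\<Prod>j\<in>J. \<bar>a z j\<bar>) *
      f (\<lambda>i\<in>K. if i \<in> J then a z i * z i + b z i else z i)) \<in> borel_measurable (PiL K)"
    by measurable
  show ?thesis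
    unfolding KIJ
    apply (subst lebesgue_product.product_nn_integral_fold[OF IJ f[unfolded KIJ]])
    apply (subst lebesgue_product.product_nn_integral_fold[OF IJ m3[unfolded KIJ]])
  proof (rule nn_integral_cong)
    fix x assume x: "x \<in> space (PiL I)"
    \<comment> \<open>On a fibre the coefficients are constant; they are read off with an arbitrary filling of the
      coordinates in \<open>J\<close>.\<close>
    define A where "A = a (merge I J (x, \<lambda>_. 0))"
    define D where "D = b (merge I J (x, \<lambda>_. 0))"
    have AD: "a (merge I J (x, y)) j = A j" "b (merge I J (x, y)) j = D j" if "j \<in> J" for y j
      using dep[of "merge I J (x, y)" "merge I J (x, \<lambda>_. 0)" j] that IJ
      by (auto simp: A_def D_def I_def merge_def)
    have [measurable]: "(\<lambda>y. f (merge I J (x, y))) \<in> borel_measurable (PiL J)"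
      by (rule measurable_compose[OF measurable_compose[OF measurable_Pair1'[OF x] measurable_merge]])
        (use f KIJ in simp)
    have "(\<integral>\<^sup>+y. f (merge I J (x, y)) \<partial>PiL J) = (\<integral>\<^sup>+y. ennreal (\<Prod>j\<in>J. \<bar>A j\<bar>) *
        f (merge I J (x, \<lambda>j\<in>J. A j * y j + D j)) \<partial>PiL J)"
      by (rule nn_integral_PiL_affine) (use IJ nz in \<open>auto simp: A_def\<close>)
    also have "\<dots> = (\<integral>\<^sup>+y. ennreal (\<Prod>j\<in>J. \<bar>a (merge I J (x, y)) j\<bar>) *
      f (\<lambda>i\<in>I \<union> J. if i \<in> J then a (merge I J (x, y)) i * merge I J (x, y) i + b (merge I J (x, y)) i
         else merge I J (x, y) i) \<partial>PiL J)"
    proof (intro nn_integral_cong arg_cong2[where f="(*)"] arg_cong[where f=f] arg_cong[where f=ennreal])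
      fix y
      show "(\<Prod>j\<in>J. \<bar>A j\<bar>) = (\<Prod>j\<in>J. \<bar>a (merge I J (x, y)) j\<bar>)"
        by (intro prod.cong) (auto simp: AD)
      show "merge I J (x, \<lambda>j\<in>J. A j * y j + D j) = (\<lambda>i\<in>I \<union> J. if i \<in> J
          then a (merge I J (x, y)) i * merge I J (x, y) i + b (merge I J (x, y)) i
          else merge I J (x, y) i)"
        using IJ by (auto simp: fun_eq_iff AD restrict_def)
    qed
    finally show "(\<integral>\<^sup>+y. f (merge I J (x, y)) \<partial>PiL J) = (\<integral>\<^sup>+y. ennreal (\<Prod>j\<in>J. \<bar>a (merge I J (x, y)) j\<bar>) *
      f (\<lambda>i\<in>I \<union> J. if i \<in> J then a (merge I J (x, y)) i * merge I J (x, y) i + b (merge I J (x, y)) i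
         else merge I J (x, y) i) \<partial>PiL J)" .
  qed
qed

text \<open>
  On an interval not meeting \<open>0\<close> the map \<open>- 1/x\<close> is smooth and increasing.
\<close>

lemma nn_integral_neg_inverse_interval:
  fixes f :: "real \<Rightarrow> real"
  assumes [measurable]: "f \<in> borel_measurable borel" and a: "0 < a * b" "a \<le> b"
  shows "(\<integral>\<^sup>+x. f x * indicator {-1/a..-1/b} x \<partial>lborel) =
    (\<integral>\<^sup>+x. f (-1/x) * (1/x\<^sup>2) * indicator {a..b} x \<partial>lborel)"
proof -
  have nz: "x \<noteq> 0" if "a \<le> x" "x \<le> b" for x
    using a that by (auto simp: zero_less_mult_iff)
  show ?thesis
    using a
    by (intro nn_integral_substitution)
      (auto dest!: nz intro!: derivative_eq_intros continuous_intros
        simp: field_simps power2_eq_square set_borel_measurable_def)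
qed

lemma nn_integral_neg_inverse_half:
  fixes f :: "real \<Rightarrow> real" and \<sigma> :: real
  assumes f[measurable]: "f \<in> borel_measurable borel" and nn: "\<And>x. f x \<ge> 0" and \<sigma>: "\<sigma> = 1 \<or> \<sigma> = -1"
  shows "(\<integral>\<^sup>+x. f x * indicator {x. \<sigma> * x < 0} x \<partial>lborel) =
    (\<integral>\<^sup>+x. f (-1/x) * (1/x\<^sup>2) * indicator {x. \<sigma> * x > 0} x \<partial>lborel)"
proof -
  \<comment> \<open>Compact intervals exhausting the open half lines, away from \<open>0\<close> and infinity; \<open>- 1/x\<close> carries
    \<open>D n\<close> to \<open>E n\<close>.\<close>
  define D where "D n = (if \<sigma> = 1 then {1 / real (Suc n)..real (Suc n)} else {- real (Suc n)..- 1 / real (Suc n)})" for n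
  define E where "E n = (if \<sigma> = 1 then {- real (Suc n)..- 1 / real (Suc n)} else {1 / real (Suc n)..real (Suc n)})" for n
  have step: "(\<integral>\<^sup>+x. f x * indicator (E n) x \<partial>lborel) =
    (\<integral>\<^sup>+x. f (-1/x) * (1/x\<^sup>2) * indicator (D n) x \<partial>lborel)" for n
  proof -
    have q: "-1 / (1 / real (Suc n)) = - real (Suc n)" "-1 / (- real (Suc n)) = 1 / real (Suc n)"
      "-1 / (- 1 / real (Suc n)) = real (Suc n)"
      by (simp_all add: field_simps)
    show ?thesis
      using nn_integral_neg_inverse_interval[OF f, of "1 / real (Suc n)" "real (Suc n)"]
        nn_integral_neg_inverse_interval[OF f, of "- real (Suc n)" "- 1 / real (Suc n)"] \<sigma>
      unfolding D_def E_def q by (auto simp: field_simps)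
  qed
  have anti: "1 / real (Suc m) \<le> 1 / real (Suc n)" if "n \<le> m" for m n
    using that by (simp add: field_simps)
  have mono: "incseq D" "incseq E"
    using \<sigma> by (auto simp: incseq_def D_def E_def intro: order_trans[OF anti] order_trans[OF _ anti])
      (auto dest: anti)
  have ex: "\<exists>n. 1 / real (Suc n) \<le> x \<and> x \<le> real (Suc n)" if "x > 0" for x
  proof -
    obtain n where n: "real n \<ge> x" "real n \<ge> 1 / x"
      using real_arch_simple[of "max x (1/x)"] by auto
    have "1 / x \<le> real (Suc n)" using n by simp
    then have "1 / real (Suc n) \<le> x" using that by (simp add: field_simps)
    then show ?thesis using n by (intro exI[of _ n]) auto
  qed
  have ex': "\<exists>n. - real (Suc n) \<le> x \<and> x \<le> - 1 / real (Suc n)" if neg: "x < 0" for x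
  proof -
    obtain n where "1 / real (Suc n) \<le> - x \<and> - x \<le> real (Suc n)" using ex[of "-x"] neg by auto
    then show ?thesis by (intro exI[of _ n]) auto
  qed
  have pos: "0 < x" if "1 / (1 + real n) \<le> x" for x n
    using that by (rule less_le_trans[rotated]) simp
  have neg: "x < 0" if "x \<le> - (1 / (1 + real n))" for x n
    using that by (rule le_less_trans) simp
  have UD: "(\<Union>n. D n) = {x. \<sigma> * x > 0}"
  proof (intro set_eqI iffI)
    fix x assume "x \<in> {x. \<sigma> * x > 0}"
    then show "x \<in> (\<Union>n. D n)" using \<sigma> ex[of x] ex'[of x] by (auto simp: D_def)
  qed (use \<sigma> in \<open>auto simp: D_def dest: pos neg\<close>)
  have UE: "(\<Union>n. E n) = {x. \<sigma> * x < 0}"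
  proof (intro set_eqI iffI)
    fix x assume "x \<in> {x. \<sigma> * x < 0}"
    then show "x \<in> (\<Union>n. E n)" using \<sigma> ex[of x] ex'[of x] by (auto simp: E_def)
  qed (use \<sigma> in \<open>auto simp: E_def dest: pos neg\<close>)
  have lim: "(\<integral>\<^sup>+x. g x * indicator (\<Union>n. S n) x \<partial>lborel) = (SUP n. \<integral>\<^sup>+x. g x * indicator (S n) x \<partial>lborel)"
    if "incseq S" "\<And>n. S n \<in> sets borel" "g \<in> borel_measurable borel" "\<And>x. g x \<ge> 0"
    for g :: "real \<Rightarrow> real" and S
  proof -
    have "(\<integral>\<^sup>+x. ennreal (g x) * indicator (\<Union>n. S n) x \<partial>lborel) = emeasure (density lborel g) (\<Union>n. S n)"
      using that by (subst emeasure_density) auto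
    also have "\<dots> = (SUP n. emeasure (density lborel g) (S n))"
      using that by (intro SUP_emeasure_incseq[symmetric]) auto
    also have "\<dots> = (SUP n. \<integral>\<^sup>+x. ennreal (g x) * indicator (S n) x \<partial>lborel)"
      using that by (subst emeasure_density) auto
    finally show ?thesis using that by (simp add: ennreal_mult' ennreal_indicator)
  qed
  show ?thesis
    unfolding UD[symmetric] UE[symmetric]
    using lim[of E f] lim[of D "\<lambda>x. f (-1/x) * (1/x\<^sup>2)"] mono step nn
    by (simp add: D_def E_def)
qed

lemma lborel_neg_inverse:
  "lborel = distr (density lborel (\<lambda>x. ennreal (1/x\<^sup>2))) borel (\<lambda>x::real. -1/x)"
proof (rule measure_eqI)
  fix A assume "A \<in> sets (lborel :: real measure)"
  then have [measurable]: "A \<in> sets borel" by simp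
  have pre: "(/) (-1 :: real) -` A \<in> sets borel"
  proof -
    have "(\<lambda>x::real. -1/x) \<in> borel_measurable borel" by measurable
    from measurable_sets[OF this \<open>A \<in> sets borel\<close>] show ?thesis
      by (simp only: space_borel Int_UNIV_right)
  qed
  let ?f = "indicator A :: real \<Rightarrow> real"
  have split: "(\<integral>\<^sup>+x. g x \<partial>lborel) = (\<integral>\<^sup>+x. g x * indicator {x. 1 * x < 0} x \<partial>lborel) +
      (\<integral>\<^sup>+x. g x * indicator {x. -1 * x < 0} x \<partial>lborel)"
    if [measurable]: "g \<in> borel_measurable borel" "\<And>x. g x \<ge> 0" for g :: "real \<Rightarrow> real"
  proof -
    have "g x = g x * indicator {x. 1 * x < 0} x + g x * indicator {x. -1 * x < 0} x" if "x \<noteq> 0" for x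
      using that by (cases "x < 0") (auto simp: indicator_def)
    then have "AE x in lborel. ennreal (g x) = ennreal (g x * indicator {x. 1 * x < 0} x)
        + ennreal (g x * indicator {x. -1 * x < 0} x)"
      using that(2) by (intro AE_I[where N="{0}"]) (auto simp flip: ennreal_plus)
    from nn_integral_cong_AE[OF this] show ?thesis
      by (simp add: nn_integral_add)
  qed
  have "emeasure lborel A = (\<integral>\<^sup>+x. ?f x \<partial>lborel)"
    by (simp add: ennreal_indicator)
  also have "\<dots> = (\<integral>\<^sup>+x. ?f (-1/x) * (1/x\<^sup>2) * indicator {x. 1 * x > 0} x \<partial>lborel) +
     (\<integral>\<^sup>+x. ?f (-1/x) * (1/x\<^sup>2) * indicator {x. -1 * x > 0} x \<partial>lborel)"
    by (subst split) (auto simp: nn_integral_neg_inverse_half[where \<sigma>=1, simplified]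
        nn_integral_neg_inverse_half[where \<sigma>="-1", simplified])
  also have "\<dots> = (\<integral>\<^sup>+x. ?f (-1/x) * (1/x\<^sup>2) \<partial>lborel)"
    by (subst (3) split) (auto simp: add.commute)
  also have "\<dots> = emeasure (distr (density lborel (\<lambda>x. ennreal (1/x\<^sup>2))) borel (\<lambda>x::real. -1/x)) A"
    by (subst emeasure_distr, simp, simp, subst emeasure_density)
      (use pre in \<open>auto intro!: nn_integral_cong simp: indicator_def\<close>)
  finally show "emeasure lborel A = emeasure (distr (density lborel (\<lambda>x. ennreal (1/x\<^sup>2))) borel (\<lambda>x::real. -1/x)) A" .
qed simp

lemma nn_integral_neg_inverse:
  assumes [measurable]: "f \<in> borel_measurable borel"
  shows "(\<integral>\<^sup>+x. f x \<partial>lborel) = (\<integral>\<^sup>+x. ennreal (1/x\<^sup>2) * f (-1/x) \<partial>lborel)"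
  by (subst lborel_neg_inverse) (simp add: nn_integral_distr nn_integral_density)

lemma nn_integral_PiL_neg_inverse:
  assumes K: "finite K" "k \<in> K" and f[measurable]: "f \<in> borel_measurable (PiL K)"
  shows "(\<integral>\<^sup>+z. f z \<partial>PiL K) = (\<integral>\<^sup>+z. ennreal (1/(z k)\<^sup>2) * f (z(k := -1 / z k)) \<partial>PiL K)"
proof -
  define I where "I = K - {k}"
  have I: "finite I" "k \<notin> I" "K = insert k I" using K by (auto simp: I_def)
  have upd: "(\<lambda>w. (fst w)(k := snd w)) \<in> PiL I \<Otimes>\<^sub>M lborel \<rightarrow>\<^sub>M PiL K"
    using measurable_add_dim[of k I "\<lambda>_. lborel :: real measure"] by (simp add: case_prod_unfold I)
  have upd2: "(\<lambda>w. (snd w)(k := fst w)) \<in> lborel \<Otimes>\<^sub>M PiL I \<rightarrow>\<^sub>M PiL K"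
    using measurable_compose[OF measurable_pair_swap' upd] by (simp add: case_prod_unfold)
  have [measurable]: "(\<lambda>z. z(k := -1 / z k)) \<in> PiL K \<rightarrow>\<^sub>M PiL K"
    by (rule measurable_fun_upd[where J=K]) (use K in auto)
  have [measurable]: "(\<lambda>x. f (x(k := y))) \<in> borel_measurable (PiL I)" for y
    using measurable_compose[OF measurable_Pair2'[of y lborel "PiL I"] measurable_compose[OF upd f]]
    by (simp add: fun_upd_def)
  have [measurable]: "(\<lambda>y. \<integral>\<^sup>+x. f (x(k := y)) \<partial>PiL I) \<in> borel_measurable borel"
    using sigma_finite_measure.borel_measurable_nn_integral[OF
        lebesgue_product.sigma_finite[OF I(1)], of "\<lambda>y x. f (x(k := y))" lborel]
      measurable_compose[OF upd2 f]
    by (simp add: case_prod_unfold)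
  have g: "(\<lambda>z. ennreal (1/(z k)\<^sup>2) * f (z(k := -1 / z k))) \<in> borel_measurable (PiL (insert k I))"
    unfolding I(3)[symmetric] using K(2) by measurable
  show ?thesis
    unfolding I(3)
    apply (subst lebesgue_product.product_nn_integral_insert_rev[OF I(1,2) f[unfolded I(3)]])
    apply (subst lebesgue_product.product_nn_integral_insert_rev[OF I(1,2) g])
    apply (subst nn_integral_neg_inverse)
    by (auto simp: nn_integral_cmult)
qed

section \<open>Congruence as a substitution on symmetric matrices\<close>

lemma sym_indices_pair [simp, intro]: "{i, j} \<in> sym_indices"
  by (auto simp: sym_indices_def)

lemma sym_indices_singleton [simp, intro]: "{i} \<in> sym_indices"
  using sym_indices_pair[of i i] by simp

lemma nn_integral_sym_lborel:
  fixes f :: "real^'n^'n \<Rightarrow> ennreal"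
  assumes [measurable]: "f \<in> borel_measurable borel"
  shows "(\<integral>\<^sup>+Z. f Z \<partial>sym_lborel) = (\<integral>\<^sup>+z. f (sym_matrix z) \<partial>PiL sym_indices)"
  unfolding sym_lborel_def by (subst nn_integral_distr) auto

lemma sets_sym_lborel [simp, measurable_cong]: "sets sym_lborel = sets borel"
  by (simp add: sym_lborel_def)

lemma space_sym_lborel [simp]: "space sym_lborel = UNIV"
  by (simp add: sym_lborel_def)

lemma linear_congruence: "linear (\<lambda>Z :: real^'n^'n. L ** Z ** M)"
  by (rule linearI)
    (simp_all add: matrix_matrix_mult_def vec_eq_iff sum_distrib_left sum_distrib_right
      algebra_simps sum.distrib)

lemma measurable_congruence [measurable]:
  fixes L M :: "real^'n^'n"
  shows "(\<lambda>Z. L ** Z ** M) \<in> borel_measurable borel"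
  by (intro borel_measurable_continuous_onI linear_continuous_on)
    (simp add: linear_conv_bounded_linear[symmetric] linear_congruence)

text \<open>
  Entries of a symmetric matrix are indexed by sets, so the factor \<open>y i * y j\<close> that belongs to the entry
  at \<open>(i, j)\<close> has to be a function of \<open>{i, j}\<close>.
\<close>

definition pair_product :: "('n \<Rightarrow> real) \<Rightarrow> 'n set \<Rightarrow> real" where
  "pair_product y e = (if card e = 1 then (\<Prod>i\<in>e. y i)\<^sup>2 else \<Prod>i\<in>e. y i)"

lemma pair_product_doubleton [simp]: "pair_product y {i, j} = y i * y j"
  by (cases "i = j") (auto simp: pair_product_def power2_eq_square)

lemma pair_product_cong: "(\<And>i. i \<in> e \<Longrightarrow> y i = y' i) \<Longrightarrow> pair_product y e = pair_product y' e"
  by (simp add: pair_product_def)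

lemma measurable_pair_product:
  assumes "\<And>i. i \<in> e \<Longrightarrow> (\<lambda>z. y z i) \<in> borel_measurable M"
  shows "(\<lambda>z. pair_product (y z) e) \<in> borel_measurable M"
  using assms by (cases "card e = 1") (auto simp: pair_product_def)

text \<open>
  An index \<open>i\<close> lies in \<open>p\<close> of the sets \<open>{i, j}\<close>, and counts twice in the one with \<open>i = j\<close>. This is the
  source of the exponent \<open>p + 1\<close> of the congruence Jacobian.
\<close>

lemma prod_sym_indices:
  fixes d :: "'n::finite \<Rightarrow> real"
  shows "(\<Prod>e\<in>sym_indices. pair_product d e) = (\<Prod>i\<in>UNIV. d i) ^ (CARD('n) + 1)"
proof -
  \<comment> \<open>The exponent of \<open>d i\<close> in the factor of the entry \<open>e\<close>; a diagonal entry counts twice.\<close>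
  define m where "m e i = (if i \<in> e then if e = {i} then 2 else 1 else (0::nat))" for e and i :: 'n
  have w: "pair_product d e = (\<Prod>i\<in>UNIV. d i ^ m e i)" for e
  proof (cases "card e = 1")
    case True
    then obtain i where i: "e = {i}" by (auto simp: card_1_singleton_iff)
    have "(\<Prod>j\<in>UNIV. d j ^ m {i} j) = (\<Prod>j\<in>UNIV. if j = i then (d i)\<^sup>2 else 1)"
      by (intro prod.cong) (auto simp: m_def)
    then show ?thesis by (simp add: i pair_product_def)
  next
    case False
    then have "(\<Prod>j\<in>UNIV. d j ^ m e j) = (\<Prod>j\<in>UNIV. if j \<in> e then d j else 1)"
      by (intro prod.cong) (auto simp: m_def)
    also have "\<dots> = (\<Prod>j\<in>e. d j)"
      by (simp add: prod.If_cases)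
    finally show ?thesis using False by (simp add: pair_product_def)
  qed
  have count: "(\<Sum>e\<in>sym_indices. m e i) = CARD('n) + 1" for i :: 'n
  proof -
    have img: "{e \<in> sym_indices. i \<in> e} = range (\<lambda>k. {i, k})"
      by (auto simp: sym_indices_def image_iff)
    have "(\<Sum>e\<in>sym_indices. m e i) = (\<Sum>e\<in>{e \<in> sym_indices. i \<in> e}. m e i)"
      by (intro sum.mono_neutral_right) (auto simp: m_def)
    also have "\<dots> = (\<Sum>k\<in>UNIV. m {i, k} i)"
      unfolding img by (subst sum.reindex) (auto simp: inj_on_def doubleton_eq_iff)
    also have "\<dots> = (\<Sum>k\<in>UNIV. 1 + (if k = i then 1 else 0))"
      by (intro sum.cong) (auto simp: m_def)
    finally show ?thesis by (subst (asm) sum.distrib) simp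
  qed
  have "(\<Prod>e\<in>sym_indices. pair_product d e) = (\<Prod>i\<in>UNIV. \<Prod>e\<in>sym_indices. d i ^ m e i)"
    unfolding w by (rule prod.swap)
  also have "\<dots> = (\<Prod>i\<in>UNIV. d i ^ (CARD('n) + 1))"
    by (simp only: power_sum[symmetric] count)
  finally show ?thesis by (simp only: prod_power_distrib)
qed

text \<open>
  The condition on the determinant sits inside the predicate so that singular matrices, which the
  induction over elementary matrices also passes through, satisfy it trivially.
\<close>

definition congruence_jacobian :: "real^'n^'n \<Rightarrow> bool" where
  "congruence_jacobian L \<longleftrightarrow> (det L \<noteq> 0 \<longrightarrow> (\<forall>f \<in> borel_measurable borel.
     (\<integral>\<^sup>+Z. f Z \<partial>sym_lborel) =
     (\<integral>\<^sup>+Z. ennreal (\<bar>det L\<bar> ^ (CARD('n) + 1)) * f (L ** Z ** transpose L) \<partial>sym_lborel)))"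

lemma congruence_jacobian_mult:
  fixes A B :: "real^'n^'n"
  assumes A: "congruence_jacobian A" and B: "congruence_jacobian B"
  shows "congruence_jacobian (A ** B)"
  unfolding congruence_jacobian_def
proof (intro impI ballI)
  fix f :: "real^'n^'n \<Rightarrow> ennreal" assume nz: "det (A ** B) \<noteq> 0" and f[measurable]: "f \<in> borel_measurable borel"
  from nz have nz': "det A \<noteq> 0" "det B \<noteq> 0" by (auto simp: det_mul)
  have "(\<integral>\<^sup>+Z. f Z \<partial>sym_lborel) =
     (\<integral>\<^sup>+Z. ennreal (\<bar>det A\<bar> ^ (CARD('n) + 1)) * f (A ** Z ** transpose A) \<partial>sym_lborel)"
    using A nz' f unfolding congruence_jacobian_def by blast
  also have "\<dots> = (\<integral>\<^sup>+Z. ennreal (\<bar>det B\<bar> ^ (CARD('n) + 1)) * (ennreal (\<bar>det A\<bar> ^ (CARD('n) + 1)) *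
      f (A ** (B ** Z ** transpose B) ** transpose A)) \<partial>sym_lborel)"
    by (rule B[unfolded congruence_jacobian_def, rule_format, OF nz'(2)]) measurable
  finally show "(\<integral>\<^sup>+Z. f Z \<partial>sym_lborel) =
     (\<integral>\<^sup>+Z. ennreal (\<bar>det (A ** B)\<bar> ^ (CARD('n) + 1)) * f (A ** B ** Z ** transpose (A ** B)) \<partial>sym_lborel)"
    by (simp add: matrix_transpose_mul matrix_mul_assoc det_mul abs_mult power_mult_distrib
        ennreal_mult ac_simps)
qed

lemma congruence_jacobian_diagonal:
  fixes L :: "real^'n^'n"
  assumes L: "\<And>i j. i \<noteq> j \<Longrightarrow> L$i$j = 0"
  shows "congruence_jacobian L"
  unfolding congruence_jacobian_def
proof (intro impI ballI)
  fix f :: "real^'n^'n \<Rightarrow> ennreal" assume nz: "det L \<noteq> 0" and f[measurable]: "f \<in> borel_measurable borel"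
  define d where "d i = L$i$i" for i
  have det: "det L = (\<Prod>i\<in>UNIV. d i)"
    using det_diagonal[of L] L by (simp add: d_def)
  with nz have d0: "d i \<noteq> 0" for i by auto
  have Ld: "L$i$k = (if k = i then d i else 0)" for i k
    using L by (auto simp: d_def)
  have eq: "sym_matrix (\<lambda>e\<in>sym_indices. pair_product d e * z e + 0) = L ** sym_matrix z ** transpose L" for z
    by (simp add: vec_eq_iff sym_matrix_def matrix_matrix_mult_def transpose_def Ld
        sum.delta mult_if_delta if_distrib[of "\<lambda>x. x * _"] if_distrib[of "\<lambda>x. _ * x"] cong: if_cong)
  have "(\<integral>\<^sup>+Z. f Z \<partial>sym_lborel) = (\<integral>\<^sup>+z. f (sym_matrix z) \<partial>PiL sym_indices)"
    by (rule nn_integral_sym_lborel) measurable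
  also have "\<dots> = (\<integral>\<^sup>+z. ennreal (\<Prod>e\<in>sym_indices. \<bar>pair_product d e\<bar>) *
      f (sym_matrix (\<lambda>e\<in>sym_indices. pair_product d e * z e + 0)) \<partial>PiL sym_indices)"
    by (rule nn_integral_PiL_affine) (auto simp: pair_product_def d0)
  also have "\<dots> = (\<integral>\<^sup>+z. ennreal (\<bar>det L\<bar> ^ (CARD('n) + 1)) * f (L ** sym_matrix z ** transpose L) \<partial>PiL sym_indices)"
    unfolding eq det prod_sym_indices[of d] power_abs[symmetric] abs_prod[symmetric] ..
  finally show "(\<integral>\<^sup>+Z. f Z \<partial>sym_lborel) =
     (\<integral>\<^sup>+Z. ennreal (\<bar>det L\<bar> ^ (CARD('n) + 1)) * f (L ** Z ** transpose L) \<partial>sym_lborel)"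
    by (subst nn_integral_sym_lborel) auto
qed

lemma sum_shear_row:
  fixes y :: "'n::finite \<Rightarrow> real"
  assumes "m \<noteq> n"
  shows "(\<Sum>k\<in>UNIV. (if i = m \<and> k = n then c else of_bool (i = k)) * y k) = y i + (if i = m then c * y n else 0)"
proof -
  have "(\<Sum>k\<in>UNIV. (if i = m \<and> k = n then c else of_bool (i = k)) * y k) =
     (\<Sum>k\<in>UNIV. (if k = i then y i else 0) + (if k = n then if i = m then c * y n else 0 else 0))"
    using assms by (intro sum.cong) auto
  then show ?thesis by (simp add: sum.distrib)
qed

text \<open>
  A shear of \<open>Z\<close> is a composition of two coordinate translations, and its determinant is \<open>1\<close>.
\<close>

lemma congruence_jacobian_shear:
  fixes m n :: "'n::finite"
  assumes mn: "m \<noteq> n"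
  shows "congruence_jacobian (\<chi> i j. if i = m \<and> j = n then c else of_bool (i = j))" (is "congruence_jacobian ?L")
  unfolding congruence_jacobian_def
proof (intro impI ballI)
  fix f :: "real^'n^'n \<Rightarrow> ennreal" assume f[measurable]: "f \<in> borel_measurable borel"
  have "?L = (\<chi> k. if k = m then row m (mat 1) + c *s row n (mat 1) else row k (mat 1))"
    using mn by (auto simp: vec_eq_iff row_def mat_def)
  then have det: "det ?L = 1"
    using det_row_operation[OF mn, of "mat 1" c] by simp
  have entry: "(?L ** Z ** transpose ?L)$i$j =
      (Z$i$j + (if i = m then c * Z$n$j else 0)) + (if j = m then c * (Z$i$n + (if i = m then c * Z$n$n else 0)) else 0)" for Z :: "real^'n^'n" and i j
  proof -
    have l: "(?L ** Z)$i$j = Z$i$j + (if i = m then c * Z$n$j else 0)" for i j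
      by (simp add: matrix_matrix_mult_def sum_shear_row[OF mn])
    have r: "(W ** transpose ?L)$i$j = W$i$j + (if j = m then c * W$i$n else 0)" for W :: "real^'n^'n" and i j
      using sum_shear_row[OF mn, where c = c and i = j and y = "\<lambda>k. W$i$k"]
      by (simp add: matrix_matrix_mult_def transpose_def mult.commute)
    show ?thesis unfolding r l ..
  qed
  define J where "J = (\<lambda>k. {m, k}) ` (- {m})"
  \<comment> \<open>\<open>L Z L\<^sup>T\<close> changes row and column \<open>m\<close> only. The entry \<open>(m, m)\<close> is moved first, since it needs the old
    off-diagonal entries; each of the two moves is a translation with amount depending on the other entries.\<close>
  define T1 where "T1 z = (\<lambda>e\<in>sym_indices. if e \<in> {{m}} then 1 * z e + (2 * c * z {m, n} + c\<^sup>2 * z {n}) else z e)"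
    for z :: "'n set \<Rightarrow> real"
  define T2 where "T2 z = (\<lambda>e\<in>sym_indices. if e \<in> J then 1 * z e + c * z (insert n (e - {m})) else z e)"
    for z :: "'n set \<Rightarrow> real"
  have J: "J \<subseteq> sym_indices" by (auto simp: J_def)
  have insJ: "insert n (e - {m}) \<in> sym_indices - J" if e: "e \<in> J" for e
  proof -
    from e obtain k where "k \<noteq> m" "e = {m, k}" by (auto simp: J_def)
    then have "insert n (e - {m}) = {n, k}" by auto
    then show ?thesis using \<open>k \<noteq> m\<close> mn by (auto simp: J_def doubleton_eq_iff)
  qed
  note comp = measurable_PiL_component
  have mT2[measurable]: "T2 \<in> PiL sym_indices \<rightarrow>\<^sub>M PiL sym_indices"
    unfolding T2_def by (rule measurable_PiL_fibre_affine) (use insJ comp in auto)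
  have eq: "sym_matrix (T2 (T1 z)) = ?L ** sym_matrix z ** transpose ?L" for z
  proof -
    have 1: "T1 z {i, j} = (if i = m \<and> j = m then z {m} + (2 * c * z {m, n} + c\<^sup>2 * z {n}) else z {i, j})" for i j
      by (auto simp: T1_def)
    have T1m: "T1 z {m} = z {m} + (2 * c * z {m, n} + c\<^sup>2 * z {n})"
      using 1[of m m] by simp
    have J_iff: "{i, j} \<in> J \<longleftrightarrow> (i = m \<and> j \<noteq> m \<or> i \<noteq> m \<and> j = m)" for i j
      by (auto simp: J_def image_iff doubleton_eq_iff)
    have 2: "T2 y {i, j} = (if i = m \<and> j \<noteq> m then y {i, j} + c * y {n, j} else
        if i \<noteq> m \<and> j = m then y {i, j} + c * y {n, i} else y {i, j})" for y i j
      unfolding T2_def by (auto simp: J_iff insert_commute intro!: arg_cong[where f=y])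
    show ?thesis
      unfolding vec_eq_iff entry using mn
      by (auto simp: sym_matrix_def 1 T1m 2 insert_commute algebra_simps power2_eq_square)
  qed
  have "(\<integral>\<^sup>+Z. f Z \<partial>sym_lborel) = (\<integral>\<^sup>+z. f (sym_matrix z) \<partial>PiL sym_indices)"
    by (rule nn_integral_sym_lborel) measurable
  also have "\<dots> = (\<integral>\<^sup>+z. ennreal (\<Prod>j\<in>J. \<bar>1\<bar>) * f (sym_matrix (T2 z)) \<partial>PiL sym_indices)"
    unfolding T2_def
    by (rule nn_integral_PiL_fibre_affine) (use J insJ comp in auto)
  also have "\<dots> = (\<integral>\<^sup>+z. f (sym_matrix (T2 z)) \<partial>PiL sym_indices)" by simp
  also have "\<dots> = (\<integral>\<^sup>+z. ennreal (\<Prod>j\<in>{{m}}. \<bar>1\<bar>) * f (sym_matrix (T2 (T1 z))) \<partial>PiL sym_indices)"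
    unfolding T1_def
    by (rule nn_integral_PiL_fibre_affine) (use mn comp in \<open>auto simp: doubleton_eq_iff\<close>)
  also have "\<dots> = (\<integral>\<^sup>+Z. f (?L ** Z ** transpose ?L) \<partial>sym_lborel)"
    by (subst nn_integral_sym_lborel) (auto simp: eq)
  finally show "(\<integral>\<^sup>+Z. f Z \<partial>sym_lborel) =
     (\<integral>\<^sup>+Z. ennreal (\<bar>det ?L\<bar> ^ (CARD('n) + 1)) * f (?L ** Z ** transpose ?L) \<partial>sym_lborel)"
    by (simp add: det)
qed

lemma congruence_jacobian_swap:
  fixes m n :: "'n::finite"
  assumes mn: "m \<noteq> n"
  shows "congruence_jacobian (\<chi> i j. mat 1 $ i $ Transposition.transpose m n j)" (is "congruence_jacobian ?S")
proof -
  define E where "E a b c = ((\<chi> i j. if i = a \<and> j = b then c else of_bool (i = j)) :: real^'n^'n)" for a b :: 'n and c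
  define D where "D = ((\<chi> i j. if i = j then if i = n then -1 else 1 else 0) :: real^'n^'n)"
  have E: "E a b c *v x = (\<chi> i. x$i + (if i = a then c * x$b else 0))" if "a \<noteq> b" for a b c x
    by (simp add: E_def matrix_vector_mult_def sum_shear_row[OF that])
  have D: "D *v x = (\<chi> i. if i = n then - x$i else x$i)" for x
    by (simp add: D_def matrix_vector_mult_def vec_eq_iff if_distrib[of "\<lambda>a. a * _"] cong: if_cong)
  have S: "?S *v x = (\<chi> i. x $ Transposition.transpose m n i)" for x
  proof -
    have "(\<Sum>j\<in>UNIV. mat 1 $ i $ Transposition.transpose m n j * x $ j) =
        (\<Sum>j\<in>UNIV. if j = Transposition.transpose m n i then x $ j else 0)" for i
      by (intro sum.cong) (auto simp: mat_def Transposition.transpose_def)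
    then show ?thesis
      by (simp add: matrix_vector_mult_def vec_eq_iff)
  qed
  \<comment> \<open>A swap is a quarter turn, which is a product of three shears, followed by a sign change.\<close>
  have "?S = D ** (E m n 1 ** (E n m (-1) ** E m n 1))"
    unfolding matrix_eq using mn
    by (simp only: matrix_vector_mul_assoc[symmetric] D S)
      (auto simp: E vec_eq_iff Transposition.transpose_def)
  moreover have "congruence_jacobian \<dots>"
    unfolding E_def using mn
    by (intro congruence_jacobian_mult congruence_jacobian_shear congruence_jacobian_diagonal) (auto simp: D_def)
  ultimately show ?thesis by simp
qed

text \<open>
  The rule is inherited by products of matrices, so it suffices to treat diagonal matrices, swaps and shears.
\<close>

theorem nn_integral_congruence:
  fixes L :: "real^'n^'n" and f :: "real^'n^'n \<Rightarrow> ennreal"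
  assumes "det L \<noteq> 0" "f \<in> borel_measurable borel"
  shows "(\<integral>\<^sup>+Z. f Z \<partial>sym_lborel) =
     (\<integral>\<^sup>+Z. ennreal (\<bar>det L\<bar> ^ (CARD('n) + 1)) * f (L ** Z ** transpose L) \<partial>sym_lborel)"
proof -
  have "congruence_jacobian L"
  proof (rule induct_matrix_elementary)
    show "congruence_jacobian A" if "row i A = 0" for A :: "real^'n^'n" and i
      using det_zero_row(1)[OF that] by (simp add: congruence_jacobian_def)
  qed (auto intro: congruence_jacobian_mult congruence_jacobian_diagonal congruence_jacobian_swap
      congruence_jacobian_shear)
  then show ?thesis using assms unfolding congruence_jacobian_def by blast
qed

section \<open>Positive definite matrices\<close>

lemma pos_def_symmetric: "pos_def A \<Longrightarrow> transpose A = A"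
  by (simp add: pos_def_def)

lemma pos_def_inner: "pos_def A \<Longrightarrow> x \<noteq> 0 \<Longrightarrow> x \<bullet> (A *v x) > 0"
  by (simp add: pos_def_def)

lemma symmetric_inner:
  fixes A :: "real^'n^'n"
  assumes "transpose A = A"
  shows "(A *v x) \<bullet> y = x \<bullet> (A *v y)"
  using dot_lmul_matrix[of x A y] assms by (metis transpose_matrix_vector)

lemma pos_def_mat_1: "pos_def (mat 1 :: real^'n^'n)"
  by (simp add: pos_def_def transpose_mat)

lemma transpose_add: "transpose (A + B) = transpose A + transpose (B :: 'a::semiring_1^'n^'m)"
  by (simp add: transpose_def vec_eq_iff)

lemma transpose_diff: "transpose (A - B) = transpose A - transpose (B :: real^'n^'m)"
  by (simp add: transpose_def vec_eq_iff)

lemma pos_def_add: "pos_def A \<Longrightarrow> pos_def B \<Longrightarrow> pos_def (A + B)"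
  by (auto simp: pos_def_def transpose_add matrix_vector_mult_add_rdistrib inner_add_right intro: add_pos_pos)

lemma pos_def_scaleR: "pos_def A \<Longrightarrow> c > 0 \<Longrightarrow> pos_def (c *\<^sub>R A)"
  by (auto simp: pos_def_def transpose_scalar scaleR_matrix_vector_assoc[symmetric])

lemma pos_def_det_nonzero: 
  assumes "pos_def A" shows "det A \<noteq> 0"
proof -
  have "x = 0" if "A *v x = 0" for x
    using pos_def_inner[OF assms, of x] that by auto
  then show ?thesis
    by (metis invertible_det_nz invertible_left_inverse matrix_left_invertible_ker)
qed

lemma matrix_inv_det_nonzero:
  fixes A :: "real^'n^'n"
  assumes "det A \<noteq> 0"
  shows "A ** matrix_inv A = mat 1" "matrix_inv A ** A = mat 1"
proof -
  have "\<exists>A'. A ** A' = mat 1 \<and> A' ** A = mat 1"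
    using assms invertible_det_nz[of A] unfolding invertible_def by auto
  from someI_ex[OF this] show "A ** matrix_inv A = mat 1" "matrix_inv A ** A = mat 1"
    unfolding matrix_inv_def by auto
qed

lemmas pos_def_inv = matrix_inv_det_nonzero[OF pos_def_det_nonzero]

lemma matrix_inv_unique:
  fixes A :: "real^'n^'n"
  assumes "B ** A = mat 1"
  shows "matrix_inv A = B"
proof -
  have "det B * det A = 1" using assms by (metis det_mul det_I)
  then have "det A \<noteq> 0" by auto
  then have "A ** matrix_inv A = mat 1" by (rule matrix_inv_det_nonzero)
  then have "B ** A ** matrix_inv A = B" by (simp add: matrix_mul_assoc[symmetric])
  then show ?thesis using assms by simp
qed

lemma pos_def_congruence:
  fixes L A :: "real^'n^'n"
  assumes A: "pos_def A" and L: "det L \<noteq> 0"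
  shows "pos_def (L ** A ** transpose L)"
  unfolding pos_def_def
proof (intro conjI allI impI)
  show "transpose (L ** A ** transpose L) = L ** A ** transpose L"
    using pos_def_symmetric[OF A] by (simp add: matrix_transpose_mul matrix_mul_assoc)
  fix x :: "real^'n" assume x: "x \<noteq> 0"
  have "transpose L *v x \<noteq> 0"
  proof
    assume "transpose L *v x = 0"
    moreover have "matrix_inv (transpose L) ** transpose L = mat 1"
      using L by (intro matrix_inv_det_nonzero) simp
    ultimately have "x = 0"
      by (metis matrix_vector_mul_assoc matrix_vector_mul_lid matrix_vector_mult_0_right)
    with x show False by simp
  qed
  from pos_def_inner[OF A this]
  show "0 < x \<bullet> (L ** A ** transpose L *v x)"
    by (simp add: matrix_vector_mul_assoc[symmetric] dot_lmul_matrix[symmetric])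
qed

text \<open>
  Undo the congruence by the inverse of \<open>L\<close>.
\<close>

lemma pos_def_congruence_iff:
  fixes L A :: "real^'n^'n"
  assumes L: "det L \<noteq> 0"
  shows "pos_def (L ** A ** transpose L) \<longleftrightarrow> pos_def A"
proof
  assume *: "pos_def (L ** A ** transpose L)"
  let ?M = "matrix_inv L"
  have M: "?M ** L = mat 1" using L by (rule matrix_inv_det_nonzero)
  then have "det ?M * det L = 1" by (metis det_mul det_I)
  then have dM: "det ?M \<noteq> 0" by auto
  have "?M ** (L ** A ** transpose L) ** transpose ?M = (?M ** L) ** A ** transpose (?M ** L)"
    by (simp add: matrix_mul_assoc matrix_transpose_mul)
  then have "?M ** (L ** A ** transpose L) ** transpose ?M = A"
    by (simp add: M transpose_mat)
  with pos_def_congruence[OF * dM] show "pos_def A" by simp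
qed (rule pos_def_congruence[OF _ L])

lemma pos_def_matrix_inv:
  assumes A: "pos_def A"
  shows "pos_def (matrix_inv A)"
proof -
  have tr: "transpose (matrix_inv A) = matrix_inv A"
  proof (rule matrix_inv_unique[symmetric])
    have "transpose (matrix_inv A) ** transpose A = transpose (A ** matrix_inv A)"
      by (simp add: matrix_transpose_mul)
    then show "transpose (matrix_inv A) ** A = mat 1"
      using pos_def_inv(1)[OF A] pos_def_symmetric[OF A] by (simp add: transpose_mat)
  qed
  have "det (matrix_inv A) * det A = 1" using pos_def_inv(2)[OF A] by (metis det_mul det_I)
  then have "det (matrix_inv A) \<noteq> 0" by auto
  from pos_def_congruence[OF A this] show ?thesis
    by (simp add: tr pos_def_inv[OF A])
qed

lemma pos_def_det_inv:
  assumes "pos_def A" shows "det (matrix_inv A) = 1 / det A"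
proof -
  have "det (matrix_inv A) * det A = 1" using pos_def_inv(2)[OF assms] by (metis det_mul det_I)
  then show ?thesis using pos_def_det_nonzero[OF assms] by (simp add: field_simps)
qed

lemma pos_def_bounded_below:
  fixes A :: "real^'n^'n"
  assumes "pos_def A"
  shows "\<exists>c>0. \<forall>x. c * (x \<bullet> x) \<le> x \<bullet> (A *v x)"
proof -
  \<comment> \<open>The constant is the minimum of the quadratic form on the unit sphere.\<close>
  let ?S = "sphere (0 :: real^'n) 1"
  have "continuous_on ?S (\<lambda>x. x \<bullet> (A *v x))"
    by (intro continuous_intros linear_continuous_on) (simp add: matrix_vector_mul_bounded_linear)
  moreover have "axis undefined 1 \<in> ?S" by (simp add: norm_axis_1)
  then have "?S \<noteq> {}" by blast
  ultimately obtain u where u: "u \<in> ?S" "\<And>x. x \<in> ?S \<Longrightarrow> u \<bullet> (A *v u) \<le> x \<bullet> (A *v x)"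
    using continuous_attains_inf[OF compact_sphere, of "0 :: real^'n" 1 "\<lambda>x. x \<bullet> (A *v x)"] by auto
  let ?c = "u \<bullet> (A *v u)"
  have "?c > 0" using u assms by (intro pos_def_inner) auto
  moreover have "?c * (x \<bullet> x) \<le> x \<bullet> (A *v x)" for x
  proof (cases "x = 0")
    case False
    then have n: "norm x > 0" by simp
    have "(1 / norm x) *\<^sub>R x \<in> ?S" using False by simp
    from u(2)[OF this] have "?c \<le> (x \<bullet> (A *v x)) / (norm x)\<^sup>2"
      by (simp add: matrix_vector_mult_scaleR power2_eq_square)
    then show ?thesis using n by (simp add: pos_le_divide_eq dot_square_norm)
  qed simp
  ultimately show ?thesis by blast
qed

lemma sets_pos_def [measurable]: "{Z :: real^'n^'n. pos_def Z} \<in> sets borel"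
proof -
  have lin: "continuous_on UNIV (\<lambda>Z :: real^'n^'n. x \<bullet> (Z *v x))" for x
    by (intro linear_continuous_on linear_conv_bounded_linear[THEN iffD1] linearI)
      (simp_all add: matrix_vector_mult_add_rdistrib inner_add_right scaleR_matrix_vector_assoc[symmetric])
  have tr: "continuous_on UNIV (transpose :: real^'n^'n \<Rightarrow> real^'n^'n)"
    by (intro linear_continuous_on linear_conv_bounded_linear[THEN iffD1] linearI) (simp_all add: transpose_add transpose_scalar)
  \<comment> \<open>Uniform lower bounds make the set a countable union of closed sets.\<close>
  have "{Z :: real^'n^'n. pos_def Z} =
    (\<Union>k. {Z. transpose Z = Z} \<inter> (\<Inter>x. {Z. (1 / real (Suc k)) * (x \<bullet> x) \<le> x \<bullet> (Z *v x)}))"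
  proof (intro set_eqI iffI)
    fix Z :: "real^'n^'n" assume "Z \<in> {Z. pos_def Z}"
    then have Z: "pos_def Z" by simp
    from pos_def_bounded_below[OF Z] obtain c where c: "c > 0" "\<And>x. c * (x \<bullet> x) \<le> x \<bullet> (Z *v x)" by blast
    from c(1) obtain k where "1 / real (Suc k) < c" by (rule nat_approx_posE)
    then have "(1 / real (Suc k)) * (x \<bullet> x) \<le> x \<bullet> (Z *v x)" for x
      using order_trans[OF mult_right_mono c(2)[of x], of "1 / real (Suc k)"] by simp
    then show "Z \<in> (\<Union>k. {Z. transpose Z = Z} \<inter> (\<Inter>x. {Z. (1 / real (Suc k)) * (x \<bullet> x) \<le> x \<bullet> (Z *v x)}))"
      using pos_def_symmetric[OF Z] by blast
  next
    fix Z :: "real^'n^'n"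
    assume "Z \<in> (\<Union>k. {Z. transpose Z = Z} \<inter> (\<Inter>x. {Z. (1 / real (Suc k)) * (x \<bullet> x) \<le> x \<bullet> (Z *v x)}))"
    then obtain k where k: "transpose Z = Z" "\<And>x. (1 / real (Suc k)) * (x \<bullet> x) \<le> x \<bullet> (Z *v x)" by blast
    have "0 < x \<bullet> (Z *v x)" if "x \<noteq> 0" for x
    proof -
      have "0 < (1 / real (Suc k)) * (x \<bullet> x)" using that by simp
      then show ?thesis using k(2)[of x] by linarith
    qed
    then show "Z \<in> {Z. pos_def Z}" using k by (simp add: pos_def_def)
  qed
  also have "\<dots> \<in> sets borel"
    by (intro sets.countable_UN sets.Int image_subsetI borel_closed closed_INT closed_Collect_eq
        closed_Collect_le lin tr continuous_intros ballI)
  finally show ?thesis .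
qed

section \<open>Inversion as a substitution on positive definite matrices\<close>

text \<open>
  The sweep operator of Gauss-Jordan elimination, with the sign that makes it preserve symmetry:
  sweeping at every index once, in any order, turns \<open>N\<close> into \<open>- N\<^sup>-\<^sup>1\<close> as long as no pivot vanishes.
\<close>

definition sweep :: "'n \<Rightarrow> real^'n^'n \<Rightarrow> real^'n^'n" where
  "sweep k N = (\<chi> i j. if i = k \<and> j = k then -1 / N$k$k
     else if i = k \<or> j = k then N$i$j / N$k$k else N$i$j - N$i$k * N$k$j / N$k$k)"

lemma borel_measurable_matrixI:
  fixes f :: "'a \<Rightarrow> real^'n^'m"
  assumes "\<And>i j. (\<lambda>x. f x $ i $ j) \<in> borel_measurable M"
  shows "f \<in> borel_measurable M"
proof -
  have "(\<lambda>x. f x \<bullet> b) \<in> borel_measurable M" if "b \<in> Basis" for b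
    using that assms by (auto simp: Basis_vec_def inner_axis)
  then show ?thesis by (subst borel_measurable_euclidean_space) auto
qed

lemma borel_measurable_entry [measurable]: "(\<lambda>Z :: real^'n^'m. Z$i$j) \<in> borel_measurable borel"
  by (intro borel_measurable_continuous_onI continuous_intros)

lemma measurable_sweep [measurable]: "sweep k \<in> borel_measurable (borel :: (real^'n^'n) measure)"
proof (rule borel_measurable_matrixI)
  fix i j
  show "(\<lambda>N. sweep k N $ i $ j) \<in> borel_measurable borel"
    by (cases "i = k"; cases "j = k") (simp_all add: sweep_def)
qed

text \<open>
  The pivot contributes \<open>|z\<^sub>k\<^sub>k|\<close> to the power \<open>- 2\<close> and the \<open>p - 1\<close> other entries of row \<open>k\<close> the power
  \<open>- (p - 1)\<close>. At a zero pivot the weight is \<open>1 / 0 = 0\<close>, which discards a null set.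
\<close>

lemma nn_integral_sweep:
  fixes f :: "real^'n^'n \<Rightarrow> ennreal"
  assumes f[measurable]: "f \<in> borel_measurable borel"
  shows "(\<integral>\<^sup>+Z. f Z \<partial>sym_lborel) =
    (\<integral>\<^sup>+Z. ennreal ((1 / \<bar>Z$k$k\<bar>) ^ (CARD('n) + 1)) * f (sweep k Z) \<partial>sym_lborel)"
proof -
  define S where "S = (sym_indices :: 'n set set)"
  define J1 where "J1 = {e \<in> S. k \<notin> e}"
  define J2 where "J2 = (\<lambda>i. {i, k}) ` (- {k})"
  \<comment> \<open>The sweep is the composition of three fibrewise maps: \<open>T1\<close> translates the entries away from \<open>k\<close>,
    \<open>T2\<close> scales the entries \<open>{i, k}\<close> with \<open>i \<noteq> k\<close> by \<open>1 / z {k}\<close>, and \<open>T3\<close> inverts the pivot. The value \<open>1\<close>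
    at \<open>z {k} = 0\<close> keeps the scaling invertible there; the factor \<open>1 / (z {k})\<^sup>2\<close> of \<open>T3\<close> is \<open>0\<close> at such
    points.\<close>
  define c where "c z = (if z {k} = 0 then 1 else 1 / z {k})" for z :: "'n set \<Rightarrow> real"
  define T1 where "T1 z = (\<lambda>e\<in>S. if e \<in> J1 then 1 * z e + (- pair_product (\<lambda>i. z {i, k}) e / z {k}) else z e)" for z
  define T2 where "T2 z = (\<lambda>e\<in>S. if e \<in> J2 then c z * z e + 0 else z e)" for z
  define T3 where "T3 z = z({k} := -1 / z {k})" for z :: "'n set \<Rightarrow> real"
  have S: "{i, j} \<in> S" "{i} \<in> S" for i j by (auto simp: S_def)
  note comp = measurable_PiL_component
  have mw: "(\<lambda>z. pair_product (\<lambda>i. z {i, k}) e) \<in> borel_measurable (PiL S)" for e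
    by (intro measurable_pair_product comp S)
  have mc[measurable]: "c \<in> borel_measurable (PiL S)"
    using comp[OF S(2)[of k]] unfolding c_def by measurable
  have mT2[measurable]: "T2 \<in> PiL S \<rightarrow>\<^sub>M PiL S"
    unfolding T2_def by (rule measurable_PiL_fibre_affine) (use mc in auto)
  have mT3[measurable]: "T3 \<in> PiL S \<rightarrow>\<^sub>M PiL S"
    unfolding T3_def by (rule measurable_fun_upd[where J=S]) (use S comp[OF S(2)[of k]] in auto)
  have msym[measurable]: "sym_matrix \<in> borel_measurable (PiL S)"
    unfolding S_def by measurable
  have mk[measurable]: "(\<lambda>z. z {k}) \<in> borel_measurable (PiL S)" by (rule comp[OF S(2)])
  have J: "J1 \<subseteq> S" "J2 \<subseteq> S" by (auto simp: J1_def J2_def S)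
  have J1_iff: "{i, j} \<in> J1 \<longleftrightarrow> i \<noteq> k \<and> j \<noteq> k" for i j by (auto simp: J1_def S)
  have J2_iff: "{i, j} \<in> J2 \<longleftrightarrow> (i = k \<and> j \<noteq> k \<or> i \<noteq> k \<and> j = k)" for i j
    by (auto simp: J2_def image_iff doubleton_eq_iff)
  have sing: "{k} \<notin> J1" "{k} \<notin> J2" using J1_iff[of k k] J2_iff[of k k] by auto
  have cardJ2: "card J2 = CARD('n) - 1"
    unfolding J2_def by (subst card_image) (auto simp: inj_on_def doubleton_eq_iff card_Diff_singleton Compl_eq_Diff_UNIV)
  have F[measurable]: "(\<lambda>z. f (sym_matrix z)) \<in> borel_measurable (PiL S)" by measurable
  define F3 where "F3 z = ennreal (1 / (z {k})\<^sup>2) * f (sym_matrix (T3 z))" for z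
  have F3[measurable]: "F3 \<in> borel_measurable (PiL S)" unfolding F3_def by measurable
  define F2 where "F2 z = ennreal (\<Prod>e\<in>J2. \<bar>c z\<bar>) * F3 (T2 z)" for z
  have F2[measurable]: "F2 \<in> borel_measurable (PiL S)" unfolding F2_def by measurable
  have pt: "sym_matrix (T3 (T2 (T1 z))) = sweep k (sym_matrix z)" if "z {k} \<noteq> 0" for z
  proof -
    have 1: "T1 z {i, j} = (if i \<noteq> k \<and> j \<noteq> k then z {i, j} - z {i, k} * z {j, k} / z {k} else z {i, j})" for i j
      by (auto simp: T1_def J1_iff S)
    have 11: "T1 z {k} = z {k}" using 1[of k k] by simp
    have 2: "T2 y {i, j} = (if i = k \<and> j \<noteq> k \<or> i \<noteq> k \<and> j = k then c y * y {i, j} else y {i, j})" for y i j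
      by (auto simp: T2_def J2_iff S)
    have 22: "T2 y {k} = y {k}" for y using 2[of y k k] by simp
    have 3: "T3 y {i, j} = (if i = k \<and> j = k then - 1 / y {k} else y {i, j})" for y i j
      by (auto simp: T3_def)
    have c: "c (T1 z) = 1 / z {k}" using that by (simp add: c_def 11)
    show ?thesis
      unfolding vec_eq_iff sym_matrix_def sweep_def vec_lambda_beta
      unfolding 3 2 c 1 22 11 by (auto simp: insert_commute)
  qed
  have weight: "F2 (T1 z) = ennreal ((1 / \<bar>z {k}\<bar>) ^ (CARD('n) + 1)) * f (sweep k (sym_matrix z))" for z
  proof (cases "z {k} = 0")
    case True
    then show ?thesis using sing by (simp add: F2_def F3_def T1_def T2_def S)
  next
    case False
    have T: "T1 z {k} = z {k}" "T2 (T1 z) {k} = z {k}" using sing by (auto simp: T1_def T2_def S)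
    have "CARD('n) > 0" by (simp add: finite_UNIV_card_ge_0)
    then have "(1 / \<bar>z {k}\<bar>) ^ (CARD('n) + 1) = (1 / \<bar>z {k}\<bar>) ^ (CARD('n) - 1) * (1 / (z {k})\<^sup>2)"
      by (cases "CARD('n)") (auto simp: power2_eq_square field_simps)
    moreover have cT: "c (T1 z) = 1 / z {k}" using False by (simp add: c_def T)
    ultimately have "ennreal ((1 / \<bar>z {k}\<bar>) ^ (CARD('n) + 1)) =
        ennreal ((1 / \<bar>z {k}\<bar>) ^ (CARD('n) - 1)) * ennreal (1 / (z {k})\<^sup>2)"
      and "F2 (T1 z) = ennreal ((1 / \<bar>z {k}\<bar>) ^ (CARD('n) - 1)) *
        (ennreal (1 / (z {k})\<^sup>2) * f (sweep k (sym_matrix z)))"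
      by (simp only: ennreal_mult zero_le_power zero_le_divide_1_iff abs_ge_zero zero_le_power2)
        (simp only: F2_def F3_def prod_constant cardJ2 T pt[of z, OF False] abs_divide abs_one cT)
    then show ?thesis by (simp add: mult.assoc)
  qed
  have "(\<integral>\<^sup>+Z. f Z \<partial>sym_lborel) = (\<integral>\<^sup>+z. f (sym_matrix z) \<partial>PiL S)"
    unfolding S_def by (rule nn_integral_sym_lborel) measurable
  also have "\<dots> = (\<integral>\<^sup>+z. F3 z \<partial>PiL S)"
    unfolding F3_def T3_def by (rule nn_integral_PiL_neg_inverse) (auto simp: S)
  also have "\<dots> = (\<integral>\<^sup>+z. F2 z \<partial>PiL S)"
    unfolding F2_def T2_def
    by (rule nn_integral_PiL_fibre_affine) (use J sing S mc in \<open>auto simp: c_def\<close>)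
  also have "\<dots> = (\<integral>\<^sup>+z. ennreal (\<Prod>e\<in>J1. \<bar>1\<bar>) * F2 (T1 z) \<partial>PiL S)"
    unfolding T1_def
  proof (rule nn_integral_PiL_fibre_affine)
    fix z z' :: "'n set \<Rightarrow> real" and e
    assume *: "\<And>i. i \<in> S - J1 \<Longrightarrow> z i = z' i" and e: "e \<in> J1"
    have "z {i, k} = z' {i, k}" "z {k} = z' {k}" for i
      using *[of "{i, k}"] *[of "{k}"] J1_iff[of i k] sing S by auto
    then show "1 = (1::real) \<and> - pair_product (\<lambda>i. z {i, k}) e / z {k} = - pair_product (\<lambda>i. z' {i, k}) e / z' {k}"
      by simp
  qed (use J mw in auto)
  also have "\<dots> = (\<integral>\<^sup>+z. ennreal ((1 / \<bar>sym_matrix z $ k $ k\<bar>) ^ (CARD('n) + 1)) * f (sweep k (sym_matrix z)) \<partial>PiL S)"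
    by (simp add: weight sym_matrix_def)
  finally show ?thesis
    unfolding S_def by (subst nn_integral_sym_lborel) auto
qed


primrec sweeps :: "'n list \<Rightarrow> real^'n^'n \<Rightarrow> real^'n^'n" where
  "sweeps [] N = N"
| "sweeps (k # ks) N = sweeps ks (sweep k N)"

text \<open>
  The product of the pivots met on the way. If it is nonzero and every index occurs once, it is the determinant.
\<close>

primrec pivots :: "'n list \<Rightarrow> real^'n^'n \<Rightarrow> real" where
  "pivots [] N = 1"
| "pivots (k # ks) N = N$k$k * pivots ks (sweep k N)"

lemma measurable_sweeps [measurable]: "sweeps ks \<in> borel_measurable borel"
proof (induction ks)
  case (Cons k ks)
  note [measurable] = Cons
  show ?case by simp
qed simp

lemma measurable_pivots [measurable]: "pivots ks \<in> borel_measurable borel"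
proof (induction ks)
  case (Cons k ks)
  note [measurable] = Cons
  show ?case by simp
qed simp

lemma nn_integral_sweeps:
  fixes f :: "real^'n^'n \<Rightarrow> ennreal"
  assumes f[measurable]: "f \<in> borel_measurable borel"
  shows "(\<integral>\<^sup>+Z. f Z \<partial>sym_lborel) =
    (\<integral>\<^sup>+Z. ennreal ((1 / \<bar>pivots ks Z\<bar>) ^ (CARD('n) + 1)) * f (sweeps ks Z) \<partial>sym_lborel)"
proof (induction ks)
  case (Cons k ks)
  have "(\<integral>\<^sup>+Z. f Z \<partial>sym_lborel) = (\<integral>\<^sup>+Z. ennreal ((1 / \<bar>Z$k$k\<bar>) ^ (CARD('n) + 1)) *
     (ennreal ((1 / \<bar>pivots ks (sweep k Z)\<bar>) ^ (CARD('n) + 1)) * f (sweeps ks (sweep k Z))) \<partial>sym_lborel)"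
    unfolding Cons by (rule nn_integral_sweep) measurable
  also have "\<dots> = (\<integral>\<^sup>+Z. ennreal ((1 / \<bar>pivots (k # ks) Z\<bar>) ^ (CARD('n) + 1)) * f (sweeps (k # ks) Z) \<partial>sym_lborel)"
  proof (rule nn_integral_cong)
    fix Z :: "real^'n^'n"
    have "(1 / \<bar>pivots (k # ks) Z\<bar>) ^ (CARD('n) + 1) =
       (1 / \<bar>Z$k$k\<bar>) ^ (CARD('n) + 1) * (1 / \<bar>pivots ks (sweep k Z)\<bar>) ^ (CARD('n) + 1)"
      by (simp only: power_mult_distrib[symmetric] pivots.simps abs_mult) simp
    then show "ennreal ((1 / \<bar>Z$k$k\<bar>) ^ (CARD('n) + 1)) *
       (ennreal ((1 / \<bar>pivots ks (sweep k Z)\<bar>) ^ (CARD('n) + 1)) * f (sweeps ks (sweep k Z))) =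
      ennreal ((1 / \<bar>pivots (k # ks) Z\<bar>) ^ (CARD('n) + 1)) * f (sweeps (k # ks) Z)"
      by (simp only: ennreal_mult zero_le_power zero_le_divide_1_iff abs_ge_zero sweeps.simps mult.assoc)
  qed
  finally show ?case .
qed simp

definition mix :: "'n set \<Rightarrow> 'a^'n \<Rightarrow> 'a^'n \<Rightarrow> 'a^'n" where
  "mix S a b = (\<chi> i. if i \<in> S then a$i else b$i)"

text \<open>
  The matrix of \<open>x \<mapsto> mix S (M x) x\<close>; its determinant is the principal minor of \<open>M\<close> on \<open>S\<close>.
\<close>

definition mix_matrix :: "'n set \<Rightarrow> real^'n^'n \<Rightarrow> real^'n^'n" where
  "mix_matrix S M = (\<chi> i. if i \<in> S then M$i else axis i 1)"

lemma mix_matrix_mult: "mix_matrix S M *v x = mix S (M *v x) x"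
proof -
  have "(\<Sum>j\<in>UNIV. axis i 1 $ j * x $ j) = x $ i" for i
    by (simp add: axis_def if_distrib[of "\<lambda>a. a * _"] cong: if_cong)
  then show ?thesis
    by (auto simp: mix_matrix_def mix_def matrix_vector_mult_def vec_eq_iff)
qed

lemma det_replace_unit_row:
  fixes v :: "real^'n"
  shows "det (\<chi> i. if i = k then v else axis i 1) = v$k"
proof -
  have r: "row i (mat 1 :: real^'n^'n) = axis i 1" for i
    by (auto simp: row_def mat_def axis_def vec_eq_iff)
  have "(\<Sum>i\<in>UNIV. v$i *s row i (mat 1)) = v"
    unfolding r by (rule basis_expansion)
  moreover have "det (\<chi> i. if i = k then (\<Sum>i\<in>UNIV. v$i *s row i (mat 1)) else row i (mat 1 :: real^'n^'n)) = v$k * det (mat 1 :: real^'n^'n)"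
    by (rule cramer_lemma_transpose)
  ultimately show ?thesis by (simp only: r det_I mult_1_right)
qed

text \<open>
  The principal pivot transform, characterised by exchanging the coordinates in \<open>S\<close> of argument and
  value. In this form a sweep only exchanges one more coordinate, and for \<open>S = UNIV\<close> the relation reads
  \<open>N M = - I\<close>.
\<close>

definition pivoted :: "'n set \<Rightarrow> real^'n^'n \<Rightarrow> real^'n^'n \<Rightarrow> bool" where
  "pivoted S M N \<longleftrightarrow> (\<forall>x. N *v mix S (M *v x) x = mix S (- x) (M *v x))"

text \<open>
  Equation \<open>k\<close> of the exchange relation is solved for \<open>x\<^sub>k\<close> and substituted into the others.
\<close>

lemma pivoted_sweep:
  fixes M N :: "real^'n^'n"
  assumes N: "pivoted S M N" and k: "k \<notin> S" "N$k$k \<noteq> 0"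
  shows "pivoted (insert k S) M (sweep k N)"
  unfolding pivoted_def
proof
  fix x :: "real^'n"
  let ?u = "mix S (M *v x) x"
  have eq: "(\<Sum>j\<in>UNIV. N$i$j * ?u$j) = mix S (- x) (M *v x) $ i" for i
    using N[unfolded pivoted_def, rule_format, of x] by (metis matrix_vector_mul_component inner_vec_def inner_real_def)
  define R where "R i = (\<Sum>j\<in>UNIV - {k}. N$i$j * ?u$j)" for i
  have eqR: "R i + N$i$k * x$k = mix S (- x) (M *v x) $ i" for i
    using eq[of i] k(1) by (subst (asm) sum.remove[of _ k]) (simp_all add: R_def mix_def)
  have eqk: "R k + N$k$k * x$k = (M *v x)$k" using eqR[of k] k by (simp add: mix_def)
  have rest: "mix (insert k S) (M *v x) x $ j = ?u $ j" if "j \<noteq> k" for j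
    using that by (simp add: mix_def)
  have at: "mix (insert k S) (M *v x) x $ k = (M *v x)$k" by (simp add: mix_def)
  show "sweep k N *v mix (insert k S) (M *v x) x = mix (insert k S) (- x) (M *v x)"
  proof (rule vec_eq_iff[THEN iffD2, rule_format])
    fix i
    have "(sweep k N *v mix (insert k S) (M *v x) x) $ i =
       sweep k N $ i $ k * (M *v x)$k + (\<Sum>j\<in>UNIV - {k}. sweep k N $ i $ j * ?u $ j)"
      unfolding matrix_vector_mult_def vec_lambda_beta
      by (subst sum.remove[of _ k]) (simp_all add: at[unfolded matrix_vector_mult_def] rest[unfolded matrix_vector_mult_def])
    also have "\<dots> = mix (insert k S) (- x) (M *v x) $ i"
    proof (cases "i = k")
      case True
      have "(\<Sum>j\<in>UNIV - {k}. sweep k N $ k $ j * ?u $ j) = R k / N$k$k"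
        unfolding R_def sum_divide_distrib by (intro sum.cong) (auto simp: sweep_def)
      then show ?thesis using True eqk k by (simp add: sweep_def mix_def field_simps)
    next
      case False
      have "(\<Sum>j\<in>UNIV - {k}. sweep k N $ i $ j * ?u $ j) = R i - N$i$k / N$k$k * R k"
        unfolding R_def sum_distrib_left sum_subtractf[symmetric]
        using False by (intro sum.cong) (auto simp: sweep_def field_simps)
      then have "sweep k N $ i $ k * (M *v x)$k + (\<Sum>j\<in>UNIV - {k}. sweep k N $ i $ j * ?u $ j)
        = R i + N$i$k * x$k"
        using False k unfolding eqk[symmetric] by (simp add: sweep_def field_simps)
      then show ?thesis using False eqR[of i] by (simp add: mix_def)
    qed
    finally show "(sweep k N *v mix (insert k S) (M *v x) x) $ i = mix (insert k S) (- x) (M *v x) $ i" .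
  qed
qed

lemma pivoted_det:
  fixes M N :: "real^'n^'n"
  assumes N: "pivoted S M N" and k: "k \<notin> S"
  shows "det (mix_matrix (insert k S) M) = N$k$k * det (mix_matrix S M)"
proof -
  \<comment> \<open>By the exchange relation the new row \<open>k\<close> of the mixed matrix is row \<open>k\<close> of \<open>N\<close> applied to the old one.\<close>
  let ?R = "(\<chi> i. if i = k then N$k else axis i 1) :: real^'n^'n"
  have R: "?R *v u = (\<chi> i. if i = k then (N *v u)$k else u$i)" for u
  proof -
    have "(\<Sum>j\<in>UNIV. axis i 1 $ j * u $ j) = u $ i" for i
      by (simp add: axis_def if_distrib[of "\<lambda>a. a * _"] cong: if_cong)
    then show ?thesis by (auto simp: matrix_vector_mult_def vec_eq_iff)
  qed
  have "mix_matrix (insert k S) M = ?R ** mix_matrix S M"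
    unfolding matrix_eq
  proof
    fix x
    show "mix_matrix (insert k S) M *v x = (?R ** mix_matrix S M) *v x"
      unfolding matrix_vector_mul_assoc[symmetric] mix_matrix_mult R
        N[unfolded pivoted_def, rule_format]
      using k by (simp add: mix_def vec_eq_iff)
  qed
  then show ?thesis by (simp add: det_mul det_replace_unit_row)
qed

lemma pivoted_sweeps:
  fixes M N :: "real^'n^'n"
  assumes "pivoted S M N" "distinct ks" "set ks \<inter> S = {}" "pivots ks N \<noteq> 0"
  shows "pivoted (S \<union> set ks) M (sweeps ks N) \<and> det (mix_matrix (S \<union> set ks) M) = pivots ks N * det (mix_matrix S M)"
  using assms
proof (induction ks arbitrary: S N)
  case (Cons k ks)
  have nz: "N$k$k \<noteq> 0" "pivots ks (sweep k N) \<noteq> 0" "k \<notin> S" using Cons.prems by auto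
  have "pivoted (insert k S) M (sweep k N)" using Cons.prems nz by (intro pivoted_sweep) auto
  from Cons.IH[OF this] Cons.prems nz pivoted_det[OF Cons.prems(1), of k]
  show ?case by auto
qed simp

text \<open>
  Each pivot is the value of the quadratic form of \<open>M\<close> at a suitable nonzero vector.
\<close>

lemma pos_def_pivots:
  fixes M N :: "real^'n^'n"
  assumes M: "pos_def M" and "pivoted S M N" "distinct ks" "set ks \<inter> S = {}"
  shows "pivots ks N > 0"
  using assms(2-)
proof (induction ks arbitrary: S N)
  case (Cons k ks)
  have inj: "x = 0" if "mix_matrix S M *v x = 0" for x
  proof (rule ccontr)
    assume "x \<noteq> 0"
    have *: "mix S (M *v x) x $ i = 0" for i
      using that unfolding mix_matrix_mult by simp
    have "x $ i * (M *v x) $ i = 0" for i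
      using *[of i] by (cases "i \<in> S") (auto simp: mix_def)
    then have "x \<bullet> (M *v x) = 0" unfolding inner_vec_def inner_real_def by (intro sum.neutral) simp
    with pos_def_inner[OF M \<open>x \<noteq> 0\<close>] show False by simp
  qed
  then obtain B where B: "B ** mix_matrix S M = mat 1"
    using matrix_left_invertible_ker[of "mix_matrix S M"] by auto
  then have B': "mix_matrix S M ** B = mat 1" by (simp add: matrix_left_right_inverse)
  \<comment> \<open>The vector with \<open>(M x)\<^sub>i = 0\<close> on \<open>S\<close> and \<open>x = e\<^sub>k\<close> off \<open>S\<close>: its value \<open>x \<bullet> M x\<close> is the pivot.\<close>
  define x where "x = B *v axis k 1"
  have "mix_matrix S M *v x = axis k 1"
    by (simp add: x_def matrix_vector_mul_assoc B')
  then have x: "mix S (M *v x) x = axis k 1"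
    by (simp add: mix_matrix_mult)
  have kS: "k \<notin> S" using Cons.prems by auto
  have x': "x$i = (if i = k then 1 else 0)" if "i \<notin> S" for i
    using arg_cong[OF x, of "\<lambda>v. v$i"] that by (simp add: mix_def axis_def)
  have Mx: "(M *v x)$i = 0" if "i \<in> S" for i
    using arg_cong[OF x, of "\<lambda>v. v$i"] that kS by (auto simp: mix_def axis_def)
  have "x$k = 1" using x'[OF kS] by simp
  then have "x \<noteq> 0" by auto
  have "x \<bullet> (M *v x) = (\<Sum>i\<in>UNIV. if i = k then (M *v x)$k else 0)"
    unfolding inner_vec_def by (intro sum.cong) (use x' Mx in force)+
  then have pos: "(M *v x)$k > 0" using pos_def_inner[OF M \<open>x \<noteq> 0\<close>] by simp
  have "(N *v axis k 1)$k = (M *v x)$k"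
    using Cons.prems(1)[unfolded pivoted_def, rule_format, of x] kS unfolding x by (simp add: mix_def)
  then have Nk: "N$k$k > 0" using pos by (simp add: matrix_vector_mul_component inner_axis)
  have "pivoted (insert k S) M (sweep k N)" using Cons.prems Nk by (intro pivoted_sweep) auto
  from Cons.IH[OF this] Cons.prems Nk show ?case by auto
qed simp

lemma pivoted_empty: "pivoted {} M M"
  by (simp add: pivoted_def mix_def vec_lambda_eta)

lemma sweeps_all:
  fixes M :: "real^'n^'n"
  assumes ks: "distinct ks" "set ks = UNIV" and nz: "pivots ks M \<noteq> 0"
  shows "matrix_inv M = - sweeps ks M" "det M = pivots ks M"
proof -
  have "pivoted UNIV M (sweeps ks M)" and det: "det (mix_matrix UNIV M) = pivots ks M * det (mix_matrix {} M)"
    using pivoted_sweeps[OF pivoted_empty ks(1) _ nz] ks(2) by auto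
  then have "sweeps ks M *v (M *v x) = - x" for x
    unfolding pivoted_def mix_def by (simp add: vec_lambda_eta) (simp add: vec_eq_iff)
  moreover have "(- N) *v y = - (N *v y)" for N :: "real^'n^'n" and y
    by (simp add: matrix_vector_mult_def sum_negf vec_eq_iff)
  ultimately have "- sweeps ks M ** M = mat 1"
    unfolding matrix_eq by (simp add: matrix_vector_mul_assoc[symmetric])
  then show "matrix_inv M = - sweeps ks M" by (rule matrix_inv_unique)
  have "(\<chi> i. axis i 1) = (mat 1 :: real^'n^'n)" by (auto simp: vec_eq_iff axis_def mat_def)
  then show "det M = pivots ks M" using det by (simp add: mix_matrix_def vec_lambda_eta)
qed

lemma pos_def_det_pos:
  fixes M :: "real^'n^'n"
  assumes "pos_def M" shows "det M > 0"
proof -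
  obtain ks :: "'n list" where ks: "set ks = UNIV" "distinct ks"
    using finite_distinct_list[of "UNIV :: 'n set"] by auto
  have "pivots ks M > 0" using pos_def_pivots[OF assms pivoted_empty ks(2)] by simp
  with sweeps_all(2)[OF ks(2,1)] show ?thesis by simp
qed

lemma measurable_pos_def_inverse:
  "(\<lambda>Z :: real^'n^'n. if pos_def Z then matrix_inv Z else mat 1) \<in> borel_measurable borel"
proof -
  obtain ks :: "'n list" where ks: "set ks = UNIV" "distinct ks"
    using finite_distinct_list[of "UNIV :: 'n set"] by auto
  have "matrix_inv Z = - sweeps ks Z" if "pos_def Z" for Z
    using pos_def_pivots[OF that pivoted_empty ks(2)] sweeps_all(1)[OF ks(2,1), of Z] by simp
  then have "(\<lambda>Z. if pos_def Z then matrix_inv Z else mat 1) = (\<lambda>Z. if pos_def Z then - sweeps ks Z else mat 1)"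
    by auto
  also have "\<dots> \<in> borel_measurable borel"
    by (rule measurable_If) (auto intro: borel_measurable_uminus measurable_sweeps sets_pos_def)
  finally show ?thesis .
qed

text \<open>
  The entry \<open>{i, j}\<close> is read at a chosen ordering of the pair; symmetry makes the choice irrelevant.
\<close>

lemma sym_matrix_surj:
  fixes D :: "real^'n^'n"
  assumes "transpose D = D"
  shows "\<exists>d. sym_matrix d = D"
proof -
  define P where "P e = (SOME ij. e = {fst ij, snd ij})" for e :: "'n set"
  have "D $ fst (P {i, j}) $ snd (P {i, j}) = D $ i $ j" for i j
  proof -
    have "\<exists>ij. {i, j} = {fst ij, snd ij}" by (rule exI[of _ "(i, j)"]) simp
    from someI_ex[OF this] have "{i, j} = {fst (P {i, j}), snd (P {i, j})}"
      unfolding P_def .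
    moreover have "D $ j $ i = D $ i $ j" using assms by (simp add: transpose_def vec_eq_iff)
    ultimately show ?thesis by (auto simp: doubleton_eq_iff)
  qed
  then show ?thesis
    by (intro exI[of _ "\<lambda>e. D $ fst (P e) $ snd (P e)"]) (simp add: sym_matrix_def vec_eq_iff)
qed

lemma nn_integral_sym_reflect:
  fixes D :: "real^'n^'n" and f :: "real^'n^'n \<Rightarrow> ennreal"
  assumes D: "transpose D = D" and f[measurable]: "f \<in> borel_measurable borel"
  shows "(\<integral>\<^sup>+Z. f Z \<partial>sym_lborel) = (\<integral>\<^sup>+Z. f (D - Z) \<partial>sym_lborel)"
proof -
  from sym_matrix_surj[OF D] obtain d where d: "sym_matrix d = D" by blast
  have eq: "sym_matrix (\<lambda>e\<in>sym_indices. -1 * z e + d e) = D - sym_matrix z" for z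
    unfolding d[symmetric] by (simp add: sym_matrix_def vec_eq_iff)
  have "(\<integral>\<^sup>+Z. f Z \<partial>sym_lborel) = (\<integral>\<^sup>+z. f (sym_matrix z) \<partial>PiL sym_indices)"
    by (rule nn_integral_sym_lborel) measurable
  also have "\<dots> = (\<integral>\<^sup>+z. ennreal (\<Prod>e\<in>(sym_indices :: 'n set set). \<bar>-1\<bar>) *
      f (sym_matrix (\<lambda>e\<in>sym_indices. -1 * z e + d e)) \<partial>PiL sym_indices)"
    by (rule nn_integral_PiL_affine) auto
  also have "\<dots> = (\<integral>\<^sup>+Z. f (D - Z) \<partial>sym_lborel)"
    unfolding eq by (subst nn_integral_sym_lborel) auto
  finally show ?thesis .
qed

text \<open>
  \<open>Z\<^sup>-\<^sup>1\<close> is the negative of the fully swept \<open>Z\<close>, and the product of the pivot powers is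
  \<open>|Z|\<close> to the power \<open>- (p + 1)\<close>.
\<close>

theorem nn_integral_pos_def_inverse:
  fixes f :: "real^'n^'n \<Rightarrow> ennreal"
  assumes f[measurable]: "f \<in> borel_measurable borel"
  shows "(\<integral>\<^sup>+Z. indicator {Z. pos_def Z} Z * f Z \<partial>sym_lborel) =
    (\<integral>\<^sup>+Z. indicator {Z. pos_def Z} Z * (ennreal ((1 / det Z) ^ (CARD('n) + 1)) * f (matrix_inv Z)) \<partial>sym_lborel)"
proof -
  obtain ks :: "'n list" where ks: "set ks = UNIV" "distinct ks"
    using finite_distinct_list[of "UNIV :: 'n set"] by auto
  let ?g = "\<lambda>Z. indicator {Z. pos_def Z} Z * f Z"
  have tr0: "transpose (0 :: real^'n^'n) = 0" by (simp add: transpose_def vec_eq_iff)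
  have "(\<integral>\<^sup>+Z. ?g Z \<partial>sym_lborel) = (\<integral>\<^sup>+Z. ?g (0 - Z) \<partial>sym_lborel)"
    by (rule nn_integral_sym_reflect[OF tr0]) measurable
  also have "\<dots> = (\<integral>\<^sup>+Z. ennreal ((1 / \<bar>pivots ks Z\<bar>) ^ (CARD('n) + 1)) * ?g (0 - sweeps ks Z) \<partial>sym_lborel)"
    by (rule nn_integral_sweeps) measurable
  also have "\<dots> = (\<integral>\<^sup>+Z. indicator {Z. pos_def Z} Z * (ennreal ((1 / det Z) ^ (CARD('n) + 1)) * f (matrix_inv Z)) \<partial>sym_lborel)"
  proof (rule nn_integral_cong)
    fix Z :: "real^'n^'n"
    show "ennreal ((1 / \<bar>pivots ks Z\<bar>) ^ (CARD('n) + 1)) * ?g (0 - sweeps ks Z) =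
      indicator {Z. pos_def Z} Z * (ennreal ((1 / det Z) ^ (CARD('n) + 1)) * f (matrix_inv Z))"
    proof (cases "pivots ks Z = 0")
      case True
      then have "\<not> pos_def Z" using pos_def_pivots[OF _ pivoted_empty ks(2), of Z] by auto
      with True show ?thesis by simp
    next
      case False
      note inv = sweeps_all[OF ks(2,1) False]
      \<comment> \<open>The cone is invariant under inversion, so its indicator agrees at \<open>Z\<close> and at the inverse of \<open>Z\<close>.\<close>
      have "pos_def Z" if *: "pos_def (matrix_inv Z)"
      proof -
        have "Z ** matrix_inv Z = mat 1" using False inv(2) by (intro matrix_inv_det_nonzero) simp
        then have "matrix_inv (matrix_inv Z) = Z" by (rule matrix_inv_unique)
        with pos_def_matrix_inv[OF *] show ?thesis by simp
      qed
      then have "pos_def (matrix_inv Z) \<longleftrightarrow> pos_def Z" using pos_def_matrix_inv by blast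
      then show ?thesis using pos_def_det_pos[of Z]
        by (auto simp: inv indicator_def)
    qed
  qed
  finally show ?thesis .
qed

section \<open>Substitutions in complex integrals\<close>

lemma measurable_det [measurable]: "det \<in> borel_measurable (borel :: (real^'n^'n) measure)"
  unfolding det_def by measurable

lemma measurable_of_real_powr [measurable]: "(\<lambda>x::real. complex_of_real x powr s) \<in> borel_measurable borel"
proof -
  have "complex_of_real x powr s = (if x = 0 then 0 else if x > 0 then exp (s * of_real (ln x))
     else exp (s * (of_real (ln (- x)) + \<i> * of_real pi)))" for x
    by (auto simp: powr_def Ln_of_real' abs_if mult.commute)
  then show ?thesis by (simp cong: measurable_cong)
qed

lemma measurable_det_powr [measurable]: "(\<lambda>Z :: real^'n^'n. det_powr Z s) \<in> borel_measurable borel"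
  unfolding det_powr_def by measurable

lemma norm_of_real_powr: "x > 0 \<Longrightarrow> norm (complex_of_real x powr s) = x powr Re s"
  by (simp add: norm_powr_real_powr)

text \<open>
  Tested on indicators, a substitution rule for nonnegative functions is an identity of measures.
\<close>

lemma change_of_variables_measure_eq:
  fixes w :: "'a \<Rightarrow> real"
  assumes T[measurable]: "T \<in> M \<rightarrow>\<^sub>M N" and w[measurable]: "w \<in> borel_measurable M"
    and eq: "\<And>f. f \<in> borel_measurable N \<Longrightarrow> (\<integral>\<^sup>+x. f x \<partial>N) = (\<integral>\<^sup>+x. ennreal (w x) * f (T x) \<partial>M)"
  shows "N = distr (density M (\<lambda>x. ennreal (w x))) N T"
proof (rule measure_eqI)
  fix A assume A[measurable]: "A \<in> sets N"
  have "emeasure N A = (\<integral>\<^sup>+x. indicator A x \<partial>N)" by simp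
  also have "\<dots> = (\<integral>\<^sup>+x. ennreal (w x) * indicator A (T x) \<partial>M)" by (rule eq) simp
  also have "\<dots> = (\<integral>\<^sup>+x. ennreal (w x) * indicator (T -` A \<inter> space M) x \<partial>M)"
    by (intro nn_integral_cong) (auto simp: indicator_def)
  also have "\<dots> = emeasure (distr (density M (\<lambda>x. ennreal (w x))) N T) A"
    by (subst emeasure_distr, simp, simp, subst emeasure_density) auto
  finally show "emeasure N A = emeasure (distr (density M (\<lambda>x. ennreal (w x))) N T) A" .
qed simp

lemma has_bochner_integral_change_of_variables:
  fixes f :: "'b \<Rightarrow> 'c::{banach, second_countable_topology}" and w :: "'a \<Rightarrow> real"
  assumes T: "T \<in> M \<rightarrow>\<^sub>M N" and w: "w \<in> borel_measurable M" "\<And>x. w x \<ge> 0"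
    and eq: "\<And>f. f \<in> borel_measurable N \<Longrightarrow> (\<integral>\<^sup>+x. f x \<partial>N) = (\<integral>\<^sup>+x. ennreal (w x) * f (T x) \<partial>M)"
    and f: "f \<in> borel_measurable N"
  shows "has_bochner_integral N f I \<longleftrightarrow> has_bochner_integral M (\<lambda>x. w x *\<^sub>R f (T x)) I"
proof -
  have "(\<lambda>x. f (T x)) \<in> borel_measurable M" using T f by measurable
  then show ?thesis
    using T w f
    by (subst change_of_variables_measure_eq[OF T w(1) eq])
      (simp_all add: has_bochner_integral_iff integrable_distr_eq integral_distr integrable_density integral_density)
qed

text \<open>
  Fubini for a product of functions of disjoint sets of coordinates.
\<close>

lemma has_bochner_integral_PiL_mult:
  fixes f g :: "('i \<Rightarrow> real) \<Rightarrow> complex"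
  assumes IJ: "I \<inter> J = {}" "finite I" "finite J"
    and f: "has_bochner_integral (PiL I) f a" and g: "has_bochner_integral (PiL J) g b"
  shows "has_bochner_integral (PiL (I \<union> J)) (\<lambda>z. f (restrict z I) * g (restrict z J)) (a * b)"
proof -
  interpret I: sigma_finite_measure "PiL I" by (rule lebesgue_product.sigma_finite) fact
  interpret J: sigma_finite_measure "PiL J" by (rule lebesgue_product.sigma_finite) fact
  interpret P: pair_sigma_finite "PiL I" "PiL J" ..
  have f': "integrable (PiL I) f" "integral\<^sup>L (PiL I) f = a" and g': "integrable (PiL J) g" "integral\<^sup>L (PiL J) g = b"
    using f g by (auto simp: has_bochner_integral_iff)
  have [measurable]: "f \<in> borel_measurable (PiL I)" "g \<in> borel_measurable (PiL J)" using f' g' by auto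
  let ?h = "\<lambda>z. f (restrict z I) * g (restrict z J)"
  have int: "integrable (PiL I \<Otimes>\<^sub>M PiL J) (\<lambda>(x, y). f x * g y)"
  proof (rule P.Fubini_integrable)
    show "integrable (PiL I) (\<lambda>x. \<integral>y. norm (case (x, y) of (x, y) \<Rightarrow> f x * g y) \<partial>PiL J)"
      using f'(1) g'(1) by (simp add: norm_mult)
    show "AE x in PiL I. integrable (PiL J) (\<lambda>y. case (x, y) of (x, y) \<Rightarrow> f x * g y)"
      using g'(1) by simp
  qed measurable
  have val: "integral\<^sup>L (PiL I \<Otimes>\<^sub>M PiL J) (\<lambda>(x, y). f x * g y) = a * b"
    using P.integral_fst'[OF int] f' g' by simp
  have [measurable]: "?h \<in> borel_measurable (PiL (I \<union> J))"
    by (intro borel_measurable_times measurable_compose[OF measurable_restrict_subset]) auto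
  have res: "restrict (merge I J (x, y)) I = x" "restrict (merge I J (x, y)) J = y"
    if "x \<in> space (PiL I)" "y \<in> space (PiL J)" for x y
    using that IJ by (auto simp: space_PiM merge_def restrict_def PiE_def extensional_def fun_eq_iff)
  have "has_bochner_integral (PiL I \<Otimes>\<^sub>M PiL J) (\<lambda>p. ?h (merge I J p)) (a * b)"
    using int val
    by (subst has_bochner_integral_cong[where g="\<lambda>(x, y). f x * g y" and N="PiL I \<Otimes>\<^sub>M PiL J" and y="a * b"])
      (auto simp: space_pair_measure res has_bochner_integral_iff)
  then have "has_bochner_integral (distr (PiL I \<Otimes>\<^sub>M PiL J) (PiL (I \<union> J)) (merge I J)) ?h (a * b)"
    by (intro has_bochner_integral_distr) measurable
  then show ?thesis using lebesgue_product.distr_merge[OF IJ] by simp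
qed

text \<open>
  Euler's integral, moved from the Henstock-Kurzweil to the Lebesgue integral.
\<close>

lemma has_bochner_integral_Gamma:
  assumes "Re \<alpha> > 0"
  shows "has_bochner_integral lborel
    (\<lambda>x. indicator {0<..} x *\<^sub>R (complex_of_real x powr (\<alpha> - 1) * exp (- complex_of_real x))) (Gamma \<alpha>)"
proof -
  let ?f = "\<lambda>t. complex_of_real t powr (\<alpha> - 1) / of_real (exp t)"
  have eq: "?f x = complex_of_real x powr (\<alpha> - 1) * exp (- complex_of_real x)" for x
    by (simp add: exp_minus exp_of_real divide_inverse)
  note * = absolutely_integrable_Gamma_integral'[OF assms]
  have m: "(\<lambda>x. indicator {0<..} x *\<^sub>R ?f x) \<in> borel_measurable borel" by measurable
  have "(LINT x:{0<..}|lebesgue. ?f x) = Gamma \<alpha>"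
    using set_lebesgue_integral_eq_integral(2)[OF *] Gamma_integral_complex'[OF assms]
    by (simp add: integral_unique)
  with * m show ?thesis
    unfolding eq[symmetric]
    by (simp add: has_bochner_integral_iff set_integrable_def set_lebesgue_integral_def
        integrable_completion integral_completion)
qed

lemma has_bochner_integral_gaussian:
  "has_bochner_integral lborel (\<lambda>x. exp (- (complex_of_real x)\<^sup>2)) (of_real (sqrt pi))"
proof -
  have half: "has_bochner_integral lborel (\<lambda>x. indicator {0..} x *\<^sub>R exp (- x\<^sup>2)) (sqrt pi / 2)"
    by (rule gaussian_moment_0)
  have "has_bochner_integral lborel (\<lambda>x::real. exp (- x\<^sup>2)) (sqrt pi)"
    using has_bochner_integral_even_function[OF half] by simp
  from has_bochner_integral_of_real[OF this, where 'a = complex]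
  show ?thesis by (simp add: exp_of_real[symmetric])
qed

section \<open>The matrix gamma integral\<close>

definition sub_indices :: "'n set \<Rightarrow> 'n set set" where
  "sub_indices S = {{i, j} | i j. i \<in> S \<and> j \<in> S}"

text \<open>
  The dimension is fixed by the type, so a principal submatrix is extended by the identity instead of
  being cut out. Determinant and positive definiteness are those of the submatrix, and the gamma
  integral can be computed by induction on \<open>S\<close>.
\<close>

definition sub_matrix :: "'n set \<Rightarrow> ('n set \<Rightarrow> real) \<Rightarrow> real^'n^'n" where
  "sub_matrix S z = (\<chi> i j. if i \<in> S \<and> j \<in> S then z {i, j} else of_bool (i = j))"

lemma measurable_sub_matrix [measurable]:
  "sub_matrix S \<in> borel_measurable (PiL (sub_indices S))"
proof (rule borel_measurable_matrixI)
  fix i j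
  show "(\<lambda>z. sub_matrix S z $ i $ j) \<in> borel_measurable (PiL (sub_indices S))"
  proof (cases "i \<in> S \<and> j \<in> S")
    case True
    then have "{i, j} \<in> sub_indices S" by (auto simp: sub_indices_def)
    from measurable_PiL_component[OF this] True show ?thesis by (simp add: sub_matrix_def)
  next
    case False
    then have "sub_matrix S z $ i $ j = of_bool (i = j)" for z by (auto simp: sub_matrix_def)
    then show ?thesis by simp
  qed
qed

text \<open>
  The block form of the Schur complement: with \<open>g\<^sub>k = \<surd>x\<close> and \<open>g\<^sub>i = u\<^sub>i\<close> the bordered matrix with corner
  \<open>x\<close>, border \<open>\<surd>x u\<close> and block \<open>W + u u\<^sup>T\<close> is congruent to \<open>W\<close>.
\<close>

lemma bordered_congruence:
  fixes W :: "real^'n^'n" and g :: "real^'n"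
  assumes W: "\<And>j. W$k$j = of_bool (k = j)" "\<And>i. W$i$k = of_bool (i = k)"
    and M: "\<And>i j. M$i$j = (if i = k \<or> j = k then 0 else W$i$j) + g$i * g$j" and gk: "g$k > 0"
  shows "det M = (g$k)\<^sup>2 * det W" "pos_def M \<longleftrightarrow> pos_def W"
proof -
  \<comment> \<open>\<open>M = G W G\<^sup>T\<close> for \<open>G\<close> the identity with column \<open>k\<close> replaced by \<open>g\<close>.\<close>
  define G :: "real^'n^'n" where "G = (\<chi> i j. if j = k then g$i else mat 1 $ i $ j)"
  have sum: "(\<Sum>a\<in>UNIV. G$i$a * h a) = (if i = k then 0 else h i) + g$i * h k" for i h
  proof -
    have "(\<Sum>a\<in>UNIV. G$i$a * h a) = (\<Sum>a\<in>UNIV. (if a = i then if i = k then 0 else h i else 0) + (if a = k then g$i * h k else 0))"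
      by (intro sum.cong) (auto simp: G_def mat_def)
    then show ?thesis by (simp add: sum.distrib)
  qed
  have GW: "(G ** W)$i$j = (if i = k then 0 else W$i$j) + g$i * of_bool (k = j)" for i j
    by (simp only: matrix_matrix_mult_def vec_lambda_beta sum W)
  have "(G ** W ** transpose G)$i$j = (\<Sum>b\<in>UNIV. G$j$b * (G ** W)$i$b)" for i j
    by (simp add: matrix_matrix_mult_def[of "G ** W"] transpose_def mult.commute)
  then have GWG: "(G ** W ** transpose G)$i$j = (if j = k then 0 else (G ** W)$i$j) + g$j * (G ** W)$i$k" for i j
    by (simp only: sum)
  have "M = G ** W ** transpose G"
    unfolding vec_eq_iff GWG GW M by (auto simp: W)
  moreover have "det G = g$k"
    using cramer_lemma[of k "mat 1 :: real^'n^'n" g] unfolding matrix_vector_mul_lid by (simp add: G_def)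
  ultimately show "det M = (g$k)\<^sup>2 * det W" "pos_def M \<longleftrightarrow> pos_def W"
    using gk pos_def_congruence_iff[of G W] by (auto simp: det_mul power2_eq_square)
qed

lemma pos_def_diagonal_pos:
  fixes M :: "real^'n^'n"
  assumes "pos_def M" shows "M$k$k > 0"
proof -
  have "axis k 1 \<bullet> (M *v axis k 1) > 0"
    using assms by (intro pos_def_inner) simp_all
  then show ?thesis
    by (simp add: inner_axis' matrix_vector_mul_component inner_axis)
qed

definition gamma_integrand :: "'n::finite set \<Rightarrow> complex \<Rightarrow> ('n set \<Rightarrow> real) \<Rightarrow> complex" where
  "gamma_integrand S \<alpha> z = indicator {z. pos_def (sub_matrix S z)} z *\<^sub>R
     (det_powr (sub_matrix S z) (\<alpha> - (of_nat (card S) + 1) / 2) * exp (- of_real (\<Sum>i\<in>S. z {i})))"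

lemma measurable_gamma_integrand [measurable]:
  "gamma_integrand S \<alpha> \<in> borel_measurable (PiL (sub_indices S))"
proof -
  have i: "(indicator {z. pos_def (sub_matrix S z)} z :: real) = indicator {Z. pos_def Z} (sub_matrix S z)" for z
    by (simp add: indicator_def)
  have s: "(\<lambda>z. \<Sum>i\<in>S. z {i}) \<in> borel_measurable (PiL (sub_indices S))"
  proof (rule borel_measurable_sum)
    fix i assume "i \<in> S"
    then have "{i} \<in> sub_indices S" by (auto simp: sub_indices_def)
    then show "(\<lambda>z. z {i}) \<in> borel_measurable (PiL (sub_indices S))" by (rule measurable_PiL_component)
  qed
  note [measurable] = s
  show ?thesis unfolding gamma_integrand_def i by measurable
qed

lemma mv_Gamma_Suc:
  "mv_Gamma (Suc s) \<alpha> = mv_Gamma s (\<alpha> - 1/2) * (Gamma \<alpha> * of_real (sqrt pi) ^ s)"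
proof -
  have p: "pi powr (real (Suc s) * (real (Suc s) - 1) / 4) = pi powr (real s * (real s - 1) / 4) * sqrt pi ^ s"
  proof -
    have "sqrt pi ^ s = pi powr (real s / 2)"
      by (simp add: powr_half_sqrt[symmetric] powr_realpow[symmetric] powr_powr)
    then show ?thesis by (simp add: powr_add[symmetric] field_simps)
  qed
  have g: "(\<Prod>j<Suc s. Gamma (\<alpha> - of_nat j / 2)) = Gamma \<alpha> * (\<Prod>j<s. Gamma (\<alpha> - 1 / 2 - of_nat j / 2))"
    unfolding prod.lessThan_Suc_shift
    by (auto intro!: prod.cong arg_cong[where f=Gamma] simp: field_simps)
  show ?thesis unfolding mv_Gamma_def p g by simp
qed

text \<open>
  In the coordinates \<open>(x, u, W)\<close> of the bordered matrix the determinant is \<open>x |W|\<close>, the trace is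
  \<open>x + |u|\<^sup>2 + tr W\<close>, and the Jacobian is \<open>x\<close> to the power \<open>s / 2\<close>. The integrand therefore splits into a Gamma
  integral in \<open>x\<close>, Gaussian integrals in \<open>u\<close>, and the integrand in \<open>W\<close> with \<open>\<alpha> - 1/2\<close> in place of \<open>\<alpha>\<close>.
\<close>

lemma has_bochner_integral_gamma_integrand_insert:
  fixes S :: "'n::finite set"
  assumes kS: "k \<notin> S" and \<alpha>: "Re \<alpha> > 0"
    and IH: "has_bochner_integral (PiL (sub_indices S)) (gamma_integrand S (\<alpha> - 1/2)) (mv_Gamma (card S) (\<alpha> - 1/2))"
  shows "has_bochner_integral (PiL (sub_indices (insert k S))) (gamma_integrand (insert k S) \<alpha>) (mv_Gamma (card (insert k S)) \<alpha>)"
proof -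
  define T where "T = insert k S"
  define K where "K = sub_indices T"
  define I where "I = sub_indices S"
  define V where "V = (\<lambda>i. {i, k}) ` S"
  define s where "s = card S"
  \<comment> \<open>\<open>T1\<close> adds \<open>u\<^sub>i u\<^sub>j\<close> to the old block and \<open>T2\<close> multiplies the border \<open>u\<close> by \<open>\<surd>x\<close>, where \<open>x = z {k}\<close>.
    For \<open>x \<le> 0\<close>, where both sides vanish, the scaling factor is set to \<open>1\<close>.\<close>
  define c where "c z = (if z {k} > 0 then sqrt (z {k}) else 1)" for z :: "'n set \<Rightarrow> real"
  define T1 where "T1 z = (\<lambda>e\<in>K. if e \<in> I then 1 * z e + pair_product (\<lambda>i. z {i, k}) e else z e)" for z
  define T2 where "T2 z = (\<lambda>e\<in>K. if e \<in> V then c z * z e + 0 else z e)" for z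
  have K_iff: "{i, j} \<in> K \<longleftrightarrow> i \<in> T \<and> j \<in> T" for i j
    by (auto simp: K_def sub_indices_def doubleton_eq_iff)
  have I_iff: "{i, j} \<in> I \<longleftrightarrow> i \<in> S \<and> j \<in> S" for i j
    by (auto simp: I_def sub_indices_def doubleton_eq_iff)
  have V_iff: "{i, j} \<in> V \<longleftrightarrow> i \<in> S \<and> j = k \<or> i = k \<and> j \<in> S" for i j
    by (auto simp: V_def image_iff doubleton_eq_iff)
  have K1: "{i} \<in> K \<longleftrightarrow> i \<in> T" and I1: "{i} \<in> I \<longleftrightarrow> i \<in> S" and V1: "{i} \<notin> V" for i
    using K_iff[of i i] I_iff[of i i] V_iff[of i i] kS by auto
  have sub: "I \<subseteq> K" "V \<subseteq> K" by (auto simp: I_def V_def K_def T_def sub_indices_def)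
  have disj: "I \<inter> insert {k} V = {}" using kS by (auto simp: V_def I_iff I1)
  have un: "K = I \<union> insert {k} V"
    by (auto simp: K_def I_def V_def T_def sub_indices_def image_iff)
  have finV: "finite V" by (simp add: V_def)
  have cardV: "card V = s"
    unfolding V_def s_def by (rule card_image) (auto simp: inj_on_def doubleton_eq_iff)
  note comp = measurable_PiL_component
  have mk[measurable]: "(\<lambda>z. z {k}) \<in> borel_measurable (PiL K)" by (rule comp) (simp add: K1 T_def)
  have mc[measurable]: "c \<in> borel_measurable (PiL K)" unfolding c_def by measurable
  have mw: "(\<lambda>z. pair_product (\<lambda>i. z {i, k}) e) \<in> borel_measurable (PiL K)" if "e \<in> I" for e
  proof -
    have "i \<in> S" if "i \<in> e" for i using \<open>e \<in> I\<close> that by (auto simp: I_def sub_indices_def)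
    then have "(\<lambda>z. z {i, k}) \<in> borel_measurable (PiL K)" if "i \<in> e" for i
      using that by (intro comp) (auto simp: K_iff T_def)
    then show ?thesis by (intro measurable_pair_product)
  qed
  have mT1[measurable]: "T1 \<in> PiL K \<rightarrow>\<^sub>M PiL K"
    unfolding T1_def by (rule measurable_PiL_fibre_affine) (use mw in auto)
  have mT2[measurable]: "T2 \<in> PiL K \<rightarrow>\<^sub>M PiL K"
    unfolding T2_def by (rule measurable_PiL_fibre_affine) (use mc in auto)
  have c_pos: "c z > 0" for z by (simp add: c_def)
  have T1k: "T1 z {k} = z {k}" for z using kS by (simp add: T1_def K1 I1 T_def)
  have cT: "c (T1 z) = c z" for z unfolding c_def T1k ..
  have change: "(\<integral>\<^sup>+z. f z \<partial>PiL K) = (\<integral>\<^sup>+z. ennreal (c z ^ s) * f (T2 (T1 z)) \<partial>PiL K)"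
    if f[measurable]: "f \<in> borel_measurable (PiL K)" for f
  proof -
    have "(\<integral>\<^sup>+z. f z \<partial>PiL K) = (\<integral>\<^sup>+z. ennreal (\<Prod>e\<in>V. \<bar>c z\<bar>) * f (T2 z) \<partial>PiL K)"
      unfolding T2_def
    proof (rule nn_integral_PiL_fibre_affine)
      fix z z' :: "'n set \<Rightarrow> real" and e
      assume "\<And>i. i \<in> K - V \<Longrightarrow> z i = z' i"
      from this[of "{k}"] show "c z = c z' \<and> (0::real) = 0" by (simp add: c_def K1 V1 T_def)
    qed (use sub c_pos in \<open>auto simp: less_imp_neq[symmetric]\<close>)
    also have "\<dots> = (\<integral>\<^sup>+z. ennreal (\<Prod>e\<in>I. \<bar>1\<bar>) * (ennreal (\<Prod>e\<in>V. \<bar>c (T1 z)\<bar>) * f (T2 (T1 z))) \<partial>PiL K)"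
      unfolding T1_def
    proof (rule nn_integral_PiL_fibre_affine)
      fix z z' :: "'n set \<Rightarrow> real" and e
      assume *: "\<And>i. i \<in> K - I \<Longrightarrow> z i = z' i" and e: "e \<in> I"
      have "z {i, k} = z' {i, k}" if "i \<in> e" for i
      proof (rule *)
        have "i \<in> S" using e that by (auto simp: I_def sub_indices_def)
        then show "{i, k} \<in> K - I" using kS by (simp add: I_iff K_iff T_def)
      qed
      then show "1 = (1::real) \<and> pair_product (\<lambda>i. z {i, k}) e = pair_product (\<lambda>i. z' {i, k}) e"
        by (simp cong: pair_product_cong)
    qed (use sub mw in \<open>auto simp: T1_def[symmetric]\<close>)
    also have "\<dots> = (\<integral>\<^sup>+z. ennreal (c z ^ s) * f (T2 (T1 z)) \<partial>PiL K)"
      using c_pos by (simp add: cardV cT abs_of_pos)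
    finally show ?thesis .
  qed
  \<comment> \<open>After the substitution the border contributes one Gamma integral and \<open>s\<close> Gaussian integrals.\<close>
  define h where "h e x = (if e = {k} then indicator {0<..} x *\<^sub>R (complex_of_real x powr (\<alpha> - 1) * exp (- complex_of_real x))
      else exp (- (complex_of_real x)\<^sup>2))" for e :: "'n set" and x
  have "has_bochner_integral (PiL (insert {k} V)) (\<lambda>z. \<Prod>e\<in>insert {k} V. h e (z e)) (\<Prod>e\<in>insert {k} V. integral\<^sup>L lborel (h e))"
  proof -
    have "integrable lborel (h e)" for e
      using has_bochner_integral_Gamma[OF \<alpha>] has_bochner_integral_gaussian
      by (cases "e = {k}") (simp_all add: h_def[abs_def] has_bochner_integral_iff)
    then show ?thesis
      unfolding has_bochner_integral_iff using finV
      by (intro conjI lebesgue_product.product_integrable_prod lebesgue_product.product_integral_prod) auto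
  qed
  moreover have "(\<Prod>e\<in>insert {k} V. integral\<^sup>L lborel (h e)) = Gamma \<alpha> * of_real (sqrt pi) ^ s"
  proof -
    have "(\<Prod>e\<in>V. integral\<^sup>L lborel (h e)) = (\<Prod>e\<in>V. of_real (sqrt pi))"
    proof (rule prod.cong[OF refl])
      fix e assume "e \<in> V"
      then have "e \<noteq> {k}" using V1 by auto
      then have "h e = (\<lambda>x. exp (- (complex_of_real x)\<^sup>2))" by (simp add: h_def[abs_def])
      then show "integral\<^sup>L lborel (h e) = of_real (sqrt pi)"
        using has_bochner_integral_gaussian by (simp add: has_bochner_integral_iff)
    qed
    moreover have "integral\<^sup>L lborel (h {k}) = Gamma \<alpha>"
      using has_bochner_integral_Gamma[OF \<alpha>] by (simp add: h_def[abs_def] has_bochner_integral_iff)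
    ultimately show ?thesis using V1 cardV by simp
  qed
  ultimately have "has_bochner_integral (PiL (insert {k} V)) (\<lambda>z. \<Prod>e\<in>insert {k} V. h e (z e)) (Gamma \<alpha> * of_real (sqrt pi) ^ s)"
    by simp
  from has_bochner_integral_PiL_mult[OF disj _ _ IH[folded I_def] this]
  have prod: "has_bochner_integral (PiL K) (\<lambda>z. gamma_integrand S (\<alpha> - 1/2) (restrict z I) *
      (\<Prod>e\<in>insert {k} V. h e (restrict z (insert {k} V) e))) (mv_Gamma (Suc s) \<alpha>)"
    by (simp add: mv_Gamma_Suc un s_def)
  have pt: "c z ^ s *\<^sub>R gamma_integrand T \<alpha> (T2 (T1 z)) = gamma_integrand S (\<alpha> - 1/2) (restrict z I) *
      (\<Prod>e\<in>insert {k} V. h e (restrict z (insert {k} V) e))" for z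
  proof -
    define x where "x = z {k}"
    define M where "M = sub_matrix T (T2 (T1 z))"
    define W where "W = sub_matrix S z"
    have T1: "T1 z {i, j} = (if i \<in> S \<and> j \<in> S then z {i, j} + z {i, k} * z {j, k} else z {i, j})" if "i \<in> T" "j \<in> T" for i j
      using that by (simp add: T1_def K_iff I_iff)
    have T2: "T2 y {i, j} = (if i \<in> S \<and> j = k \<or> i = k \<and> j \<in> S then c y * y {i, j} else y {i, j})" if "i \<in> T" "j \<in> T" for y i j
      using that by (simp add: T2_def K_iff V_iff)
    have diag: "T2 (T1 z) {i} = (if i = k then x else z {i} + (z {i, k})\<^sup>2)" if "i \<in> T" for i
      using T2[of i i "T1 z"] T1[of i i] that kS by (auto simp: T_def x_def power2_eq_square)
    have Mkk: "M$k$k = x" using diag[of k] by (simp add: M_def sub_matrix_def T_def)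
    have W': "sub_matrix S (restrict z I) = W" by (auto simp: W_def sub_matrix_def vec_eq_iff I_iff)
    have tr: "(\<Sum>i\<in>S. restrict z I {i}) = (\<Sum>i\<in>S. z {i})" by (intro sum.cong) (auto simp: I1)
    have hprod: "(\<Prod>e\<in>insert {k} V. h e (restrict z (insert {k} V) e)) =
       h {k} x * (\<Prod>i\<in>S. exp (- (complex_of_real (z {i, k}))\<^sup>2))"
    proof -
      have "(\<Prod>e\<in>insert {k} V. h e (restrict z (insert {k} V) e)) = (\<Prod>e\<in>insert {k} V. h e (z e))"
        by (intro prod.cong) auto
      also have "\<dots> = h {k} x * (\<Prod>e\<in>V. exp (- (complex_of_real (z e))\<^sup>2))"
        using V1 by (subst prod.insert) (auto simp: x_def h_def intro!: prod.cong)
      also have "(\<Prod>e\<in>V. exp (- (complex_of_real (z e))\<^sup>2)) = (\<Prod>i\<in>S. exp (- (complex_of_real (z {i, k}))\<^sup>2))"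
        unfolding V_def by (subst prod.reindex) (auto simp: inj_on_def doubleton_eq_iff)
      finally show ?thesis .
    qed
    show ?thesis
    proof (cases "x > 0")
      case False
      then have "\<not> pos_def M" using pos_def_diagonal_pos[of M k] Mkk by auto
      then show ?thesis using False unfolding hprod by (simp add: gamma_integrand_def M_def h_def)
    next
      case True
      define g :: "real^'n" where "g = (\<chi> i. if i = k then sqrt x else if i \<in> S then z {i, k} else 0)"
      have cz: "c z = sqrt x" using True by (simp add: c_def x_def)
      have gk: "g$k > 0" "(g$k)\<^sup>2 = x" using True by (auto simp: g_def)
      have M: "M$i$j = (if i = k \<or> j = k then 0 else W$i$j) + g$i * g$j" for i j
      proof (cases "i \<in> T \<and> j \<in> T")
        case True
        then show ?thesis
          using T2[of i j "T1 z"] T1[of i j] kS \<open>x > 0\<close>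
          by (auto simp: M_def W_def sub_matrix_def g_def T_def cT cz Mkk[unfolded M_def] x_def[symmetric] insert_commute)
      next
        case False
        then show ?thesis
          by (auto simp: M_def W_def sub_matrix_def g_def T_def)
      qed
      have Wk: "W$k$j = of_bool (k = j)" "W$i$k = of_bool (i = k)" for i j
        using kS by (auto simp: W_def sub_matrix_def)
      note dM = bordered_congruence[OF Wk M gk(1), unfolded gk(2)]
      show ?thesis
      proof (cases "pos_def W")
        case False
        then show ?thesis using dM by (simp add: gamma_integrand_def M_def[symmetric] W')
      next
        case PW: True
        then have dW: "det W > 0" by (rule pos_def_det_pos)
        let ?r = "\<alpha> - (of_nat s + 2) / 2"
        have cardT: "card T = Suc s" using kS by (simp add: T_def s_def)
        have e1: "det_powr M ?r = of_real x powr ?r * det_powr W ?r"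
          unfolding det_powr_def dM(1) of_real_mult using True dW by (intro powr_times_real) auto
        have e2: "of_real (sqrt x ^ s) * of_real x powr ?r = complex_of_real x powr (\<alpha> - 1)"
        proof -
          have "complex_of_real (sqrt x ^ s) = of_real x powr (of_nat s / 2)"
          proof -
            have "sqrt x ^ s = x powr (real s / 2)"
              using True by (simp add: powr_half_sqrt[symmetric] powr_realpow[symmetric] powr_powr)
            then show ?thesis using powr_of_real[of x "real s / 2"] True by simp
          qed
          then have "of_real (sqrt x ^ s) * of_real x powr ?r = complex_of_real x powr (of_nat s / 2 + ?r)"
            by (simp only: powr_add)
          moreover have "of_nat s / 2 + ?r = \<alpha> - 1" by (simp add: field_simps)
          ultimately show ?thesis by simp
        qed
        have "(\<Sum>i\<in>T. T2 (T1 z) {i}) = x + (\<Sum>i\<in>S. z {i} + (z {i, k})\<^sup>2)"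
          unfolding T_def using kS diag by (auto simp: T_def intro!: sum.cong)
        then have e3: "exp (- complex_of_real (\<Sum>i\<in>T. T2 (T1 z) {i})) =
           exp (- of_real x) * exp (- of_real (\<Sum>i\<in>S. z {i})) * (\<Prod>i\<in>S. exp (- (complex_of_real (z {i, k}))\<^sup>2))"
          by (simp add: exp_sum[symmetric] exp_add[symmetric] sum.distrib sum_negf algebra_simps)
        have expo: "\<alpha> - (of_nat (card T) + 1) / 2 = ?r" "\<alpha> - 1/2 - (of_nat (card S) + 1) / 2 = ?r"
          by (simp_all add: cardT s_def[symmetric] field_simps)
        have "c z ^ s *\<^sub>R gamma_integrand T \<alpha> (T2 (T1 z)) = of_real (sqrt x ^ s) * (of_real x powr ?r * det_powr W ?r *
           (exp (- of_real x) * exp (- of_real (\<Sum>i\<in>S. z {i})) * (\<Prod>i\<in>S. exp (- (complex_of_real (z {i, k}))\<^sup>2))))"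
          using dM(2) PW unfolding gamma_integrand_def M_def[symmetric] expo e1 e3 cz
          by (simp add: scaleR_conv_of_real M_def)
        also have "\<dots> = (of_real (sqrt x ^ s) * of_real x powr ?r) * exp (- of_real x) * (\<Prod>i\<in>S. exp (- (complex_of_real (z {i, k}))\<^sup>2))
           * (det_powr W ?r * exp (- of_real (\<Sum>i\<in>S. z {i})))"
          by (simp add: mult_ac)
        also have "\<dots> = gamma_integrand S (\<alpha> - 1/2) (restrict z I) * (h {k} x * (\<Prod>i\<in>S. exp (- (complex_of_real (z {i, k}))\<^sup>2)))"
          unfolding e2 gamma_integrand_def expo using True PW W' tr by (simp add: h_def mult_ac)
        finally show ?thesis unfolding hprod .
      qed
    qed
  qed
  have "has_bochner_integral (PiL K) (gamma_integrand T \<alpha>) (mv_Gamma (Suc s) \<alpha>)"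
  proof (subst has_bochner_integral_change_of_variables[where T="\<lambda>z. T2 (T1 z)" and w="\<lambda>z. c z ^ s" and M="PiL K"])
    show "has_bochner_integral (PiL K) (\<lambda>z. c z ^ s *\<^sub>R gamma_integrand T \<alpha> (T2 (T1 z))) (mv_Gamma (Suc s) \<alpha>)"
      using prod by (simp only: pt)
    show "gamma_integrand T \<alpha> \<in> borel_measurable (PiL K)" unfolding K_def by measurable
    show "(\<lambda>z. T2 (T1 z)) \<in> PiL K \<rightarrow>\<^sub>M PiL K" by measurable
    show "(\<lambda>z. c z ^ s) \<in> borel_measurable (PiL K)" by measurable
    show "0 \<le> c z ^ s" for z using c_pos[of z] by simp
  qed (rule change)
  then show ?thesis using kS by (simp add: K_def T_def s_def)
qed

lemma has_bochner_integral_gamma_integrand: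
  fixes S :: "'n::finite set"
  assumes "Re \<alpha> > (real (card S) - 1) / 2"
  shows "has_bochner_integral (PiL (sub_indices S)) (gamma_integrand S \<alpha>) (mv_Gamma (card S) \<alpha>)"
  using finite[of S] assms
proof (induction S arbitrary: \<alpha> rule: finite_induct)
  case empty
  have "sub_matrix {} z = (mat 1 :: real^'n^'n)" for z
    by (auto simp: sub_matrix_def mat_def vec_eq_iff)
  then show ?case
    by (simp add: has_bochner_integral_iff sub_indices_def PiM_empty integrable_count_space
        lebesgue_integral_count_space_finite gamma_integrand_def pos_def_mat_1 det_powr_def mv_Gamma_def)
next
  case (insert k S)
  show ?case
    by (rule has_bochner_integral_gamma_integrand_insert[OF insert.hyps(2)])
      (use insert.prems insert.hyps in \<open>auto intro!: insert.IH simp: field_simps\<close>)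
qed

section \<open>The positive definite square root\<close>

lemma symmetric_norm_bound:
  fixes T :: "real^'n^'n"
  assumes sym: "transpose T = T" and r: "r > 0"
    and lo: "\<And>x. 0 \<le> x \<bullet> (T *v x)" and hi: "\<And>x. x \<bullet> (T *v x) \<le> r * (x \<bullet> x)"
  shows "norm (T *v x) \<le> r * norm x"
proof -
  let ?y = "T *v x"
  \<comment> \<open>Positivity of the form at the test vector \<open>r x - T x\<close> replaces the spectral theorem.\<close>
  have "0 \<le> (r *\<^sub>R x - ?y) \<bullet> (T *v (r *\<^sub>R x - ?y))" by (rule lo)
  also have "\<dots> = r\<^sup>2 * (x \<bullet> ?y) - 2 * r * (?y \<bullet> ?y) + ?y \<bullet> (T *v ?y)"
    using symmetric_inner[OF sym, of x ?y]
    by (simp add: matrix_vector_mult_diff_distrib matrix_vector_mult_scaleR inner_diff_left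
        inner_diff_right power2_eq_square inner_commute algebra_simps)
  also have "\<dots> \<le> r\<^sup>2 * (x \<bullet> ?y) - 2 * r * (?y \<bullet> ?y) + r * (?y \<bullet> ?y)" using hi[of ?y] by simp
  finally have "r * (?y \<bullet> ?y) \<le> r * (r * (x \<bullet> ?y))" by (simp add: power2_eq_square algebra_simps)
  then have "?y \<bullet> ?y \<le> r * (x \<bullet> ?y)" using r by simp
  also have "\<dots> \<le> r * (r * (x \<bullet> x))" using r hi[of x] by (intro mult_left_mono) auto
  finally have "(norm ?y)\<^sup>2 \<le> (r * norm x)\<^sup>2" by (simp add: dot_square_norm power_mult_distrib power2_eq_square mult_ac)
  then show ?thesis using r by (intro power2_le_imp_le[of "norm ?y" "r * norm x"]) auto
qed

text \<open>
  With \<open>A = I - T\<close>, the equation \<open>(I - S)\<^sup>2 = A\<close> is the fixed point equation \<open>S = (T + S\<^sup>2) / 2\<close>, and the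
  right hand side is a contraction of the operators of norm at most \<open>r < 1\<close>.
\<close>

lemma ex_pos_def_sqrt_near_1:
  fixes A :: "real^'n^'n"
  assumes sym: "transpose A = A" and r: "0 < r" "r < 1"
    and lo: "\<And>x. (1 - r) * (x \<bullet> x) \<le> x \<bullet> (A *v x)" and hi: "\<And>x. x \<bullet> (A *v x) \<le> x \<bullet> x"
  shows "\<exists>R. pos_def R \<and> R ** R = A"
proof -
  define T where "T = mat 1 - A"
  have Tx: "T *v x = x - A *v x" for x by (simp add: T_def matrix_vector_mult_diff_rdistrib)
  have symT: "transpose T = T" using sym by (simp add: T_def transpose_diff transpose_mat)
  have nT: "norm (T *v x) \<le> r * norm x" for x
  proof (rule symmetric_norm_bound[OF symT r(1)])
    show "0 \<le> y \<bullet> (T *v y)" for y using hi[of y] by (simp add: Tx inner_diff_right)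
    show "y \<bullet> (T *v y) \<le> r * (y \<bullet> y)" for y
      using lo[of y] unfolding Tx inner_diff_right by argo
  qed
  define t where "t = Blinfun ((*v) T)"
  have t: "blinfun_apply t = (*v) T"
    unfolding t_def by (rule bounded_linear_Blinfun_apply) (rule matrix_vector_mul_bounded_linear)
  have norm_t: "norm t \<le> r" by (rule norm_blinfun_bound) (use r nT in \<open>auto simp: t\<close>)
  \<comment> \<open>The self-adjoint operators of norm at most \<open>r\<close>.\<close>
  define C where "C = {f :: (real^'n) \<Rightarrow>\<^sub>L (real^'n). norm f \<le> r \<and> (\<forall>x y. blinfun_apply f x \<bullet> y = x \<bullet> blinfun_apply f y)}"
  define \<Phi> where "\<Phi> f = (1/2) *\<^sub>R (t + (f o\<^sub>L f))" for f :: "(real^'n) \<Rightarrow>\<^sub>L (real^'n)"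
  have "closed C"
  proof -
    have "C = cball 0 r \<inter> (\<Inter>x. \<Inter>y. {f :: (real^'n) \<Rightarrow>\<^sub>L (real^'n). blinfun_apply f x \<bullet> y = x \<bullet> blinfun_apply f y})" by (auto simp: C_def)
    moreover have "closed {f :: (real^'n) \<Rightarrow>\<^sub>L (real^'n). blinfun_apply f x \<bullet> y = x \<bullet> blinfun_apply f y}" for x y
      by (intro closed_Collect_eq continuous_intros)
    ultimately show ?thesis by (auto intro!: closed_Int closed_INT)
  qed
  then have "complete C" by (simp add: complete_eq_closed)
  moreover have "0 \<in> C" using r by (simp add: C_def)
  then have "C \<noteq> {}" by blast
  moreover have "\<Phi> ` C \<subseteq> C"
  proof
    fix g assume "g \<in> \<Phi> ` C"
    then obtain f where f: "f \<in> C" "g = \<Phi> f" by blast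
    have "norm (f o\<^sub>L f) \<le> r * r"
      using norm_blinfun_compose[of f f] f(1) mult_mono[of "norm f" r "norm f" r] r by (auto simp: C_def)
    also have "\<dots> \<le> r" using r by (simp add: mult_left_le_one_le)
    finally have "norm (t + (f o\<^sub>L f)) \<le> 2 * r" using norm_t norm_triangle_ineq[of t "f o\<^sub>L f"] by simp
    then have "norm g \<le> r" by (simp add: f \<Phi>_def)
    moreover have "blinfun_apply g x \<bullet> y = x \<bullet> blinfun_apply g y" for x y
      using f(1) symmetric_inner[OF symT, of x y]
      by (simp add: f(2) \<Phi>_def C_def t blinfun.add_left blinfun.scaleR_left inner_add_left inner_add_right)
    ultimately show "g \<in> C" by (simp add: C_def)
  qed
  moreover have "\<forall>f\<in>C. \<forall>g\<in>C. dist (\<Phi> f) (\<Phi> g) \<le> r * dist f g"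
  proof (intro ballI)
    fix f g assume fg: "f \<in> C" "g \<in> C"
    have "\<Phi> f - \<Phi> g = (1/2) *\<^sub>R ((f o\<^sub>L (f - g)) + ((f - g) o\<^sub>L g))"
      by (rule blinfun_eqI) (simp add: \<Phi>_def blinfun.diff_left blinfun.add_left blinfun.scaleR_left blinfun.diff_right scaleR_diff_right[symmetric])
    then have "norm (\<Phi> f - \<Phi> g) \<le> (1/2) * (norm f * norm (f - g) + norm (f - g) * norm g)"
      using norm_triangle_ineq[of "f o\<^sub>L (f - g)" "(f - g) o\<^sub>L g"]
        norm_blinfun_compose[of f "f - g"] norm_blinfun_compose[of "f - g" g] by simp
    also have "\<dots> \<le> (1/2) * (r * norm (f - g) + norm (f - g) * r)"
      using fg by (intro mult_left_mono add_mono mult_right_mono) (auto simp: C_def)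
    finally show "dist (\<Phi> f) (\<Phi> g) \<le> r * dist f g" by (simp add: dist_norm)
  qed
  ultimately obtain f where f: "f \<in> C" "\<Phi> f = f"
    using Banach_fix[of C r \<Phi>] r by auto
  define R where "R = mat 1 - matrix (blinfun_apply f)"
  have lin: "linear (blinfun_apply f)" by (rule bounded_linear.linear) (rule blinfun.bounded_linear_right)
  have Rx: "R *v x = x - blinfun_apply f x" for x
    using matrix_works[OF lin[folded linear_matrix_vector_mul_eq]] by (simp add: R_def matrix_vector_mult_diff_rdistrib)
  have "pos_def R"
    unfolding pos_def_def
  proof (intro conjI allI impI)
    have "(R *v x) \<bullet> y = x \<bullet> (R *v y)" for x y
      using f(1) by (simp add: Rx C_def inner_diff_left inner_diff_right)
    then have "(x v* R) \<bullet> y = (R *v x) \<bullet> y" for x y by (simp add: dot_lmul_matrix)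
    then have "x v* R = R *v x" for x by (intro vector_eq_rdot[THEN iffD1]) blast
    then have "transpose R *v x = R *v x" for x by simp
    then show "transpose R = R" by (simp add: matrix_eq)
    fix x :: "real^'n" assume x: "x \<noteq> 0"
    have "norm (blinfun_apply f x) \<le> r * norm x"
      using norm_blinfun[of f x] f(1) mult_right_mono[of "norm f" r "norm x"] by (simp add: C_def)
    then have "x \<bullet> blinfun_apply f x \<le> norm x * (r * norm x)"
      using norm_cauchy_schwarz[of x "blinfun_apply f x"] mult_left_mono[of "norm (blinfun_apply f x)" "r * norm x" "norm x"] by simp
    also have "\<dots> = r * (x \<bullet> x)" by (simp add: dot_square_norm power2_eq_square)
    also have "\<dots> < x \<bullet> x" using x r by simp
    finally show "0 < x \<bullet> (R *v x)" by (simp add: Rx inner_diff_right)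
  qed
  moreover have "R ** R = A"
    unfolding matrix_eq
  proof
    fix x
    have "blinfun_apply f x = (1/2) *\<^sub>R (x - A *v x + blinfun_apply f (blinfun_apply f x))"
      using arg_cong[OF f(2), of "\<lambda>g. blinfun_apply g x"]
      by (simp add: \<Phi>_def blinfun.scaleR_left blinfun.add_left t Tx)
    then have "2 *\<^sub>R blinfun_apply f x = 2 *\<^sub>R ((1/2) *\<^sub>R (x - A *v x + blinfun_apply f (blinfun_apply f x)))"
      by (rule arg_cong)
    also have "\<dots> = x - A *v x + blinfun_apply f (blinfun_apply f x)" by simp
    finally have "A *v x = x - 2 *\<^sub>R blinfun_apply f x + blinfun_apply f (blinfun_apply f x)"
      by (simp only:) (simp add: algebra_simps)
    moreover have "R ** R *v x = x - 2 *\<^sub>R blinfun_apply f x + blinfun_apply f (blinfun_apply f x)"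
      by (simp add: matrix_vector_mul_assoc[symmetric] Rx blinfun.diff_right scaleR_2)
    ultimately show "R ** R *v x = A *v x" by (simp only:)
  qed
  ultimately show ?thesis by blast
qed

lemma ex_pos_def_sqrt:
  fixes A :: "real^'n^'n"
  assumes A: "pos_def A"
  shows "\<exists>R. pos_def R \<and> R ** R = A"
proof -
  from pos_def_bounded_below[OF A] obtain m where m: "m > 0" "\<And>x. m * (x \<bullet> x) \<le> x \<bullet> (A *v x)" by blast
  \<comment> \<open>Rescaling by a bound on the spectrum brings \<open>A\<close> into the range \<open>(1 - r) I \<le> A \<le> I\<close> with \<open>0 < r < 1\<close>.\<close>
  define c where "c = onorm ((*v) A) + m + 1"
  have bl: "bounded_linear ((*v) A)" by (rule matrix_vector_mul_bounded_linear)
  have on: "0 \<le> onorm ((*v) A)" by (rule onorm_pos_le[OF bl])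
  have c: "c > 0" "m < c" "onorm ((*v) A) \<le> c" using m on by (auto simp: c_def)
  have hi: "x \<bullet> (A *v x) \<le> c * (x \<bullet> x)" for x
  proof -
    have "x \<bullet> (A *v x) \<le> norm x * norm (A *v x)" by (rule norm_cauchy_schwarz)
    also have "\<dots> \<le> norm x * (c * norm x)"
      using onorm[OF bl, of x] c mult_right_mono[OF c(3), of "norm x"] by (intro mult_left_mono) auto
    finally show ?thesis by (simp add: dot_square_norm power2_eq_square mult_ac)
  qed
  have "\<exists>R. pos_def R \<and> R ** R = (1/c) *\<^sub>R A"
  proof (rule ex_pos_def_sqrt_near_1[where r = "1 - m / c"])
    show "transpose ((1/c) *\<^sub>R A) = (1/c) *\<^sub>R A" using pos_def_symmetric[OF A] by (simp add: transpose_scalar)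
    show "0 < 1 - m / c" "1 - m / c < 1" using c m by (auto simp: field_simps)
    show "(1 - (1 - m / c)) * (x \<bullet> x) \<le> x \<bullet> ((1/c) *\<^sub>R A *v x)" for x
      using m(2)[of x] c by (simp add: scaleR_matrix_vector_assoc[symmetric] field_simps)
    show "x \<bullet> ((1/c) *\<^sub>R A *v x) \<le> x \<bullet> x" for x
      using hi[of x] c by (simp add: scaleR_matrix_vector_assoc[symmetric] field_simps)
  qed
  then obtain R where R: "pos_def R" "R ** R = (1/c) *\<^sub>R A" by blast
  have "(a *\<^sub>R R) ** (a *\<^sub>R R) = (a * a) *\<^sub>R (R ** R)" for a
    by (simp add: matrix_matrix_mult_def vec_eq_iff sum_distrib_left mult_ac)
  from this[of "sqrt c"] have "(sqrt c *\<^sub>R R) ** (sqrt c *\<^sub>R R) = A" using c by (simp add: R)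
  moreover have "pos_def (sqrt c *\<^sub>R R)" using R c by (intro pos_def_scaleR) auto
  ultimately show ?thesis by blast
qed

lemma pos_def_sqrt_unique:
  fixes R S :: "real^'n^'n"
  assumes R: "pos_def R" and S: "pos_def S" and eq: "R ** R = S ** S"
  shows "R = S"
proof -
  define D where "D = R - S"
  define P where "P = R + S"
  have P: "pos_def P" unfolding P_def using R S by (rule pos_def_add)
  have D: "transpose D = D" unfolding D_def using R S by (simp add: transpose_diff pos_def_symmetric)
  have ev: "D *v (P *v x) + P *v (D *v x) = 0" for x
  proof -
    have "R *v (R *v x) = S *v (S *v x)" using eq by (simp add: matrix_vector_mul_assoc)
    then show ?thesis
      by (simp add: D_def P_def matrix_vector_mult_add_rdistrib matrix_vector_mult_diff_rdistrib
          matrix_vector_mult_diff_distrib matrix_vector_right_distrib)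
  qed
  have "(\<Sum>i\<in>UNIV. (D *v axis i 1) \<bullet> (P *v (D *v axis i 1))) = 0" (is "?s = 0")
  proof -
    have tr: "trace M = (\<Sum>i\<in>UNIV. axis i 1 \<bullet> (M *v axis i 1))" for M :: "real^'n^'n"
      by (simp add: trace_def inner_axis' matrix_vector_mul_component inner_axis)
    have s1: "?s = trace (D ** P ** D)"
      unfolding tr by (intro sum.cong) (simp_all add: symmetric_inner[OF D] matrix_vector_mul_assoc[symmetric])
    \<comment> \<open>\<open>R\<^sup>2 - S\<^sup>2 = 0\<close> says that \<open>D\<close> and \<open>P\<close> anticommute, so the trace of \<open>D P D\<close> is its own negative.\<close>
    have "D ** P + P ** D = 0"
      unfolding matrix_eq using ev by (simp add: matrix_vector_mult_add_rdistrib matrix_vector_mul_assoc[symmetric])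
    then have "P ** D = - (D ** P)" by (simp add: eq_neg_iff_add_eq_0 add.commute)
    then have "D ** P ** D = D ** (- (D ** P))" by (simp add: matrix_mul_assoc[symmetric])
    also have "trace \<dots> = - trace (D ** (D ** P))"
      by (simp add: trace_def matrix_matrix_mult_def sum_negf)
    also have "trace (D ** (D ** P)) = trace (D ** P ** D)"
      by (rule trace_mul_sym)
    finally show ?thesis using s1 by simp
  qed
  moreover have nn: "0 \<le> v \<bullet> (P *v v)" for v
    using pos_def_inner[OF P, of v] by (cases "v = 0") auto
  ultimately have "(D *v axis i 1) \<bullet> (P *v (D *v axis i 1)) = 0" for i
    by (subst (asm) sum_nonneg_eq_0_iff) auto
  then have "D *v axis i 1 = 0" for i
    using pos_def_inner[OF P, of "D *v axis i 1"] by force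
  then have "D $ j $ i = 0" for i j
    by (metis matrix_vector_mul_component inner_axis inner_real_def mult.right_neutral zero_index)
  then show ?thesis by (simp add: D_def vec_eq_iff)
qed

lemma msqrt:
  fixes A :: "real^'n^'n"
  assumes "pos_def A"
  shows pos_def_msqrt: "pos_def (msqrt A)" and msqrt_square: "msqrt A ** msqrt A = A"
proof -
  have "\<exists>!R. pos_def R \<and> R ** R = A"
    using ex_pos_def_sqrt[OF assms] pos_def_sqrt_unique by blast
  from theI'[OF this] show "pos_def (msqrt A)" "msqrt A ** msqrt A = A"
    unfolding msqrt_def by auto
qed

text \<open>
  \<open>tr (A Z) = tr (A\<^sup>1\<^sup>/\<^sup>2 Z A\<^sup>1\<^sup>/\<^sup>2)\<close> is the trace of a positive definite matrix.
\<close>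

lemma pos_def_trace_pos:
  assumes A: "pos_def A" and Z: "pos_def Z"
  shows "trace (A ** Z) > 0"
proof -
  let ?R = "msqrt A"
  have R: "pos_def ?R" "?R ** ?R = A" using msqrt[OF A] by auto
  have "trace (A ** Z) = trace (?R ** (?R ** Z))" by (simp only: matrix_mul_assoc R(2))
  also have "\<dots> = trace (?R ** Z ** ?R)" by (rule trace_mul_sym)
  also have "\<dots> = trace (?R ** Z ** transpose ?R)" using pos_def_symmetric[OF R(1)] by simp
  also have "\<dots> > 0"
  proof -
    have "pos_def (?R ** Z ** transpose ?R)" using Z pos_def_det_nonzero[OF R(1)] by (rule pos_def_congruence)
    then show ?thesis unfolding trace_def by (intro sum_pos pos_def_diagonal_pos) auto
  qed
  finally show ?thesis .
qed

text \<open>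
  The matrices with entries bounded by \<open>k\<close> correspond to a box of finite measure.
\<close>

lemma sigma_finite_sym_lborel: "sigma_finite_measure (sym_lborel :: (real^'n^'n) measure)"
proof
  define A where "A k = {Z :: real^'n^'n. \<forall>i j. \<bar>Z$i$j\<bar> \<le> real k}" for k :: nat
  have meas[measurable]: "A k \<in> sets borel" for k unfolding A_def by measurable
  have fin: "emeasure sym_lborel (A k) \<noteq> \<infinity>" for k
  proof -
    have "emeasure sym_lborel (A k) = emeasure (PiL sym_indices) (sym_matrix -` A k \<inter> space (PiL sym_indices))"
      unfolding sym_lborel_def by (rule emeasure_distr) auto
    also have "sym_matrix -` A k \<inter> space (PiL sym_indices) = (\<Pi>\<^sub>E e\<in>(sym_indices :: 'n set set). {- real k..real k})"
      by (auto simp: A_def sym_matrix_def space_PiM PiE_iff sym_indices_def abs_le_iff) (metis minus_le_iff)+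
    also have "emeasure (PiL sym_indices) \<dots> = (\<Prod>e\<in>(sym_indices :: 'n set set). emeasure lborel {- real k..real k})"
      by (rule lebesgue_product.emeasure_PiM) auto
    also have "\<dots> \<noteq> \<infinity>" by (simp add: ennreal_power)
    finally show ?thesis .
  qed
  have "(\<Union>k. A k) = UNIV"
  proof (intro set_eqI iffI UNIV_I)
    fix Z :: "real^'n^'n"
    obtain k where "norm Z \<le> real k" using real_arch_simple by blast
    moreover have "\<bar>Z$i$j\<bar> \<le> norm Z" for i j
      using order_trans[OF component_le_norm_cart Finite_Cartesian_Product.norm_nth_le] by blast
    ultimately show "Z \<in> (\<Union>k. A k)" unfolding A_def using order_trans by blast
  qed
  then show "\<exists>A. countable A \<and> A \<subseteq> sets (sym_lborel :: (real^'n^'n) measure) \<and> \<Union> A = space sym_lborel \<and> (\<forall>a\<in>A. emeasure sym_lborel a \<noteq> \<infinity>)"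
    using fin by (intro exI[of _ "range A"]) auto
qed

theorem has_bochner_integral_mv_Gamma:
  assumes "Re s > (real CARD('n) - 1) / 2"
  shows "has_bochner_integral sym_lborel (\<lambda>Z :: real^'n^'n. indicator {Z. pos_def Z} Z *\<^sub>R
    (det_powr Z (s - (of_nat CARD('n) + 1) / 2) * exp (- of_real (trace Z)))) (mv_Gamma CARD('n) s)"
proof -
  have si: "sub_indices (UNIV :: 'n set) = sym_indices" by (simp add: sub_indices_def sym_indices_def)
  have sm: "sub_matrix (UNIV :: 'n set) z = sym_matrix z" for z by (simp add: sub_matrix_def sym_matrix_def)
  have "(\<Sum>i\<in>UNIV. z {i}) = trace (sym_matrix z :: real^'n^'n)" for z by (simp add: trace_def sym_matrix_def)
  then have gi: "gamma_integrand (UNIV :: 'n set) s z = indicator {Z. pos_def Z} (sym_matrix z :: real^'n^'n) *\<^sub>R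
    (det_powr (sym_matrix z :: real^'n^'n) (s - (of_nat CARD('n) + 1) / 2) * exp (- of_real (trace (sym_matrix z :: real^'n^'n))))" for z
    by (simp add: gamma_integrand_def sm indicator_def)
  have mt: "trace \<in> borel_measurable (borel :: (real^'n^'n) measure)" unfolding trace_def by measurable
  note [measurable] = mt
  show ?thesis
    unfolding sym_lborel_def
    by (rule has_bochner_integral_distr)
      (use has_bochner_integral_gamma_integrand[of "UNIV :: 'n set" s] assms in \<open>simp_all add: gi[symmetric] si del: of_real_sum, (measurable)?\<close>)
qed

section \<open>The Laplace transform of a power of the determinant\<close>

lemma measurable_matrix_mult [measurable (raw)]:
  fixes f :: "'a \<Rightarrow> real^'n^'m" and g :: "'a \<Rightarrow> real^'k^'n"
  assumes [measurable]: "f \<in> borel_measurable M" "g \<in> borel_measurable M"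
  shows "(\<lambda>x. f x ** g x) \<in> borel_measurable M"
proof (rule borel_measurable_matrixI)
  fix i j
  have [measurable]: "(\<lambda>x. f x $ i $ k) \<in> borel_measurable M" "(\<lambda>x. g x $ k $ j) \<in> borel_measurable M" for k
    using measurable_compose[OF _ borel_measurable_entry] assms by blast+
  show "(\<lambda>x. (f x ** g x) $ i $ j) \<in> borel_measurable M"
    unfolding matrix_matrix_mult_def by simp
qed

lemma measurable_trace [measurable]: "trace \<in> borel_measurable (borel :: (real^'n^'n) measure)"
  unfolding trace_def by measurable

lemma of_real_powr_exp: "x > 0 \<Longrightarrow> complex_of_real x powr s = exp (s * of_real (ln x))"
  by (simp add: powr_def Ln_of_real)

text \<open>
  The substitution \<open>Z = A\<^sup>-\<^sup>1\<^sup>/\<^sup>2 Y A\<^sup>-\<^sup>1\<^sup>/\<^sup>2\<close> reduces the Laplace transform to the gamma integral.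
\<close>

theorem has_bochner_integral_mv_Gamma_Laplace:
  fixes A :: "real^'n^'n"
  assumes A: "pos_def A" and s: "Re s > (real CARD('n) - 1) / 2"
  shows "has_bochner_integral sym_lborel (\<lambda>Z :: real^'n^'n. indicator {Z. pos_def Z} Z *\<^sub>R
    (det_powr Z (s - (of_nat CARD('n) + 1) / 2) * exp (- of_real (trace (A ** Z)))))
    (mv_Gamma CARD('n) s * det_powr A (- s))"
proof -
  let ?h = "(of_nat CARD('n) + 1) / 2 :: complex"
  define R where "R = msqrt A"
  have R: "pos_def R" "R ** R = A" using msqrt[OF A] by (auto simp: R_def)
  \<comment> \<open>\<open>L A L = I\<close>, so \<open>Z \<mapsto> L Z L\<close> turns the trace of \<open>A Z\<close> into the trace of \<open>Z\<close>.\<close>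
  define L where "L = matrix_inv R"
  have L: "pos_def L" unfolding L_def using R(1) by (rule pos_def_matrix_inv)
  have tL: "transpose L = L" using L by (rule pos_def_symmetric)
  have LR: "L ** R = mat 1" "R ** L = mat 1" unfolding L_def by (rule pos_def_inv[OF R(1)])+
  have LAL: "L ** A ** L = mat 1"
    unfolding R(2)[symmetric] by (simp add: matrix_mul_assoc LR)
  have a: "det L > 0" using L by (rule pos_def_det_pos)
  have dA: "det A > 0" using A by (rule pos_def_det_pos)
  have lnA: "ln (det A) = - 2 * ln (det L)"
  proof -
    have "det L * det A * det L = 1" using LAL by (metis det_mul det_I)
    then have "ln (det L * det A * det L) = 0" by simp
    then show ?thesis using a dA by (simp add: ln_mult)
  qed
  let ?f = "\<lambda>Z :: real^'n^'n. indicator {Z. pos_def Z} Z *\<^sub>R (det_powr Z (s - ?h) * exp (- of_real (trace (A ** Z))))"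
  let ?g = "\<lambda>Z :: real^'n^'n. indicator {Z. pos_def Z} Z *\<^sub>R (det_powr Z (s - ?h) * exp (- of_real (trace Z)))"
  have pt: "\<bar>det L\<bar> ^ (CARD('n) + 1) *\<^sub>R ?f (L ** Z ** transpose L) = ?g Z * det_powr A (- s)" for Z
  proof (cases "pos_def Z")
    case False
    then show ?thesis using a pos_def_congruence_iff[of L Z] by simp
  next
    case True
    then have dZ: "det Z > 0" by (rule pos_def_det_pos)
    have P: "pos_def (L ** Z ** transpose L)" using True a by (intro pos_def_congruence) auto
    have "trace (A ** (L ** Z ** L)) = trace (L ** Z ** L ** A)" by (rule trace_mul_sym)
    also have "\<dots> = trace (L ** (Z ** L ** A))" by (simp add: matrix_mul_assoc)
    also have "\<dots> = trace (Z ** L ** A ** L)" by (rule trace_mul_sym)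
    also have "\<dots> = trace (Z ** (L ** A ** L))" by (simp add: matrix_mul_assoc)
    finally have tr: "trace (A ** (L ** Z ** L)) = trace Z" by (simp add: LAL)
    have lnLZL: "ln (det (L ** Z ** L)) = 2 * ln (det L) + ln (det Z)"
      using a dZ by (simp add: det_mul ln_mult)
    have pow: "complex_of_real (\<bar>det L\<bar> ^ (CARD('n) + 1)) = exp (2 * ?h * of_real (ln (det L)))"
    proof -
      have "complex_of_real (\<bar>det L\<bar> ^ (CARD('n) + 1)) = exp (of_real (ln (det L))) ^ (CARD('n) + 1)"
        using a by (simp add: exp_of_real)
      also have "\<dots> = exp (of_nat (CARD('n) + 1) * of_real (ln (det L)))"
        by (rule exp_of_nat_mult[symmetric])
      also have "of_nat (CARD('n) + 1) = 2 * ?h" by simp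
      finally show ?thesis .
    qed
    have "0 < det (L ** Z ** L)" using a dZ by (simp add: det_mul)
    then have dp: "det_powr (L ** Z ** L) (s - ?h) = exp ((s - ?h) * of_real (2 * ln (det L) + ln (det Z)))"
      "det_powr Z (s - ?h) = exp ((s - ?h) * of_real (ln (det Z)))"
      "det_powr A (- s) = exp (- s * of_real (- 2 * ln (det L)))"
      using dZ dA by (simp_all only: det_powr_def of_real_powr_exp lnLZL lnA)
    \<comment> \<open>The Jacobian contributes \<open>det L\<close> to the power \<open>2 h\<close>, which cancels the shift of the exponent by \<open>h\<close>.\<close>
    have expo: "2 * h * of_real l + (s - h) * of_real (2 * l + m) = (s - h) * of_real m + - s * of_real (- 2 * l)"
      for h :: complex and l m
      by (simp add: algebra_simps)
    have "complex_of_real (\<bar>det L\<bar> ^ (CARD('n) + 1)) * det_powr (L ** Z ** L) (s - ?h) = det_powr Z (s - ?h) * det_powr A (- s)"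
      unfolding pow dp exp_add[symmetric] expo ..
    then show ?thesis
      using P True unfolding tL
      by (simp add: scaleR_conv_of_real tr mult_ac del: of_real_power power_Suc)
  qed
  have "has_bochner_integral sym_lborel (\<lambda>Z. ?g Z * det_powr A (- s)) (mv_Gamma CARD('n) s * det_powr A (- s))"
    using has_bochner_integral_mv_Gamma[OF s] by (rule has_bochner_integral_mult_left)
  then show ?thesis
    unfolding pt[symmetric]
  proof (subst has_bochner_integral_change_of_variables[where T="\<lambda>Z. L ** Z ** transpose L"
        and w="\<lambda>Z. \<bar>det L\<bar> ^ (CARD('n) + 1)" and M=sym_lborel])
    show "(\<integral>\<^sup>+Z. f Z \<partial>sym_lborel) = (\<integral>\<^sup>+Z. ennreal (\<bar>det L\<bar> ^ (CARD('n) + 1)) * f (L ** Z ** transpose L) \<partial>sym_lborel)"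
      if "f \<in> borel_measurable sym_lborel" for f :: "real^'n^'n \<Rightarrow> ennreal"
      using a that by (intro nn_integral_congruence) auto
  qed auto
qed

definition mv_Gamma_real :: "nat \<Rightarrow> real \<Rightarrow> real" where
  "mv_Gamma_real p s = pi powr (real p * (real p - 1) / 4) * (\<Prod>j<p. Gamma (s - real j / 2))"

lemma mv_Gamma_of_real: "mv_Gamma p (of_real s) = of_real (mv_Gamma_real p s)"
  unfolding mv_Gamma_def mv_Gamma_real_def of_real_mult of_real_prod Gamma_complex_of_real[symmetric]
  by simp

lemma mv_Gamma_real_pos:
  assumes "s > (real p - 1) / 2" shows "mv_Gamma_real p s > 0"
proof -
  have "Gamma (s - real j / 2) > 0" if "j < p" for j
  proof (rule Gamma_real_pos)
    have "real j \<le> real p - 1" using that by linarith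
    then show "0 < s - real j / 2" using assms by argo
  qed
  then show ?thesis unfolding mv_Gamma_real_def by (intro mult_pos_pos prod_pos) auto
qed

lemma mv_Gamma_nonzero:
  assumes "Re s > (real p - 1) / 2" shows "mv_Gamma p s \<noteq> 0"
proof -
  have "Gamma (s - of_nat j / 2) \<noteq> 0" if "j < p" for j
  proof -
    have "real j \<le> real p - 1" using that by linarith
    then have "Re (s - of_nat j / 2) > 0" using assms by simp
    have "s - of_nat j / 2 \<notin> \<int>\<^sub>\<le>\<^sub>0"
    proof
      assume "s - of_nat j / 2 \<in> \<int>\<^sub>\<le>\<^sub>0"
      then obtain n where n: "s - of_nat j / 2 = of_int n" "n \<le> 0" by (rule nonpos_Ints_cases)
      then show False using \<open>Re (s - of_nat j / 2) > 0\<close> unfolding n(1) by simp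
    qed
    then show ?thesis by (simp add: Gamma_eq_zero_iff)
  qed
  then show ?thesis unfolding mv_Gamma_def by (simp add: prod_zero_iff)
qed

lemma nn_integral_mv_Gamma_Laplace:
  fixes A :: "real^'n^'n"
  assumes A: "pos_def A" and s: "s > (real CARD('n) - 1) / 2"
  shows "(\<integral>\<^sup>+Z. ennreal (indicator {Z. pos_def Z} Z *
      (det Z powr (s - (real CARD('n) + 1) / 2) * exp (- trace (A ** Z)))) \<partial>sym_lborel) =
    ennreal (mv_Gamma_real CARD('n) s * det A powr (- s))"
proof -
  let ?f = "\<lambda>Z :: real^'n^'n. indicator {Z. pos_def Z} Z *
      (det Z powr (s - (real CARD('n) + 1) / 2) * exp (- trace (A ** Z)))"
  have "has_bochner_integral sym_lborel (\<lambda>Z :: real^'n^'n. indicator {Z. pos_def Z} Z *\<^sub>R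
    (det_powr Z (of_real s - (of_nat CARD('n) + 1) / 2) * exp (- of_real (trace (A ** Z)))))
    (mv_Gamma CARD('n) (of_real s) * det_powr A (- of_real s))"
    by (rule has_bochner_integral_mv_Gamma_Laplace[OF A]) (use s in simp)
  moreover have "indicator {Z. pos_def Z} Z *\<^sub>R
    (det_powr Z (of_real s - (of_nat CARD('n) + 1) / 2) * exp (- of_real (trace (A ** Z)))) = complex_of_real (?f Z)" for Z
  proof (cases "pos_def Z")
    case True
    then have "det Z > 0" by (rule pos_def_det_pos)
    then have "complex_of_real (det Z powr (s - (real CARD('n) + 1) / 2)) = det_powr Z (of_real s - (of_nat CARD('n) + 1) / 2)"
      using powr_of_real[of "det Z" "s - (real CARD('n) + 1) / 2"] by (simp add: det_powr_def)
    then show ?thesis using True by (simp add: exp_of_real[symmetric])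
  qed simp
  moreover have "mv_Gamma CARD('n) (of_real s) * det_powr A (- of_real s) = of_real (mv_Gamma_real CARD('n) s * det A powr (- s))"
    using pos_def_det_pos[OF A] powr_of_real[of "det A" "- s"] by (simp add: mv_Gamma_of_real det_powr_def)
  ultimately have "has_bochner_integral sym_lborel (\<lambda>Z. complex_of_real (?f Z)) (of_real (mv_Gamma_real CARD('n) s * det A powr (- s)))"
    by simp
  from has_bochner_integral_bounded_linear[OF bounded_linear_Re this]
  have "has_bochner_integral sym_lborel ?f (mv_Gamma_real CARD('n) s * det A powr (- s))"
    by (simp only: Re_complex_of_real)
  moreover have "?f Z \<ge> 0" for Z by (auto simp: indicator_def)
  ultimately show ?thesis
    by (subst nn_integral_eq_integral) (auto simp: has_bochner_integral_iff)
qed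

text \<open>
  Read off from the Laplace transform, whose integrand decreases in the matrix parameter.
\<close>

lemma det_powr_antimono:
  fixes P Q :: "real^'n^'n"
  assumes P: "pos_def P" and QP: "pos_def (Q - P)" and s: "s > (real CARD('n) - 1) / 2"
  shows "det Q powr (- s) \<le> det P powr (- s)"
proof -
  have Q: "pos_def Q" using pos_def_add[OF P QP] by simp
  note g = mv_Gamma_real_pos[OF s]
  have "ennreal (mv_Gamma_real CARD('n) s * det Q powr (- s)) \<le> ennreal (mv_Gamma_real CARD('n) s * det P powr (- s))"
    unfolding nn_integral_mv_Gamma_Laplace[OF P s, symmetric] nn_integral_mv_Gamma_Laplace[OF Q s, symmetric]
  proof (intro nn_integral_mono ennreal_leI)
    fix Z :: "real^'n^'n"
    show "indicator {Z. pos_def Z} Z * (det Z powr (s - (real CARD('n) + 1) / 2) * exp (- trace (Q ** Z)))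
      \<le> indicator {Z. pos_def Z} Z * (det Z powr (s - (real CARD('n) + 1) / 2) * exp (- trace (P ** Z)))"
    proof (cases "pos_def Z")
      case True
      have "Q ** Z = P ** Z + (Q - P) ** Z"
        by (simp add: matrix_matrix_mult_def vec_eq_iff sum.distrib[symmetric] algebra_simps)
      then have "trace (Q ** Z) = trace (P ** Z) + trace ((Q - P) ** Z)" by (simp add: trace_add)
      with pos_def_trace_pos[OF QP True] show ?thesis using True by (simp add: mult_left_mono)
    qed simp
  qed
  then show ?thesis using g by (simp add: ennreal_le_iff)
qed

text \<open>
  Tonelli for a double gamma integral: \<open>|I + Y|\<close> to the power \<open>- c\<close> is a Laplace transform, and after exchanging the
  integrals both are gamma integrals.
\<close>

lemma nn_integral_mv_beta_finite:
  assumes b: "b > (real CARD('n) - 1) / 2" and cb: "c - b > (real CARD('n) - 1) / 2"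
  shows "(\<integral>\<^sup>+Y. ennreal (indicator {Y. pos_def Y} Y *
      (det Y powr (b - (real CARD('n) + 1) / 2) * det (mat 1 + Y) powr (- c))) \<partial>(sym_lborel :: (real^'n^'n) measure)) < \<infinity>"
proof -
  interpret sigma_finite_measure "sym_lborel :: (real^'n^'n) measure" by (rule sigma_finite_sym_lborel)
  interpret P: pair_sigma_finite "sym_lborel :: (real^'n^'n) measure" "sym_lborel :: (real^'n^'n) measure" ..
  let ?h = "(real CARD('n) + 1) / 2"
  let ?I = "\<lambda>Z :: real^'n^'n. indicator {Z. pos_def Z} Z :: real"
  have "CARD('n) \<ge> 1" by (simp add: Suc_leI)
  then have c: "c > (real CARD('n) - 1) / 2" using b cb by (smt (verit) divide_nonneg_pos of_nat_1 of_nat_mono)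
  \<comment> \<open>Integrated over \<open>Z\<close> first, \<open>K\<close> gives the beta integrand; over \<open>Y\<close> first, a gamma integrand with
    parameter \<open>c - b\<close>.\<close>
  define K where "K Y Z = ?I Y * ?I Z * (det Y powr (b - ?h) * det Z powr (c - ?h) * exp (- trace ((mat 1 + Y) ** Z)))"
    for Y Z :: "real^'n^'n"
  have [measurable]: "(\<lambda>(Y, Z). ennreal (K Y Z)) \<in> borel_measurable (sym_lborel \<Otimes>\<^sub>M sym_lborel)"
    unfolding K_def by measurable
  have "(\<integral>\<^sup>+Y. \<integral>\<^sup>+Z. ennreal (K Y Z) \<partial>sym_lborel \<partial>sym_lborel) = (\<integral>\<^sup>+Y. ennreal (mv_Gamma_real CARD('n) c) * ennreal (?I Y *
      (det Y powr (b - ?h) * det (mat 1 + Y) powr (- c))) \<partial>sym_lborel)"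
  proof (rule nn_integral_cong)
    fix Y :: "real^'n^'n"
    show "(\<integral>\<^sup>+Z. ennreal (K Y Z) \<partial>sym_lborel) = ennreal (mv_Gamma_real CARD('n) c) * ennreal (?I Y *
      (det Y powr (b - ?h) * det (mat 1 + Y) powr (- c)))"
    proof (cases "pos_def Y")
      case True
      then have PY: "pos_def (mat 1 + Y)" using pos_def_mat_1 by (intro pos_def_add)
      have "(\<integral>\<^sup>+Z. ennreal (K Y Z) \<partial>sym_lborel) = (\<integral>\<^sup>+Z. ennreal (det Y powr (b - ?h)) *
         ennreal (?I Z * (det Z powr (c - ?h) * exp (- trace ((mat 1 + Y) ** Z)))) \<partial>sym_lborel)"
        using True by (intro nn_integral_cong) (simp add: K_def ennreal_mult'[symmetric] mult_ac)
      also have "\<dots> = ennreal (det Y powr (b - ?h)) * ennreal (mv_Gamma_real CARD('n) c * det (mat 1 + Y) powr (- c))"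
        by (subst nn_integral_cmult) (simp_all add: nn_integral_mv_Gamma_Laplace[OF PY c])
      finally show ?thesis using True mv_Gamma_real_pos[OF c]
        by (simp add: ennreal_mult'[symmetric] mult_ac)
    qed (simp add: K_def)
  qed
  also have "\<dots> = ennreal (mv_Gamma_real CARD('n) c) * (\<integral>\<^sup>+Y. ennreal (?I Y *
      (det Y powr (b - ?h) * det (mat 1 + Y) powr (- c))) \<partial>sym_lborel)"
    by (rule nn_integral_cmult) measurable
  finally have left: "(\<integral>\<^sup>+Y. \<integral>\<^sup>+Z. ennreal (K Y Z) \<partial>sym_lborel \<partial>sym_lborel) = \<dots>" .
  have "(\<integral>\<^sup>+Y. \<integral>\<^sup>+Z. ennreal (K Y Z) \<partial>sym_lborel \<partial>sym_lborel) = (\<integral>\<^sup>+Z. \<integral>\<^sup>+Y. ennreal (K Y Z) \<partial>sym_lborel \<partial>sym_lborel)"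
    by (rule P.Fubini') measurable
  also have "\<dots> = (\<integral>\<^sup>+Z. ennreal (mv_Gamma_real CARD('n) b) * ennreal (?I Z *
      (det Z powr (c - b - ?h) * exp (- trace (mat 1 ** Z)))) \<partial>sym_lborel)"
  proof (rule nn_integral_cong)
    fix Z :: "real^'n^'n"
    show "(\<integral>\<^sup>+Y. ennreal (K Y Z) \<partial>sym_lborel) = ennreal (mv_Gamma_real CARD('n) b) * ennreal (?I Z *
      (det Z powr (c - b - ?h) * exp (- trace (mat 1 ** Z))))"
    proof (cases "pos_def Z")
      case True
      have tr: "trace ((mat 1 + Y) ** Z) = trace (mat 1 ** Z) + trace (Z ** Y)" for Y
      proof -
        have "(mat 1 + Y) ** Z = mat 1 ** Z + Y ** Z"
          by (simp add: matrix_matrix_mult_def vec_eq_iff sum.distrib[symmetric] algebra_simps)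
        then show ?thesis by (simp add: trace_add trace_mul_sym[of Z Y])
      qed
      have ex: "exp (- trace ((mat 1 + Y) ** Z)) = exp (- trace (mat 1 ** Z)) * exp (- trace (Z ** Y))" for Y
        unfolding tr exp_add[symmetric] by simp
      have "(\<integral>\<^sup>+Y. ennreal (K Y Z) \<partial>sym_lborel) = (\<integral>\<^sup>+Y. ennreal (det Z powr (c - ?h) * exp (- trace (mat 1 ** Z))) *
         ennreal (?I Y * (det Y powr (b - ?h) * exp (- trace (Z ** Y)))) \<partial>sym_lborel)"
        using True unfolding K_def ex
        by (intro nn_integral_cong) (simp add: ennreal_mult'[symmetric] mult_ac)
      also have "\<dots> = ennreal (det Z powr (c - ?h) * exp (- trace (mat 1 ** Z))) * ennreal (mv_Gamma_real CARD('n) b * det Z powr (- b))"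
        by (subst nn_integral_cmult) (simp_all add: nn_integral_mv_Gamma_Laplace[OF True b])
      also have "\<dots> = ennreal (mv_Gamma_real CARD('n) b * (det Z powr (c - ?h) * det Z powr (- b)) * exp (- trace (mat 1 ** Z)))"
        by (subst ennreal_mult'[symmetric]) (simp_all add: mult_ac)
      also have "det Z powr (c - ?h) * det Z powr (- b) = det Z powr (c - b - ?h)"
        by (simp add: powr_add[symmetric] algebra_simps)
      finally show ?thesis using True mv_Gamma_real_pos[OF b]
        by (simp add: ennreal_mult'[symmetric] mult_ac)
    qed (simp add: K_def)
  qed
  also have "\<dots> = ennreal (mv_Gamma_real CARD('n) b) * ennreal (mv_Gamma_real CARD('n) (c - b) * det (mat 1 :: real^'n^'n) powr (- (c - b)))"
    by (subst nn_integral_cmult) (measurable, simp only: nn_integral_mv_Gamma_Laplace[OF pos_def_mat_1 cb])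
  also have "\<dots> < \<infinity>" by (simp add: ennreal_mult_less_top)
  finally have "ennreal (mv_Gamma_real CARD('n) c) * (\<integral>\<^sup>+Y. ennreal (?I Y *
      (det Y powr (b - ?h) * det (mat 1 + Y) powr (- c))) \<partial>sym_lborel) < \<infinity>"
    unfolding left .
  then show ?thesis using mv_Gamma_real_pos[OF c] by (auto simp: ennreal_mult_less_top)
qed

lemma has_bochner_integral_reflect:
  fixes f :: "real^'n^'n \<Rightarrow> complex"
  assumes D: "transpose D = D" and f: "f \<in> borel_measurable borel"
  shows "has_bochner_integral sym_lborel f x \<longleftrightarrow> has_bochner_integral sym_lborel (\<lambda>Z. f (D - Z)) x"
proof (subst has_bochner_integral_change_of_variables[where T="\<lambda>Z. D - Z" and w="\<lambda>_. 1" and M=sym_lborel])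
  show "(\<integral>\<^sup>+Z. g Z \<partial>sym_lborel) = (\<integral>\<^sup>+Z. ennreal 1 * g (D - Z) \<partial>sym_lborel)"
    if "g \<in> borel_measurable sym_lborel" for g :: "real^'n^'n \<Rightarrow> ennreal"
    using nn_integral_sym_reflect[OF D, of g] that by simp
qed (use f in auto)

lemma has_bochner_integral_pos_def_inverse:
  fixes f :: "real^'n^'n \<Rightarrow> complex"
  assumes f[measurable]: "f \<in> borel_measurable borel"
  shows "has_bochner_integral sym_lborel (\<lambda>Z. indicator {Z. pos_def Z} Z *\<^sub>R f Z) x \<longleftrightarrow>
    has_bochner_integral sym_lborel (\<lambda>Z. (indicator {Z. pos_def Z} Z * (1 / det Z) ^ (CARD('n) + 1)) *\<^sub>R f (matrix_inv Z)) x"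
proof -
  let ?I = "\<lambda>Z :: real^'n^'n. indicator {Z. pos_def Z} Z :: real"
  let ?T = "\<lambda>Z :: real^'n^'n. if pos_def Z then matrix_inv Z else mat 1"
  let ?w = "\<lambda>Z :: real^'n^'n. ?I Z * (1 / det Z) ^ (CARD('n) + 1)"
  let ?N = "density sym_lborel (\<lambda>Z. ennreal (?I Z))"
  note [measurable] = measurable_pos_def_inverse
  have "has_bochner_integral sym_lborel (\<lambda>Z. ?I Z *\<^sub>R f Z) x \<longleftrightarrow> has_bochner_integral ?N f x"
    by (simp add: has_bochner_integral_iff integrable_density integral_density)
  also have "\<dots> \<longleftrightarrow> has_bochner_integral sym_lborel (\<lambda>Z. ?w Z *\<^sub>R f (?T Z)) x"
  proof (rule has_bochner_integral_change_of_variables)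
    show "0 \<le> ?w Z" for Z
      using pos_def_det_pos[of Z] by (cases "pos_def Z") auto
    fix g :: "real^'n^'n \<Rightarrow> ennreal" assume "g \<in> borel_measurable ?N"
    then have g[measurable]: "g \<in> borel_measurable borel" by simp
    have "(\<integral>\<^sup>+Z. g Z \<partial>?N) = (\<integral>\<^sup>+Z. indicator {Z. pos_def Z} Z * g Z \<partial>sym_lborel)"
      by (subst nn_integral_density) (auto simp: ennreal_indicator)
    also have "\<dots> = (\<integral>\<^sup>+Z. indicator {Z. pos_def Z} Z * (ennreal ((1 / det Z) ^ (CARD('n) + 1)) * g (matrix_inv Z)) \<partial>sym_lborel)"
      by (rule nn_integral_pos_def_inverse) measurable
    also have "\<dots> = (\<integral>\<^sup>+Z. ennreal (?w Z) * g (?T Z) \<partial>sym_lborel)"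
      by (intro nn_integral_cong) (auto simp: indicator_def)
    finally show "(\<integral>\<^sup>+Z. g Z \<partial>?N) = (\<integral>\<^sup>+Z. ennreal (?w Z) * g (?T Z) \<partial>sym_lborel)" .
  next
    show "?w \<in> borel_measurable sym_lborel" by measurable
    show "?T \<in> sym_lborel \<rightarrow>\<^sub>M ?N" using measurable_pos_def_inverse
      by (simp add: measurable_cong_sets[OF sets_sym_lborel sets_sym_lborel])
    show "f \<in> borel_measurable ?N" using f by simp
  qed
  also have "(\<lambda>Z. ?w Z *\<^sub>R f (?T Z)) = (\<lambda>Z. ?w Z *\<^sub>R f (matrix_inv Z))"
    by (auto simp: fun_eq_iff)
  finally show ?thesis .
qed

section \<open>The Laplace transform of the Whittaker function\<close>

lemma pos_def_sandwich:
  assumes L: "pos_def L" and A: "pos_def A"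
  shows "pos_def (L ** A ** L)"
  using pos_def_congruence[OF A pos_def_det_nonzero[OF L]] pos_def_symmetric[OF L] by simp

lemma mult_add_distrib_both:
  fixes A B L :: "real^'n^'n"
  shows "L ** (A + B) = L ** A + L ** B" "(A + B) ** L = A ** L + B ** L"
    "L ** (A - B) = L ** A - L ** B" "(A - B) ** L = A ** L - B ** L"
    "L ** (r *\<^sub>R A) = r *\<^sub>R (L ** A)" "(r *\<^sub>R A) ** L = r *\<^sub>R (A ** L)"
  by (simp_all add: matrix_matrix_mult_def vec_eq_iff sum.distrib[symmetric] sum_subtractf[symmetric]
      sum_distrib_left algebra_simps)

lemma norm_det_powr: "det Z > 0 \<Longrightarrow> norm (det_powr Z s) = det Z powr Re s"
  unfolding det_powr_def by (rule norm_of_real_powr)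

lemma det_powr_mult:
  assumes "det X > 0" "det Y > 0" "det Z = det X * det Y"
  shows "det_powr Z s = det_powr X s * det_powr Y s"
  unfolding det_powr_def assms(3) of_real_mult using assms(1,2) by (intro powr_times_real) auto

text \<open>
  The integral that remains after integrating out \<open>Z\<close> converges absolutely because it is dominated by a
  matrix beta integral.
\<close>

lemma Whittaker_integrand_bound:
  fixes E Bh :: "real^'n^'n"
  assumes Bh: "pos_def Bh" and E: "pos_def (E - (1/2) *\<^sub>R (Bh ** Bh))"
    and b: "Re b > (real CARD('n) - 1) / 2" and cb: "Re (c - b) > (real CARD('n) - 1) / 2"
    and \<delta>: "Re \<delta> > (real CARD('n) - 1) / 2"
  shows "(\<integral>\<^sup>+Y. ennreal (indicator {Y. pos_def Y} Y *
      (det Y powr (Re b - (real CARD('n) + 1) / 2) * det (mat 1 + Y) powr Re (\<delta> - c) *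
       det (E + Bh ** Y ** Bh) powr (- Re \<delta>))) \<partial>sym_lborel) < \<infinity>"
proof -
  let ?h = "(real CARD('n) + 1) / 2"
  let ?k = "det ((1/2) *\<^sub>R (Bh ** Bh))"
  have PB: "pos_def ((1/2) *\<^sub>R (Bh ** Bh))"
    using pos_def_scaleR[OF pos_def_sandwich[OF Bh pos_def_mat_1], of "1/2"] by simp
  then have k: "?k > 0" by (rule pos_def_det_pos)
  have "(\<integral>\<^sup>+Y. ennreal (indicator {Y. pos_def Y} Y *
      (det Y powr (Re b - ?h) * det (mat 1 + Y) powr Re (\<delta> - c) *
       det (E + Bh ** Y ** Bh) powr (- Re \<delta>))) \<partial>sym_lborel) \<le> (\<integral>\<^sup>+Y. ennreal (?k powr (- Re \<delta>)) *
      ennreal (indicator {Y. pos_def Y} Y * (det Y powr (Re b - ?h) * det (mat 1 + Y) powr (- Re c))) \<partial>(sym_lborel :: (real^'n^'n) measure))"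
  proof (rule nn_integral_mono)
    fix Y :: "real^'n^'n"
    show "ennreal (indicator {Y. pos_def Y} Y *
      (det Y powr (Re b - ?h) * det (mat 1 + Y) powr Re (\<delta> - c) *
       det (E + Bh ** Y ** Bh) powr (- Re \<delta>))) \<le> ennreal (?k powr (- Re \<delta>)) *
      ennreal (indicator {Y. pos_def Y} Y * (det Y powr (Re b - ?h) * det (mat 1 + Y) powr (- Re c)))"
    proof (cases "pos_def Y")
      case True
      \<comment> \<open>\<open>E + Bh Y Bh\<close> dominates half of \<open>Bh (I + Y) Bh\<close>, whose determinant is a multiple of \<open>|I + Y|\<close>.\<close>
      let ?P = "(1/2) *\<^sub>R (Bh ** (mat 1 + Y) ** Bh)"
      have PY: "pos_def (mat 1 + Y)" using True pos_def_mat_1 by (intro pos_def_add)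
      have P: "pos_def ?P" using pos_def_scaleR[OF pos_def_sandwich[OF Bh PY], of "1/2"] by simp
      have "E + Bh ** Y ** Bh - ?P = (E - (1/2) *\<^sub>R (Bh ** Bh)) + (1/2) *\<^sub>R (Bh ** Y ** Bh)"
        by (simp add: mult_add_distrib_both scaleR_add_right vec_eq_iff)
      also have "pos_def \<dots>"
        using E pos_def_scaleR[OF pos_def_sandwich[OF Bh True], of "1/2"] by (intro pos_def_add) simp_all
      finally have le0: "det (E + Bh ** Y ** Bh) powr (- Re \<delta>) \<le> det ?P powr (- Re \<delta>)"
        by (rule det_powr_antimono[OF P _ \<delta>])
      have "?P = ((1/2) *\<^sub>R Bh) ** (mat 1 + Y) ** Bh" by (simp add: mult_add_distrib_both scaleR_add_right)
      then have "det ?P = det ((1/2) *\<^sub>R Bh) * det (mat 1 + Y) * det Bh" by (simp add: det_mul)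
      moreover have "?k = det ((1/2) *\<^sub>R Bh) * det Bh"
        using det_mul[of "(1/2) *\<^sub>R Bh" Bh] by (simp add: mult_add_distrib_both)
      ultimately have "det ?P = ?k * det (mat 1 + Y)" by simp
      then have "det ?P powr (- Re \<delta>) = ?k powr (- Re \<delta>) * det (mat 1 + Y) powr (- Re \<delta>)"
        using k pos_def_det_pos[OF PY] by (simp add: powr_mult)
      with le0 have le: "det (E + Bh ** Y ** Bh) powr (- Re \<delta>) \<le> ?k powr (- Re \<delta>) * det (mat 1 + Y) powr (- Re \<delta>)" by simp
      have "det (mat 1 + Y) powr (- Re c) = det (mat 1 + Y) powr Re (\<delta> - c) * det (mat 1 + Y) powr (- Re \<delta>)"
        by (simp add: powr_add[symmetric])
      then have "det Y powr (Re b - ?h) * det (mat 1 + Y) powr Re (\<delta> - c) * det (E + Bh ** Y ** Bh) powr (- Re \<delta>)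
        \<le> ?k powr (- Re \<delta>) * (det Y powr (Re b - ?h) * det (mat 1 + Y) powr (- Re c))"
        using mult_left_mono[OF le, of "det Y powr (Re b - ?h) * det (mat 1 + Y) powr Re (\<delta> - c)"]
        by (simp add: mult_ac)
      then show ?thesis using True by (simp add: ennreal_mult'[symmetric] ennreal_leI)
    qed simp
  qed
  also have "\<dots> = ennreal (?k powr (- Re \<delta>)) * (\<integral>\<^sup>+Y. 
      ennreal (indicator {Y. pos_def Y} Y * (det Y powr (Re b - ?h) * det (mat 1 + Y) powr (- Re c))) \<partial>(sym_lborel :: (real^'n^'n) measure))"
    by (rule nn_integral_cmult) measurable
  also have "\<dots> < \<infinity>"
    using nn_integral_mv_beta_finite[OF b, of "Re c"] cb by (simp add: ennreal_mult_less_top)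
  finally show ?thesis .
qed

text \<open>
  Up to a constant, \<open>K\<close> is the integrand of the Laplace transform of the Whittaker function once the
  latter is replaced by its defining integral. It is absolutely integrable over pairs, so Fubini allows \<open>Z\<close> to be integrated first.
\<close>

proposition iterated_Whittaker_integral:
  fixes E Bh :: "real^'n^'n"
  assumes Bh: "pos_def Bh" and E: "pos_def (E - (1/2) *\<^sub>R (Bh ** Bh))"
    and b: "Re b > (real CARD('n) - 1) / 2" and cb: "Re (c - b) > (real CARD('n) - 1) / 2"
    and \<delta>: "Re \<delta> > (real CARD('n) - 1) / 2"
  defines "h \<equiv> (of_nat CARD('n) + 1) / 2"
  defines "K \<equiv> \<lambda>Y Z. (indicator {Y. pos_def Y} Y * indicator {Z. pos_def Z} Z) *\<^sub>R
     (det_powr Y (b - h) * det_powr (mat 1 + Y) (\<delta> - c) *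
     (det_powr Z (\<delta> - h) * exp (- of_real (trace ((E + Bh ** Y ** Bh) ** Z)))))"
  defines "G \<equiv> \<lambda>Y. indicator {Y. pos_def Y} Y *\<^sub>R
     (det_powr Y (b - h) * det_powr (mat 1 + Y) (\<delta> - c) * det_powr (E + Bh ** Y ** Bh) (- \<delta>))"
  shows "integrable sym_lborel (\<lambda>Z. LINT Y|sym_lborel. K Y Z)"
    and "(LINT Z|sym_lborel. LINT Y|sym_lborel. K Y Z) = mv_Gamma CARD('n) \<delta> * (LINT Y|sym_lborel. G Y)"
proof -
  interpret sigma_finite_measure "sym_lborel :: (real^'n^'n) measure" by (rule sigma_finite_sym_lborel)
  interpret P: pair_sigma_finite "sym_lborel :: (real^'n^'n) measure" "sym_lborel :: (real^'n^'n) measure" ..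
  have Re_h: "Re h = (real CARD('n) + 1) / 2" by (simp add: h_def)
  have PE: "pos_def (E + Bh ** Y ** Bh)" if "pos_def Y" for Y
  proof -
    have "E + Bh ** Y ** Bh = (E - (1/2) *\<^sub>R (Bh ** Bh)) + (1/2) *\<^sub>R (Bh ** Bh) + Bh ** Y ** Bh" by simp
    also have "pos_def \<dots>"
      using E pos_def_scaleR[OF pos_def_sandwich[OF Bh pos_def_mat_1], of "1/2"] pos_def_sandwich[OF Bh that]
      by (intro pos_def_add) simp_all
    finally show ?thesis .
  qed
  have mK[measurable]: "(\<lambda>(Y, Z). K Y Z) \<in> borel_measurable (sym_lborel \<Otimes>\<^sub>M sym_lborel)"
    unfolding K_def by measurable
  \<comment> \<open>For fixed \<open>Y\<close> the integral over \<open>Z\<close> is a Laplace transform at \<open>E + Bh Y Bh\<close>.\<close>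
  have KZ: "has_bochner_integral sym_lborel (\<lambda>Z. K Y Z) (mv_Gamma CARD('n) \<delta> * G Y)" for Y
  proof (cases "pos_def Y")
    case True
    have "has_bochner_integral sym_lborel (\<lambda>Z. (det_powr Y (b - h) * det_powr (mat 1 + Y) (\<delta> - c)) *
       (indicator {Z. pos_def Z} Z *\<^sub>R (det_powr Z (\<delta> - h) * exp (- of_real (trace ((E + Bh ** Y ** Bh) ** Z))))))
       ((det_powr Y (b - h) * det_powr (mat 1 + Y) (\<delta> - c)) * (mv_Gamma CARD('n) \<delta> * det_powr (E + Bh ** Y ** Bh) (- \<delta>)))"
      unfolding h_def by (intro has_bochner_integral_mult_right has_bochner_integral_mv_Gamma_Laplace PE True \<delta>)
    then show ?thesis using True by (simp add: K_def G_def mult_ac)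
  next
    case False
    then show ?thesis by (simp add: K_def G_def has_bochner_integral_iff)
  qed
  have norm_K: "norm (K Y Z) = indicator {Y. pos_def Y} Y * (det Y powr (Re b - Re h) * det (mat 1 + Y) powr Re (\<delta> - c)) *
     (indicator {Z. pos_def Z} Z * (det Z powr (Re \<delta> - Re h) * exp (- trace ((E + Bh ** Y ** Bh) ** Z))))" for Y Z
  proof (cases "pos_def Y \<and> pos_def Z")
    case True
    then have "det Y > 0" "det Z > 0" "det (mat 1 + Y) > 0"
      by (auto intro!: pos_def_det_pos pos_def_add pos_def_mat_1)
    then show ?thesis using True by (simp add: K_def norm_mult norm_det_powr)
  qed (auto simp: K_def)
  have int: "integrable (sym_lborel \<Otimes>\<^sub>M sym_lborel) (\<lambda>(Y, Z). K Y Z)"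
  proof (rule integrableI_bounded)
    have "(\<integral>\<^sup>+p. ennreal (norm (case p of (Y, Z) \<Rightarrow> K Y Z)) \<partial>(sym_lborel \<Otimes>\<^sub>M sym_lborel)) =
      (\<integral>\<^sup>+Y. \<integral>\<^sup>+Z. ennreal (norm (K Y Z)) \<partial>sym_lborel \<partial>sym_lborel)"
      by (subst nn_integral_fst[symmetric]) auto
    also have "\<dots> = (\<integral>\<^sup>+Y. ennreal (mv_Gamma_real CARD('n) (Re \<delta>)) * ennreal (indicator {Y. pos_def Y} Y *
      (det Y powr (Re b - Re h) * det (mat 1 + Y) powr Re (\<delta> - c) *
       det (E + Bh ** Y ** Bh) powr (- Re \<delta>))) \<partial>sym_lborel)"
    proof (rule nn_integral_cong)
      fix Y :: "real^'n^'n"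
      show "(\<integral>\<^sup>+Z. ennreal (norm (K Y Z)) \<partial>sym_lborel) = ennreal (mv_Gamma_real CARD('n) (Re \<delta>)) * ennreal (indicator {Y. pos_def Y} Y *
      (det Y powr (Re b - Re h) * det (mat 1 + Y) powr Re (\<delta> - c) *
       det (E + Bh ** Y ** Bh) powr (- Re \<delta>)))"
      proof (cases "pos_def Y")
        case True
        have "(\<integral>\<^sup>+Z. ennreal (norm (K Y Z)) \<partial>sym_lborel) = (\<integral>\<^sup>+Z. ennreal (det Y powr (Re b - Re h) * det (mat 1 + Y) powr Re (\<delta> - c)) *
          ennreal (indicator {Z. pos_def Z} Z * (det Z powr (Re \<delta> - Re h) * exp (- trace ((E + Bh ** Y ** Bh) ** Z)))) \<partial>sym_lborel)"
          unfolding norm_K using True by (intro nn_integral_cong) (simp add: ennreal_mult')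
        also have "\<dots> = ennreal (det Y powr (Re b - Re h) * det (mat 1 + Y) powr Re (\<delta> - c)) *
          ennreal (mv_Gamma_real CARD('n) (Re \<delta>) * det (E + Bh ** Y ** Bh) powr (- Re \<delta>))"
          by (subst nn_integral_cmult) (simp_all add: nn_integral_mv_Gamma_Laplace[OF PE[OF True] \<delta>] Re_h)
        finally show ?thesis using True mv_Gamma_real_pos[OF \<delta>]
          by (simp add: ennreal_mult'[symmetric] mult_ac)
      qed (simp add: norm_K)
    qed
    also have "\<dots> = ennreal (mv_Gamma_real CARD('n) (Re \<delta>)) * (\<integral>\<^sup>+Y. ennreal (indicator {Y. pos_def Y} Y *
      (det Y powr (Re b - Re h) * det (mat 1 + Y) powr Re (\<delta> - c) *
       det (E + Bh ** Y ** Bh) powr (- Re \<delta>))) \<partial>sym_lborel)"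
      by (rule nn_integral_cmult) measurable
    also have "\<dots> < \<infinity>"
      using Whittaker_integrand_bound[OF Bh E b cb \<delta>] by (simp add: ennreal_mult_less_top Re_h)
    finally show "(\<integral>\<^sup>+p. ennreal (norm (case p of (Y, Z) \<Rightarrow> K Y Z)) \<partial>(sym_lborel \<Otimes>\<^sub>M sym_lborel)) < \<infinity>" .
  qed (rule mK)
  show "integrable sym_lborel (\<lambda>Z. LINT Y|sym_lborel. K Y Z)"
    using P.integrable_snd[OF int] by simp
  have G: "(LINT Z|sym_lborel. K Y Z) = mv_Gamma CARD('n) \<delta> * G Y" for Y
    using KZ by (simp add: has_bochner_integral_iff)
  have "(LINT Z|sym_lborel. LINT Y|sym_lborel. K Y Z) = (LINT Y|sym_lborel. LINT Z|sym_lborel. K Y Z)"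
    using P.Fubini_integral[OF int] by simp
  then show "(LINT Z|sym_lborel. LINT Y|sym_lborel. K Y Z) = mv_Gamma CARD('n) \<delta> * (LINT Y|sym_lborel. G Y)"
    by (simp add: G)
qed

text \<open>
  The exponential and the determinant power in front of the integral defining the Whittaker function at
  \<open>B\<^sup>1\<^sup>/\<^sup>2 Z B\<^sup>1\<^sup>/\<^sup>2\<close> turn the weight into the kernel of the iterated integral for \<open>A + B/2\<close>, and leave a power of
  \<open>|B|\<close> behind.
\<close>

lemma Whittaker_Laplace_transform:
  fixes A B :: "real^'n^'n" and \<alpha> \<beta> \<gamma> :: complex
  assumes A: "pos_def A" and B: "pos_def B"
    and \<gamma>\<beta>_plus: "Re (\<gamma> + \<beta>) > (real CARD('n) - 3) / 4"
    and \<gamma>\<beta>_minus: "Re (\<gamma> - \<beta>) > (real CARD('n) - 3) / 4"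
    and \<beta>\<alpha>: "Re (\<beta> - \<alpha>) > (real CARD('n) - 3) / 4"
  defines "q \<equiv> (of_nat CARD('n) + 1) / 4"
  defines "F \<equiv> \<lambda>Z. det_powr Z (\<gamma> - 2 * q) * exp (- of_real (trace (A ** Z)))
    * mv_Whittaker \<alpha> \<beta> (msqrt B ** Z ** msqrt B)"
  defines "G \<equiv> \<lambda>Y. det_powr Y (\<beta> - \<alpha> - q) * det_powr (mat 1 + Y) (\<alpha> + \<beta> - q)
    * det_powr (A + (1/2) *\<^sub>R B + msqrt B ** Y ** msqrt B) (- (\<gamma> + \<beta> + q))"
  shows "set_integrable sym_lborel {Z. pos_def Z} F"
    and "(LINT Z:{Z. pos_def Z}|sym_lborel. F Z) =
      det_powr B (\<beta> + q) * (mv_Gamma CARD('n) (\<gamma> + \<beta> + q) / mv_Gamma CARD('n) (\<beta> - \<alpha> + q))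
        * (LINT Y:{Y. pos_def Y}|sym_lborel. G Y)"
proof -
  define Bh where "Bh = msqrt B"
  have Bh: "pos_def Bh" "Bh ** Bh = B" using msqrt[OF B] by (auto simp: Bh_def)
  define E where "E = A + (1/2) *\<^sub>R B"
  define h :: complex where "h = (of_nat CARD('n) + 1) / 2"
  define b where "b = \<beta> - \<alpha> + q"
  define \<delta> where "\<delta> = \<gamma> + \<beta> + q"
  \<comment> \<open>\<open>b\<close>, \<open>\<delta>\<close> and \<open>c\<close> are the parameters of the hypergeometric function to come.\<close>
  define c where "c = \<gamma> - \<alpha> + 2 * q"
  have h2: "h = 2 * q" by (simp add: h_def q_def)
  have Re_q: "Re q = (real CARD('n) + 1) / 4" by (simp add: q_def)
  have Re_b: "Re b > (real CARD('n) - 1) / 2" using \<beta>\<alpha> by (simp add: b_def Re_q field_simps)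
  have Re_cb: "Re (c - b) > (real CARD('n) - 1) / 2" using \<gamma>\<beta>_minus by (simp add: b_def c_def Re_q field_simps)
  have Re_d: "Re \<delta> > (real CARD('n) - 1) / 2" using \<gamma>\<beta>_plus by (simp add: \<delta>_def Re_q field_simps)
  have exps: "b - h = \<beta> - \<alpha> - q" "\<delta> - c = \<alpha> + \<beta> - q" "\<delta> - h = (\<gamma> - 2 * q) + (\<beta> + q)"
    by (simp_all add: b_def \<delta>_def c_def h2)
  have PE: "pos_def (E - (1/2) *\<^sub>R (Bh ** Bh))" using A by (simp add: E_def Bh(2))
  define K where "K = (\<lambda>Y Z. (indicator {Y. pos_def Y} Y * indicator {Z. pos_def Z} Z) *\<^sub>R
     (det_powr Y (b - h) * det_powr (mat 1 + Y) (\<delta> - c) *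
     (det_powr Z (\<delta> - h) * exp (- of_real (trace ((E + Bh ** Y ** Bh) ** Z))))))"
  have it: "integrable sym_lborel (\<lambda>Z. LINT Y|sym_lborel. K Y Z)"
    "(LINT Z|sym_lborel. LINT Y|sym_lborel. K Y Z) = mv_Gamma CARD('n) \<delta> * (LINT Y|sym_lborel.
       indicator {Y. pos_def Y} Y *\<^sub>R (det_powr Y (b - h) * det_powr (mat 1 + Y) (\<delta> - c) * det_powr (E + Bh ** Y ** Bh) (- \<delta>)))"
    unfolding K_def h_def by (rule iterated_Whittaker_integral[OF Bh(1) PE Re_b Re_cb Re_d])+
  define k where "k = det_powr B (\<beta> + q) / mv_Gamma CARD('n) b"
  have F: "indicator {Z. pos_def Z} Z *\<^sub>R F Z = k * (LINT Y|sym_lborel. K Y Z)" for Z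
  proof (cases "pos_def Z")
    case False
    then show ?thesis by (simp add: K_def)
  next
    case True
    let ?W = "Bh ** Z ** Bh"
    let ?w = "\<lambda>Y. det_powr Y (\<beta> - \<alpha> - q) * det_powr (mat 1 + Y) (\<alpha> + \<beta> - q) * exp (- of_real (trace (?W ** Y)))"
    have tr: "trace ((E + Bh ** Y ** Bh) ** Z) = trace (A ** Z) + trace ?W / 2 + trace (?W ** Y)" for Y
    proof -
      have "trace (B ** Z) = trace (Bh ** (Bh ** Z))" by (simp add: Bh(2)[symmetric] matrix_mul_assoc)
      also have "\<dots> = trace ?W" by (rule trace_mul_sym)
      finally have 1: "trace (B ** Z) = trace ?W" .
      have "trace (Bh ** Y ** Bh ** Z) = trace ((Bh ** Y) ** (Bh ** Z))" by (simp add: matrix_mul_assoc)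
      also have "\<dots> = trace ((Bh ** Z) ** (Bh ** Y))" by (rule trace_mul_sym)
      finally have 2: "trace (Bh ** Y ** Bh ** Z) = trace (?W ** Y)" by (simp add: matrix_mul_assoc)
      have "trace (r *\<^sub>R X) = r * trace X" for r and X :: "real^'n^'n"
        by (simp add: trace_def sum_distrib_left)
      then show ?thesis by (simp add: E_def mult_add_distrib_both trace_add 1 2)
    qed
    have ex: "exp (- complex_of_real (trace ((E + Bh ** Y ** Bh) ** Z))) =
       exp (- of_real (trace (A ** Z))) * exp (- of_real (trace ?W / 2)) * exp (- of_real (trace (?W ** Y)))" for Y
      unfolding tr exp_add[symmetric] by simp
    have dZ: "det Z > 0" and dB: "det B > 0" using True B by (auto intro: pos_def_det_pos)
    have "det B = det Bh * det Bh" using det_mul[of Bh Bh] by (simp add: Bh(2))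
    then have dW: "det_powr ?W (\<beta> + q) = det_powr B (\<beta> + q) * det_powr Z (\<beta> + q)"
      by (intro det_powr_mult dB dZ) (simp add: det_mul)
    have dd: "det_powr Z (\<delta> - h) = det_powr Z (\<gamma> - 2 * q) * det_powr Z (\<beta> + q)"
      unfolding exps det_powr_def by (rule powr_add)
    have "(LINT Y|sym_lborel. K Y Z) = (LINT Y|sym_lborel. (det_powr Z (\<delta> - h) * exp (- of_real (trace (A ** Z)))
        * exp (- of_real (trace ?W / 2))) * (indicator {Y. pos_def Y} Y *\<^sub>R ?w Y))"
      unfolding K_def ex exps(1,2) using True by (intro Bochner_Integration.integral_cong refl) (simp add: mult_ac)
    also have "\<dots> = (det_powr Z (\<delta> - h) * exp (- of_real (trace (A ** Z))) * exp (- of_real (trace ?W / 2)))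
        * (LINT Y:{Y. pos_def Y}|sym_lborel. ?w Y)"
      unfolding set_lebesgue_integral_def by (rule integral_mult_right_zero)
    finally have K: "(LINT Y|sym_lborel. K Y Z) = \<dots>" .
    have "mv_Whittaker \<alpha> \<beta> ?W = det_powr ?W (\<beta> + q) * exp (- of_real (trace ?W / 2)) / mv_Gamma CARD('n) b
        * (LINT Y:{Y. pos_def Y}|sym_lborel. ?w Y)"
      unfolding mv_Whittaker_def Let_def q_def[symmetric] b_def[symmetric] ..
    then show ?thesis
      using True unfolding K F_def Bh_def[symmetric] dd dW k_def by (simp add: mult_ac)
  qed
  have G: "indicator {Y. pos_def Y} Y *\<^sub>R (det_powr Y (b - h) * det_powr (mat 1 + Y) (\<delta> - c) * det_powr (E + Bh ** Y ** Bh) (- \<delta>))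
     = indicator {Y. pos_def Y} Y *\<^sub>R G Y" for Y
    unfolding G_def exps E_def Bh_def unfolding \<delta>_def ..
  show "set_integrable sym_lborel {Z. pos_def Z} F"
    unfolding set_integrable_def F using it(1) by (rule integrable_mult_right)
  have "(LINT Z:{Z. pos_def Z}|sym_lborel. F Z) = k * (LINT Z|sym_lborel. LINT Y|sym_lborel. K Y Z)"
    unfolding set_lebesgue_integral_def F by (rule integral_mult_right_zero)
  also have "\<dots> = k * (mv_Gamma CARD('n) \<delta> * (LINT Y:{Y. pos_def Y}|sym_lborel. G Y))"
    unfolding it(2) G set_lebesgue_integral_def ..
  finally show "(LINT Z:{Z. pos_def Z}|sym_lborel. F Z) =
      det_powr B (\<beta> + q) * (mv_Gamma CARD('n) (\<gamma> + \<beta> + q) / mv_Gamma CARD('n) (\<beta> - \<alpha> + q))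
        * (LINT Y:{Y. pos_def Y}|sym_lborel. G Y)"
    by (simp add: k_def b_def \<delta>_def)
qed

section \<open>Euler integrals over the unit interval\<close>

lemma pos_def_inverse_minus_1_iff:
  fixes U :: "real^'n^'n"
  assumes U: "pos_def U"
  shows "pos_def (matrix_inv U - mat 1) \<longleftrightarrow> pos_def (mat 1 - U)"
    and "det (matrix_inv U - mat 1) = det (mat 1 - U) / det U"
proof -
  define R where "R = msqrt U"
  have R: "pos_def R" "R ** R = U" using msqrt[OF U] by (auto simp: R_def)
  \<comment> \<open>\<open>U\<^sup>-\<^sup>1 - I = L (I - U) L\<close>.\<close>
  define L where "L = matrix_inv R"
  have L: "pos_def L" unfolding L_def using R(1) by (rule pos_def_matrix_inv)
  have LR: "L ** R = mat 1" "R ** L = mat 1" unfolding L_def by (rule pos_def_inv[OF R(1)])+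
  have "L ** L ** U = L ** (L ** R) ** R" by (simp add: R(2)[symmetric] matrix_mul_assoc)
  then have "L ** L ** U = mat 1" by (simp add: LR)
  then have LL: "matrix_inv U = L ** L" by (rule matrix_inv_unique)
  have "L ** U ** L = (L ** R) ** (R ** L)" by (simp add: R(2)[symmetric] matrix_mul_assoc)
  then have LUL: "L ** U ** L = mat 1" by (simp add: LR)
  have eq: "L ** (mat 1 - U) ** transpose L = matrix_inv U - mat 1"
    using pos_def_symmetric[OF L] by (simp add: mult_add_distrib_both LL LUL)
  show "pos_def (matrix_inv U - mat 1) \<longleftrightarrow> pos_def (mat 1 - U)"
    unfolding eq[symmetric] by (rule pos_def_congruence_iff[OF pos_def_det_nonzero[OF L]])
  have "(matrix_inv U - mat 1) ** U = mat 1 - U"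
    by (simp add: mult_add_distrib_both pos_def_inv[OF U])
  then have "det (matrix_inv U - mat 1) * det U = det (mat 1 - U)" by (metis det_mul)
  then show "det (matrix_inv U - mat 1) = det (mat 1 - U) / det U"
    using pos_def_det_pos[OF U] by (simp add: field_simps)
qed

text \<open>
  The substitution \<open>I + Y = U\<^sup>-\<^sup>1\<close>: a translation followed by inversion.
\<close>

lemma has_bochner_integral_mv_beta_substitution:
  fixes H :: "real^'n^'n \<Rightarrow> complex"
  assumes H[measurable]: "H \<in> borel_measurable borel"
  shows "has_bochner_integral sym_lborel (\<lambda>Y. indicator {Y. pos_def Y} Y *\<^sub>R H Y) x \<longleftrightarrow>
    has_bochner_integral sym_lborel (\<lambda>U. indicator {U. 0 \<prec>\<^sub>L U \<and> U \<prec>\<^sub>L mat 1} U *\<^sub>R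
      ((1 / det U) ^ (CARD('n) + 1) *\<^sub>R H (matrix_inv U - mat 1))) x"
proof -
  let ?g = "\<lambda>Y. indicator {Y. pos_def Y} Y *\<^sub>R H Y"
  have tr: "transpose (0 :: real^'n^'n) = 0" "transpose (mat 1 :: real^'n^'n) = mat 1"
    by (simp_all add: transpose_mat) (simp add: transpose_def vec_eq_iff)
  have "has_bochner_integral sym_lborel ?g x \<longleftrightarrow> has_bochner_integral sym_lborel (\<lambda>Z. ?g (0 - Z)) x"
    by (rule has_bochner_integral_reflect[OF tr(1)]) measurable
  also have "\<dots> \<longleftrightarrow> has_bochner_integral sym_lborel (\<lambda>Z. ?g (0 - (mat 1 - Z))) x"
    by (rule has_bochner_integral_reflect[OF tr(2)]) measurable
  also have "(\<lambda>Z. ?g (0 - (mat 1 - Z))) = (\<lambda>W. indicator {W. pos_def W} W *\<^sub>R ?g (W - mat 1))"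
  proof
    fix W :: "real^'n^'n"
    have "pos_def W" if "pos_def (W - mat 1)" using pos_def_add[OF that pos_def_mat_1] by simp
    then show "?g (0 - (mat 1 - W)) = indicator {W. pos_def W} W *\<^sub>R ?g (W - mat 1)" by (auto simp: indicator_def)
  qed
  also have "has_bochner_integral sym_lborel (\<lambda>W. indicator {W. pos_def W} W *\<^sub>R ?g (W - mat 1)) x \<longleftrightarrow>
    has_bochner_integral sym_lborel (\<lambda>U. (indicator {U. pos_def U} U * (1 / det U) ^ (CARD('n) + 1)) *\<^sub>R ?g (matrix_inv U - mat 1)) x"
    by (rule has_bochner_integral_pos_def_inverse) measurable
  also have "(\<lambda>U. (indicator {U. pos_def U} U * (1 / det U) ^ (CARD('n) + 1)) *\<^sub>R ?g (matrix_inv U - mat 1)) =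
    (\<lambda>U. indicator {U. 0 \<prec>\<^sub>L U \<and> U \<prec>\<^sub>L mat 1} U *\<^sub>R
      ((1 / det U) ^ (CARD('n) + 1) *\<^sub>R H (matrix_inv U - mat 1)))"
  proof
    fix U :: "real^'n^'n"
    show "(indicator {U. pos_def U} U * (1 / det U) ^ (CARD('n) + 1)) *\<^sub>R ?g (matrix_inv U - mat 1) =
      indicator {U. 0 \<prec>\<^sub>L U \<and> U \<prec>\<^sub>L mat 1} U *\<^sub>R ((1 / det U) ^ (CARD('n) + 1) *\<^sub>R H (matrix_inv U - mat 1))"
      using pos_def_inverse_minus_1_iff(1)[of U] by (auto simp: indicator_def loewner_less_def)
  qed
  finally show ?thesis .
qed

lemma integral_eq_if_has_bochner_integral_iff:
  fixes f g :: "'a \<Rightarrow> complex"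
  assumes "\<And>x. has_bochner_integral M f x \<longleftrightarrow> has_bochner_integral N g x"
  shows "integral\<^sup>L M f = integral\<^sup>L N g"
  using assms by (metis has_bochner_integral_iff not_integrable_integral_eq)

text \<open>
  \<open>D + (U\<^sup>-\<^sup>1 - I)\<close> is a sum of positive definite matrices, and its product with \<open>U\<close> is \<open>I + (D - I) U\<close>.
\<close>

lemma Euler_kernel_det_pos:
  fixes D U :: "real^'n^'n"
  assumes D: "pos_def D" and U: "0 \<prec>\<^sub>L U" "U \<prec>\<^sub>L mat 1"
  shows "det (D + (matrix_inv U - mat 1)) = det (mat 1 + (D - mat 1) ** U) / det U"
    and "det (mat 1 + (D - mat 1) ** U) > 0"
proof -
  have PU: "pos_def U" and P1: "pos_def (mat 1 - U)" using U by (auto simp: loewner_less_def)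
  have "pos_def (D + (matrix_inv U - mat 1))"
    using D P1 pos_def_inverse_minus_1_iff(1)[OF PU] by (intro pos_def_add) auto
  then have pos: "det (D + (matrix_inv U - mat 1)) > 0" by (rule pos_def_det_pos)
  have dU: "det U > 0" using PU by (rule pos_def_det_pos)
  have "(D + (matrix_inv U - mat 1)) ** U = mat 1 + (D - mat 1) ** U"
    by (simp add: mult_add_distrib_both pos_def_inv[OF PU])
  then have eq: "det (D + (matrix_inv U - mat 1)) * det U = det (mat 1 + (D - mat 1) ** U)" by (metis det_mul)
  then show "det (D + (matrix_inv U - mat 1)) = det (mat 1 + (D - mat 1) ** U) / det U"
    using dU by (simp add: field_simps)
  show "det (mat 1 + (D - mat 1) ** U) > 0" using pos dU unfolding eq[symmetric] by simp
qed

text \<open>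
  Under \<open>I + Y = U\<^sup>-\<^sup>1\<close> each of \<open>|Y|\<close>, \<open>|I + Y|\<close> and \<open>|D + Y|\<close> becomes a quotient by \<open>|U|\<close>, and the exponents of
  \<open>|U|\<close> add up to that of an Euler integral.
\<close>

lemma integral_pos_def_eq_Euler_integral:
  fixes D :: "real^'n^'n"
  assumes D: "pos_def D"
  defines "h \<equiv> (of_nat CARD('n) + 1) / 2"
  shows "(LINT Y:{Y. pos_def Y}|sym_lborel. det_powr Y (b - h) * det_powr (mat 1 + Y) (\<delta> - c) * det_powr (D + Y) (- \<delta>)) =
    (LINT U:{U. 0 \<prec>\<^sub>L U \<and> U \<prec>\<^sub>L mat 1}|sym_lborel.
       det_powr U (c - b - h) * det_powr (mat 1 - U) (b - h) * det_powr (mat 1 + (D - mat 1) ** U) (- \<delta>))"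
proof -
  let ?H = "\<lambda>Y. det_powr Y (b - h) * det_powr (mat 1 + Y) (\<delta> - c) * det_powr (D + Y) (- \<delta>)"
  let ?e = "\<lambda>U. det_powr U (c - b - h) * det_powr (mat 1 - U) (b - h) * det_powr (mat 1 + (D - mat 1) ** U) (- \<delta>)"
  have pt: "indicator {U. 0 \<prec>\<^sub>L U \<and> U \<prec>\<^sub>L mat 1} U *\<^sub>R ((1 / det U) ^ (CARD('n) + 1) *\<^sub>R ?H (matrix_inv U - mat 1)) =
    indicator {U. 0 \<prec>\<^sub>L U \<and> U \<prec>\<^sub>L mat 1} U *\<^sub>R ?e U" for U
  proof (cases "0 \<prec>\<^sub>L U \<and> U \<prec>\<^sub>L mat 1")
    case True
    then have U: "0 \<prec>\<^sub>L U" "U \<prec>\<^sub>L mat 1" and PU: "pos_def U" "pos_def (mat 1 - U)" by (auto simp: loewner_less_def)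
    note dU = PU[THEN pos_def_det_pos]
    note w = Euler_kernel_det_pos[OF D U]
    let ?u = "ln (det U)" and ?v = "ln (det (mat 1 - U))" and ?w = "ln (det (mat 1 + (D - mat 1) ** U))"
    have dp: "det_powr (matrix_inv U - mat 1) s = exp (s * of_real (?v - ?u))"
      "det_powr (mat 1 + (matrix_inv U - mat 1)) s = exp (s * of_real (- ?u))"
      "det_powr (D + (matrix_inv U - mat 1)) s = exp (s * of_real (?w - ?u))"
      "det_powr U s = exp (s * of_real ?u)"
      "det_powr (mat 1 - U) s = exp (s * of_real ?v)"
      "det_powr (mat 1 + (D - mat 1) ** U) s = exp (s * of_real ?w)" for s
      using dU w(2)
      by (simp_all add: det_powr_def w(1) pos_def_inverse_minus_1_iff(2)[OF PU(1)] pos_def_det_inv[OF PU(1)]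
          of_real_powr_exp ln_div ln_inverse[unfolded inverse_eq_divide] del: of_real_divide)
    have "complex_of_real ((1 / det U) ^ (CARD('n) + 1)) = exp (of_real (- ?u)) ^ (CARD('n) + 1)"
    proof -
      have "exp (complex_of_real (- ?u)) = of_real (1 / det U)"
        using dU(1) unfolding exp_of_real by (simp add: exp_minus divide_inverse)
      then show ?thesis by (simp only: of_real_power)
    qed
    also have "\<dots> = exp (of_nat (CARD('n) + 1) * of_real (- ?u))" by (rule exp_of_nat_mult[symmetric])
    also have "of_nat (CARD('n) + 1) = 2 * h" by (simp add: h_def)
    finally have pow: "complex_of_real ((1 / det U) ^ (CARD('n) + 1)) = exp (2 * h * of_real (- ?u))" .
    \<comment> \<open>The exponent of \<open>|U|\<close> collects the Jacobian \<open>- 2 h\<close> and the three negative powers of \<open>|U|\<close>.\<close>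
    have expo: "2 * k * of_real (- u) + ((b - k) * of_real (v - u) + (\<delta> - c) * of_real (- u) + - \<delta> * of_real (w - u))
      = (c - b - k) * of_real u + (b - k) * of_real v + - \<delta> * of_real w" for k :: complex and u v w
      by (simp add: algebra_simps)
    show ?thesis
      unfolding scaleR_conv_of_real[of "(1 / det U) ^ (CARD('n) + 1)"] pow dp exp_add[symmetric] expo ..
  qed simp
  have "(LINT Y|sym_lborel. indicator {Y. pos_def Y} Y *\<^sub>R ?H Y) = (LINT U|sym_lborel.
     indicator {U. 0 \<prec>\<^sub>L U \<and> U \<prec>\<^sub>L mat 1} U *\<^sub>R ((1 / det U) ^ (CARD('n) + 1) *\<^sub>R ?H (matrix_inv U - mat 1)))"
    by (rule integral_eq_if_has_bochner_integral_iff, rule has_bochner_integral_mv_beta_substitution) measurable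
  then show ?thesis unfolding set_lebesgue_integral_def pt .
qed

lemma sets_unit_interval [measurable]: "{U :: real^'n^'n. 0 \<prec>\<^sub>L U \<and> U \<prec>\<^sub>L mat 1} \<in> sets borel"
proof -
  have m: "(\<lambda>U :: real^'n^'n. mat 1 - U) \<in> borel_measurable borel" by measurable
  have "{U :: real^'n^'n. 0 \<prec>\<^sub>L U \<and> U \<prec>\<^sub>L mat 1} = {U. pos_def U} \<inter> (\<lambda>U. mat 1 - U) -` {U. pos_def U}"
    by (auto simp: loewner_less_def)
  also have "\<dots> \<in> sets borel"
    using measurable_sets[OF m sets_pos_def] by (intro sets.Int sets_pos_def) simp
  finally show ?thesis .
qed

text \<open>
  The matrix analogue of Pfaff's transformation of the Gauss hypergeometric function; it comes from the
  substitution of \<open>I - U\<close> for \<open>U\<close>.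
\<close>

lemma Euler_integral_reflect:
  fixes D :: "real^'n^'n"
  assumes D: "pos_def D"
  shows "(LINT U:{U. 0 \<prec>\<^sub>L U \<and> U \<prec>\<^sub>L mat 1}|sym_lborel.
       det_powr U r * det_powr (mat 1 - U) s * det_powr (mat 1 + (D - mat 1) ** U) t) =
    det_powr D t * (LINT U:{U. 0 \<prec>\<^sub>L U \<and> U \<prec>\<^sub>L mat 1}|sym_lborel.
       det_powr U s * det_powr (mat 1 - U) r * det_powr (mat 1 - (mat 1 - matrix_inv D) ** U) t)"
proof -
  let ?S = "{U :: real^'n^'n. 0 \<prec>\<^sub>L U \<and> U \<prec>\<^sub>L mat 1}"
  let ?f = "\<lambda>U. indicator ?S U *\<^sub>R (det_powr U r * det_powr (mat 1 - U) s * det_powr (mat 1 + (D - mat 1) ** U) t)"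
  have tr: "transpose (mat 1 :: real^'n^'n) = mat 1" by (rule transpose_mat)
  have "(LINT U|sym_lborel. ?f U) = (LINT U|sym_lborel. ?f (mat 1 - U))"
    by (rule integral_eq_if_has_bochner_integral_iff, rule has_bochner_integral_reflect[OF tr]) measurable
  also have "\<dots> = (LINT U|sym_lborel. det_powr D t * (indicator ?S U *\<^sub>R
       (det_powr U s * det_powr (mat 1 - U) r * det_powr (mat 1 - (mat 1 - matrix_inv D) ** U) t)))"
  proof (intro Bochner_Integration.integral_cong refl)
    fix U :: "real^'n^'n"
    have S: "mat 1 - U \<in> ?S \<longleftrightarrow> U \<in> ?S" by (auto simp: loewner_less_def)
    show "?f (mat 1 - U) = det_powr D t * (indicator ?S U *\<^sub>R
       (det_powr U s * det_powr (mat 1 - U) r * det_powr (mat 1 - (mat 1 - matrix_inv D) ** U) t))"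
    proof (cases "U \<in> ?S")
      case True
      \<comment> \<open>\<open>I + (D - I) (I - U) = D (I - (I - D\<^sup>-\<^sup>1) U)\<close>.\<close>
      have "D ** (mat 1 - (mat 1 - matrix_inv D) ** U) = D - (D ** mat 1 - D ** matrix_inv D) ** U"
        by (simp add: mult_add_distrib_both matrix_mul_assoc)
      also have "\<dots> = mat 1 + (D - mat 1) ** (mat 1 - U)"
        by (simp add: pos_def_inv[OF D] mult_add_distrib_both)
      finally have eq: "det (mat 1 + (D - mat 1) ** (mat 1 - U)) = det D * det (mat 1 - (mat 1 - matrix_inv D) ** U)"
        by (metis det_mul)
      have "mat 1 - U \<in> ?S" using True S by simp
      then have "det (mat 1 + (D - mat 1) ** (mat 1 - U)) > 0" using D by (intro Euler_kernel_det_pos(2)) auto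
      then have "det (mat 1 - (mat 1 - matrix_inv D) ** U) > 0"
        using pos_def_det_pos[OF D] unfolding eq by (simp add: zero_less_mult_iff)
      then have "det_powr (mat 1 + (D - mat 1) ** (mat 1 - U)) t = det_powr D t * det_powr (mat 1 - (mat 1 - matrix_inv D) ** U) t"
        by (rule det_powr_mult[OF pos_def_det_pos[OF D] _ eq])
      then show ?thesis using S True by simp
    next
      case False
      then have "mat 1 - U \<notin> ?S" using S by simp
      with False show ?thesis by (simp only: indicator_def of_bool_def if_False scaleR_zero_left mult_zero_right)
    qed
  qed
  also have "\<dots> = det_powr D t * (LINT U|sym_lborel. indicator ?S U *\<^sub>R
       (det_powr U s * det_powr (mat 1 - U) r * det_powr (mat 1 - (mat 1 - matrix_inv D) ** U) t))"
    by (rule integral_mult_right_zero)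
  finally show ?thesis unfolding set_lebesgue_integral_def .
qed

lemma onorm_less_1_if_between:
  fixes C :: "real^'n^'n"
  assumes "0 \<prec>\<^sub>L C" "C \<prec>\<^sub>L mat 1"
  shows "onorm ((*v) C) < 1"
proof -
  have C: "pos_def C" and C1: "pos_def (mat 1 - C)" using assms by (auto simp: loewner_less_def)
  from pos_def_bounded_below[OF C1] obtain m where m: "m > 0" "\<And>x. m * (x \<bullet> x) \<le> x \<bullet> ((mat 1 - C) *v x)" by blast
  have hi: "x \<bullet> (C *v x) \<le> (1 - m) * (x \<bullet> x)" for x
  proof -
    have "x \<bullet> ((mat 1 - C) *v x) = x \<bullet> x - x \<bullet> (C *v x)"
      by (simp add: matrix_vector_mult_diff_rdistrib inner_diff_right)
    then show ?thesis using m(2)[of x] by argo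
  qed
  have lo: "0 \<le> x \<bullet> (C *v x)" for x using pos_def_inner[OF C, of x] by (cases "x = 0") auto
  have "0 < axis undefined 1 \<bullet> (C *v axis undefined 1)" by (intro pos_def_inner[OF C]) simp
  also have "\<dots> \<le> 1 - m" using hi[of "axis undefined 1"] by (simp add: inner_axis_axis)
  finally have r: "0 < 1 - m" .
  have "norm (C *v x) \<le> (1 - m) * norm x" for x
    by (rule symmetric_norm_bound[OF pos_def_symmetric[OF C] r lo hi])
  then have "onorm ((*v) C) \<le> 1 - m" by (rule onorm_bound[rotated]) (use r in simp)
  then show ?thesis using m(1) by simp
qed

section \<open>The two closed forms\<close>

theorem theorem2p3:
  fixes A B Bh Bmh C M :: "real^'n^'n"
    and \<alpha> \<beta> \<gamma> :: complex
    and p :: nat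
    and F :: "real^'n^'n \<Rightarrow> complex"
    and R1 R2 :: complex
    and \<nu> :: "real^'n^'n \<Rightarrow> real"
  assumes p: "p = CARD('n)"
    and A: "pos_def A"
    and B: "pos_def B"
    and \<gamma>\<beta>_plus: "Re (\<gamma> + \<beta>) > (real p - 3) / 4"
    and \<gamma>\<beta>_minus: "Re (\<gamma> - \<beta>) > (real p - 3) / 4"
    and \<beta>\<alpha>: "Re (\<beta> - \<alpha>) > (real p - 3) / 4"
    and Bh: "Bh = msqrt B"
    and Bmh: "Bmh = matrix_inv (msqrt B)"
    and C: "C = Bmh ** A ** Bmh - (1/2) *\<^sub>R mat 1"
    and \<nu>: "is_norm \<nu>"
    and M: "M = Bh ** matrix_inv (A + (1/2) *\<^sub>R B) ** Bh"
    and F: "F = (\<lambda>Z. det_powr Z (\<gamma> - (of_nat p + 1) / 2) * exp (- of_real (trace (A ** Z)))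
                  * mv_Whittaker \<alpha> \<beta> (Bh ** Z ** Bh))"
    and R1: "R1 = det_powr B (\<beta> + (of_nat p + 1) / 4)
              * (det_powr (A + (1/2) *\<^sub>R B) (- (\<gamma> + \<beta> + (of_nat p + 1) / 4))
                 * (mv_Gamma p (\<gamma> + \<beta> + (of_nat p + 1) / 4) * mv_Gamma p (\<gamma> - \<beta> + (of_nat p + 1) / 4)
                    / mv_Gamma p (\<gamma> - \<alpha> + (of_nat p + 1) / 2))
                 * mv_hyp2F1 ((of_nat p + 1) / 4 + \<beta> - \<alpha>) ((of_nat p + 1) / 4 + \<gamma> + \<beta>)
                     ((of_nat p + 1) / 2 + \<gamma> - \<alpha>) (mat 1 - M))"
    and R2: "R2 = det_powr B (\<beta> + (of_nat p + 1) / 4)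
              * (det_powr B (- (\<gamma> + \<beta> + (of_nat p + 1) / 4))
                 * (mv_Gamma p ((of_nat p + 1) / 4 + \<gamma> + \<beta>) * mv_Gamma p ((of_nat p + 1) / 4 + \<gamma> - \<beta>)
                    / mv_Gamma p ((of_nat p + 1) / 2 + \<gamma> - \<alpha>))
                 * mv_hyp2F1 ((of_nat p + 1) / 4 + \<gamma> - \<beta>) ((of_nat p + 1) / 4 + \<gamma> + \<beta>)
                     ((of_nat p + 1) / 2 + \<gamma> - \<alpha>) (- C))"
  shows "set_integrable sym_lborel {Z. pos_def Z} F
    \<and> ((0 \<prec>\<^sub>L M \<and> M \<prec>\<^sub>L mat 1) \<or> mat 1 \<prec>\<^sub>L 2 *\<^sub>R (Bmh ** A ** Bmh)
        \<longrightarrow> (LINT Z:{Z. pos_def Z}|sym_lborel. F Z) = R1)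
    \<and> (\<nu> C < 1 \<longrightarrow> (LINT Z:{Z. pos_def Z}|sym_lborel. F Z) = R2)
    \<and> ((0 \<prec>\<^sub>L C \<and> C \<prec>\<^sub>L mat 1)
          \<or> (0 \<prec>\<^sub>L (1/2) *\<^sub>R mat 1 - Bmh ** A ** Bmh \<and> (1/2) *\<^sub>R mat 1 - Bmh ** A ** Bmh \<prec>\<^sub>L mat 1)
        \<longrightarrow> onorm ((*v) C) < 1 \<and> (LINT Z:{Z. pos_def Z}|sym_lborel. F Z) = R2)"
proof -
  define q :: complex where "q = (of_nat p + 1) / 4"
  define a where "a = \<gamma> - \<beta> + q"
  define b where "b = \<beta> - \<alpha> + q"
  define c where "c = \<gamma> - \<alpha> + 2 * q"
  define \<delta> where "\<delta> = \<gamma> + \<beta> + q"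
  have q2: "(of_nat p + 1) / 2 = 2 * q" by (simp add: q_def)
  have Re_q: "Re q = (real p + 1) / 4" by (simp add: q_def)
  have Re_a: "Re a > (real p - 1) / 2" using \<gamma>\<beta>_minus by (simp add: a_def Re_q field_simps)
  have Re_b: "Re b > (real p - 1) / 2" using \<beta>\<alpha> by (simp add: b_def Re_q field_simps)
  have "c = a + b" by (simp add: a_def b_def c_def)
  moreover have "real p \<ge> 1" by (simp add: p Suc_leI)
  ultimately have Re_c: "Re c > (real p - 1) / 2" using Re_a Re_b by simp
  note nz = mv_Gamma_nonzero[OF Re_a] mv_Gamma_nonzero[OF Re_b] mv_Gamma_nonzero[OF Re_c]
  have Bh': "pos_def Bh" "Bh ** Bh = B" using msqrt[OF B] by (auto simp: Bh)
  have Bmh': "pos_def Bmh" "Bmh ** Bh = mat 1" "Bh ** Bmh = mat 1"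
    using pos_def_matrix_inv[OF Bh'(1)] pos_def_inv[OF Bh'(1)] by (auto simp: Bmh Bh)
  \<comment> \<open>\<open>D = I + C\<close> satisfies \<open>A + B/2 = Bh D Bh\<close> and \<open>M = D\<^sup>-\<^sup>1\<close>.\<close>
  define D where "D = C + mat 1"
  have D_eq: "D = Bmh ** A ** Bmh + (1/2) *\<^sub>R mat 1"
    by (simp add: D_def C vec_eq_iff mat_def)
  have D: "pos_def D"
    unfolding D_eq using pos_def_sandwich[OF Bmh'(1) A] pos_def_scaleR[OF pos_def_mat_1, of "1/2"]
    by (intro pos_def_add) auto
  have sand: "Bh ** (D + Y) ** Bh = A + (1/2) *\<^sub>R B + Bh ** Y ** Bh" for Y
  proof -
    have "Bh ** (Bmh ** A ** Bmh) ** Bh = (Bh ** Bmh) ** A ** (Bmh ** Bh)" by (simp add: matrix_mul_assoc)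
    then have "Bh ** (Bmh ** A ** Bmh) ** Bh = A" by (simp add: Bmh')
    then show ?thesis by (simp add: D_eq mult_add_distrib_both Bh')
  qed
  have det_B: "det B = det Bh * det Bh" using det_mul[of Bh Bh] by (simp add: Bh')
  have dB: "det B > 0" using B by (rule pos_def_det_pos)
  have det_E: "det_powr (A + (1/2) *\<^sub>R B + Bh ** Y ** Bh) s = det_powr B s * det_powr (D + Y) s" if "pos_def (D + Y)" for Y s
    by (rule det_powr_mult[OF dB pos_def_det_pos[OF that]]) (simp add: sand[symmetric] det_mul det_B)
  have E0: "det_powr (A + (1/2) *\<^sub>R B) s = det_powr B s * det_powr D s" for s
    using det_E[of 0 s] D by simp
  have M_eq: "M = matrix_inv D"
  proof (rule sym, rule matrix_inv_unique)
    let ?E = "A + (1/2) *\<^sub>R B"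
    have E: "Bh ** D ** Bh = ?E" using sand[of 0] by simp
    have PE: "pos_def ?E" unfolding E[symmetric] by (rule pos_def_sandwich[OF Bh'(1) D])
    have "M ** D = Bh ** matrix_inv ?E ** (Bh ** D ** Bh) ** Bmh"
      by (simp add: M matrix_mul_assoc[symmetric] Bmh')
    also have "\<dots> = Bh ** (matrix_inv ?E ** ?E) ** Bmh" by (simp add: E matrix_mul_assoc)
    finally show "M ** D = mat 1" by (simp add: pos_def_inv[OF PE] Bmh')
  qed
  let ?S = "{U :: real^'n^'n. 0 \<prec>\<^sub>L U \<and> U \<prec>\<^sub>L mat 1}"
  \<comment> \<open>The common Euler integral of both closed forms.\<close>
  define X where "X = (LINT U:?S|sym_lborel. det_powr U (c - b - 2 * q) * det_powr (mat 1 - U) (b - 2 * q)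
       * det_powr (mat 1 + (D - mat 1) ** U) (- \<delta>))"
  note W = Whittaker_Laplace_transform[OF A B \<gamma>\<beta>_plus[unfolded p] \<gamma>\<beta>_minus[unfolded p] \<beta>\<alpha>[unfolded p],
      folded p, folded q_def]
  have F': "F = (\<lambda>Z. det_powr Z (\<gamma> - 2 * q) * exp (- of_real (trace (A ** Z)))
      * mv_Whittaker \<alpha> \<beta> (msqrt B ** Z ** msqrt B))"
    unfolding F q2 Bh ..
  have int: "(LINT Z:{Z. pos_def Z}|sym_lborel. F Z) =
      det_powr B (\<beta> + q) * (mv_Gamma p \<delta> / mv_Gamma p b) * (det_powr B (- \<delta>) * X)"
  proof -
    have "(LINT Y:{Y. pos_def Y}|sym_lborel. det_powr Y (\<beta> - \<alpha> - q) * det_powr (mat 1 + Y) (\<alpha> + \<beta> - q)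
         * det_powr (A + (1/2) *\<^sub>R B + msqrt B ** Y ** msqrt B) (- (\<gamma> + \<beta> + q))) =
       (LINT Y|sym_lborel. det_powr B (- \<delta>) * (indicator {Y. pos_def Y} Y *\<^sub>R
         (det_powr Y (b - 2 * q) * det_powr (mat 1 + Y) (\<delta> - c) * det_powr (D + Y) (- \<delta>))))"
      unfolding set_lebesgue_integral_def
    proof (intro Bochner_Integration.integral_cong refl)
      fix Y :: "real^'n^'n"
      have e: "\<beta> - \<alpha> - q = b - 2 * q" "\<alpha> + \<beta> - q = \<delta> - c" "- (\<gamma> + \<beta> + q) = - \<delta>"
        by (simp_all add: b_def c_def \<delta>_def)
      show "indicator {Y. pos_def Y} Y *\<^sub>R (det_powr Y (\<beta> - \<alpha> - q) * det_powr (mat 1 + Y) (\<alpha> + \<beta> - q)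
         * det_powr (A + (1/2) *\<^sub>R B + msqrt B ** Y ** msqrt B) (- (\<gamma> + \<beta> + q))) =
        det_powr B (- \<delta>) * (indicator {Y. pos_def Y} Y *\<^sub>R
         (det_powr Y (b - 2 * q) * det_powr (mat 1 + Y) (\<delta> - c) * det_powr (D + Y) (- \<delta>)))"
        unfolding e Bh[symmetric] using det_E[OF pos_def_add[OF D], of Y "- \<delta>"]
        by (cases "pos_def Y") (simp_all add: mult_ac)
    qed
    also have "\<dots> = det_powr B (- \<delta>) * X"
      unfolding X_def using integral_pos_def_eq_Euler_integral[OF D, of b \<delta> c, folded p, unfolded q2]
      by (simp only: integral_mult_right_zero set_lebesgue_integral_def)
    finally show ?thesis using W(2) unfolding F' b_def \<delta>_def by simp
  qed
  have R2': "(LINT Z:{Z. pos_def Z}|sym_lborel. F Z) = R2"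
  proof -
    have e: "(of_nat p + 1) / 4 + \<gamma> + \<beta> = \<delta>" "(of_nat p + 1) / 4 + \<gamma> - \<beta> = a" "(of_nat p + 1) / 2 + \<gamma> - \<alpha> = c"
      "\<gamma> + \<beta> + (of_nat p + 1) / 4 = \<delta>"
      unfolding q2 q_def[symmetric] by (simp_all add: a_def c_def \<delta>_def)
    have ab: "c - a = b" "c - b = a" by (simp_all add: a_def b_def c_def)
    have "mv_hyp2F1 a \<delta> c (- C) = mv_Gamma p c / (mv_Gamma p a * mv_Gamma p b) * X"
    proof -
      have "mat 1 - (- C) ** U = mat 1 + (D - mat 1) ** U" for U
        by (simp add: D_def matrix_matrix_mult_def vec_eq_iff sum_negf)
      then show ?thesis unfolding mv_hyp2F1_def Let_def p[symmetric] q2 X_def ab by (simp only:)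
    qed
    then show ?thesis unfolding int R2 unfolding e unfolding q_def[symmetric] using nz by (simp add: field_simps)
  qed
  have R1': "(LINT Z:{Z. pos_def Z}|sym_lborel. F Z) = R1"
  proof -
    have e: "(of_nat p + 1) / 4 + \<gamma> + \<beta> = \<delta>" "(of_nat p + 1) / 4 + \<beta> - \<alpha> = b" "(of_nat p + 1) / 2 + \<gamma> - \<alpha> = c"
      "\<gamma> + \<beta> + (of_nat p + 1) / 4 = \<delta>" "\<gamma> - \<beta> + (of_nat p + 1) / 4 = a" "\<gamma> - \<alpha> + (of_nat p + 1) / 2 = c"
      unfolding q2 q_def[symmetric] by (simp_all add: a_def b_def c_def \<delta>_def)
    have ab: "c - b = a" by (simp add: a_def b_def c_def)
    have "det_powr D (- \<delta>) * mv_hyp2F1 b \<delta> c (mat 1 - M) = mv_Gamma p c / (mv_Gamma p b * mv_Gamma p a) * X"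
      unfolding mv_hyp2F1_def Let_def p[symmetric] q2 X_def ab M_eq Euler_integral_reflect[OF D] by simp
    then show ?thesis unfolding int R1 unfolding e unfolding q_def[symmetric] E0 using nz by (simp add: field_simps)
  qed
  have on: "onorm ((*v) C) < 1"
    if "(0 \<prec>\<^sub>L C \<and> C \<prec>\<^sub>L mat 1) \<or> (0 \<prec>\<^sub>L (1/2) *\<^sub>R mat 1 - Bmh ** A ** Bmh \<and> (1/2) *\<^sub>R mat 1 - Bmh ** A ** Bmh \<prec>\<^sub>L mat 1)"
    using that
  proof
    assume "0 \<prec>\<^sub>L C \<and> C \<prec>\<^sub>L mat 1"
    then show ?thesis by (intro onorm_less_1_if_between) auto
  next
    assume *: "0 \<prec>\<^sub>L (1/2) *\<^sub>R mat 1 - Bmh ** A ** Bmh \<and> (1/2) *\<^sub>R mat 1 - Bmh ** A ** Bmh \<prec>\<^sub>L mat 1"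
    have "(1/2) *\<^sub>R mat 1 - Bmh ** A ** Bmh = - C" by (simp add: C)
    with * have "onorm ((*v) (- C)) < 1" by (intro onorm_less_1_if_between) auto
    moreover have "(- C) *v x = - (C *v x)" for x
      by (simp add: matrix_vector_mult_def sum_negf vec_eq_iff)
    ultimately show ?thesis by (simp add: onorm_def)
  qed
  show ?thesis using W(1) R1' R2' on unfolding F' by blast
qed

end
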